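(* Let $C$ and $C'$ be row-finite, aperiodic, cofinal higher rank graphs with finitely many vertices (identities) and no sources, such that $\mathsf{B}(C)$ and $\mathsf{B}(C')$ are countably infinite. If $\mathscr{G}(C)\cong\mathscr{G}(C')$ as discrete groups, then $H_*(\mathcal{G}(C))\cong H_*(\mathcal{G}(C'))$.
   Context: Categories. $\mathbb{N}=\{0,1,2,\dots\}$, $\mathbb{N}^k$ ordered componentwise. A category $C$ is regarded as a set of arrows, with the set of identities (vertices) $C_o\subseteq C$; each arrow $a$ has a domain $\mathbf{d}(a)\in C_o$ and codomain $\mathbf{r}(a)\in C_o$, and $ab$ is defined exactly when $\mathbf{d}(a)=\mathbf{r}(b)$. Put $aC=\{ac : ac \text{ defined}\}$ and $XC=\bigcup_{x\in X}xC$. Elements $a,b$ are independent if $aC\cap bC=\varnothing$, otherwise dependent. A subset $X\subseteq aC$ is large in $aC$ if every $b\in aC$ is dependent on some element of $X$. Higher rank graphs. A $k$-graph ($k\ge 1$) is a countable category $C$ with a functor $d\colon C\to\mathbb{N}^k$ (the degree) such that whenever $d(a)=\mathbf{m}+\mathbf{n}$ there are unique $a_1,a_2\in C$ with $a=a_1a_2$, $d(a_1)=\mathbf{m}$, $d(a_2)=\mathbf{n}$. A higher rank graph is a $k$-graph for some $k$. It has no sources if for each $e\in C_o$ and $\mathbf{m}\in\mathbb{N}^k$ there is $x\in C$ with $\mathbf{r}(x)=e$, $d(x)=\mathbf{m}$; it is row finite if for each $e\in C_o$ and $\mathbf{m}\in\mathbb{N}^k$ the set of $x\in eC$ with $d(x)=\mathbf{m}$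 is finite. $C$ is aperiodic if for all $a\neq b$ in $C$ with $\mathbf{d}(a)=\mathbf{d}(b)$ there is $u\in C$ (with $au,bu$ defined) such that $au$ and $bu$ are independent. $C$ is cofinal if for all $e,f\in C_o$ there is a finite large subset $X$ of $fC$ such that for every $x\in X$ there is an arrow $a$ with $\mathbf{r}(a)=e$ and $\mathbf{d}(a)=\mathbf{d}(x)$. $\mathscr{G}(C)$ and $\mathsf{B}(C)$. A right ideal of $C$ is a (possibly empty) subset $R$ with $RC\subseteq R$; it is finitely generated if $R=XC$ with $X$ finite. A bijective morphism $\theta\colon R_1\to R_2$ of right ideals is a bijection with $\mathbf{d}(\theta(r))=\mathbf{d}(r)$ and $\theta(rc)=\theta(r)c$ whenever $rc$ is defined. $\mathsf{R}(C)$ is the inverse monoid of bijective morphisms between finitely generated right ideals under composition of partial bijections (zero: the empty function). In an inverse semigroup $S$ with zero, $a\le b$ means $a=ba^{-1}a$; a non-zero idempotent $e$ is essential if $ef\ne0$ for all non-zero idempotents $f$; $S^e$ is the inverse subsemigroup of $s\in S$ with $s^{-1}s$, $ss^{-1}$ essential; $s\,\sigma\,t$ iff some $z$ satisfies $z\le s,t$. Then $\mathscr{G}(C)=\mathsf{R}(C)^e/\sigma$. The Lenz congruence $\equiv$ is: $s\equiv t$ iff for each $0<x\le s$ there is a non-zero element below both $x$ and $t$, and for each $0<y\le t$ there is a non-zero element below both $y$ and $s$; $\mathsf{B}(C)=\mathsf{R}(C)/{\equiv}$. The groupoid $\mathcal{G}(C)$. A $k$-tiling of the $k$-graph $C$ is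 a family $w(\mathbf{m},\mathbf{n})\in C$ for $\mathbf{m}\le\mathbf{n}$ in $\mathbb{N}^k$ with $w(\mathbf{m},\mathbf{m})$ an identity, $w(\mathbf{m},\mathbf{n})w(\mathbf{n},\mathbf{p})=w(\mathbf{m},\mathbf{p})$ and $d(w(\mathbf{m},\mathbf{n}))=\mathbf{n}-\mathbf{m}$. $C^\infty$ is the set of $k$-tilings, $C^\infty(e)=\{w:w(\mathbf{0},\mathbf{0})=e\}$, and $\sigma^{\mathbf{p}}(w)(\mathbf{m},\mathbf{n})=w(\mathbf{p}+\mathbf{m},\mathbf{p}+\mathbf{n})$. If $\mathbf{d}(x)=w(\mathbf{0},\mathbf{0})$, then $xw$ is the unique $k$-tiling with $(xw)(\mathbf{0},d(x))=x$ and $\sigma^{d(x)}(xw)=w$. $\mathcal{G}(C)$ is the set of triples $(w_1,\mathbf{n},w_2)\in C^\infty\times\mathbb{Z}^k\times C^\infty$ for which there are $\mathbf{l},\mathbf{m}\in\mathbb{N}^k$ with $\mathbf{n}=\mathbf{l}-\mathbf{m}$ and $\sigma^{\mathbf{l}}(w_1)=\sigma^{\mathbf{m}}(w_2)$, with $\mathbf{d}(w_1,\mathbf{n},w_2)=(w_2,\mathbf{0},w_2)$, $\mathbf{r}(w_1,\mathbf{n},w_2)=(w_1,\mathbf{0},w_1)$, product $(w_1,\mathbf{m},w_2)(w_2,\mathbf{n},w_3)=(w_1,\mathbf{m}+\mathbf{n},w_3)$, and topology with base the sets $Z(x,y)=\{(xw,d(x)-d(y),yw): w\in C^\infty(\mathbf{d}(x))\}$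 for $\mathbf{d}(x)=\mathbf{d}(y)$; it is an étale Hausdorff groupoid. Groupoid homology (Matui). For an étale Hausdorff groupoid $G$ with totally disconnected, locally compact unit space $G^{(0)}$, let $G^{(n)}$ ($n\ge1$) be the space of composable strings $(g_1,\dots,g_n)$ and $C_c(G^{(n)},\mathbb{Z})$ the group of compactly supported continuous integer functions. For a local homeomorphism $\varphi$, $\varphi_*(f)(y)=\sum_{\varphi(x)=y}f(x)$. $H_*(G)$ is the homology of the complex $C_c(G^{(n)},\mathbb{Z})$ with $\partial_1=\mathbf{d}_*-\mathbf{r}_*$ and $\partial_n=\sum_{i=0}^n(-1)^i(d_i)_*$ for $n\ge2$, where $d_0$ deletes $g_1$, $d_n$ deletes $g_n$, and $d_i$ ($0<i<n$) replaces $g_i,g_{i+1}$ by $g_ig_{i+1}$. *)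

theory Defs
  imports "HOL-Analysis.Analysis" "HOL-Algebra.Coset"
begin

section \<open>Categories as sets of arrows\<close>

text \<open>Categories are single-sorted: objects are identified with their identity arrows. The product
  \<open>a \<cdot> b\<close> is meaningful only if \<open>src a = tgt b\<close>; its value elsewhere is arbitrary and never used.\<close>

record 'a cat =
  arrows :: "'a set"
  idents :: "'a set"
  src :: "'a \<Rightarrow> 'a"
  tgt :: "'a \<Rightarrow> 'a"
  cmp :: "'a \<Rightarrow> 'a \<Rightarrow> 'a"  (infixl \<open>\<cdot>\<index>\<close> 70)

locale category =
  fixes C :: "('a, 'm) cat_scheme" (structure)
  assumes idents_subset: "idents C \<subseteq> arrows C"
    and src_in: "a \<in> arrows C \<Longrightarrow> src C a \<in> idents C"
    and tgt_in: "a \<in> arrows C \<Longrightarrow> tgt C a \<in> idents C"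
    and src_ident: "e \<in> idents C \<Longrightarrow> src C e = e"
    and tgt_ident: "e \<in> idents C \<Longrightarrow> tgt C e = e"
    and cmp_closed: "a \<in> arrows C \<Longrightarrow> b \<in> arrows C \<Longrightarrow> src C a = tgt C b \<Longrightarrow> a \<cdot> b \<in> arrows C"
    and src_cmp: "a \<in> arrows C \<Longrightarrow> b \<in> arrows C \<Longrightarrow> src C a = tgt C b \<Longrightarrow> src C (a \<cdot> b) = src C b"
    and tgt_cmp: "a \<in> arrows C \<Longrightarrow> b \<in> arrows C \<Longrightarrow> src C a = tgt C b \<Longrightarrow> tgt C (a \<cdot> b) = tgt C a"
    and cmp_assoc: "a \<in> arrows C \<Longrightarrow> b \<in> arrows C \<Longrightarrow> c \<in> arrows C \<Longrightarrow>
      src C a = tgt C b \<Longrightarrow> src C b = tgt C c \<Longrightarrow> (a \<cdot> b) \<cdot> c = a \<cdot> (b \<cdot> c)"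
    and cmp_src: "a \<in> arrows C \<Longrightarrow> a \<cdot> src C a = a"
    and tgt_cmp_left: "a \<in> arrows C \<Longrightarrow> tgt C a \<cdot> a = a"

definition arrow_ideal :: "('a, 'm) cat_scheme \<Rightarrow> 'a \<Rightarrow> 'a set" where
  "arrow_ideal C a = {a \<cdot>\<^bsub>C\<^esub> c | c. c \<in> arrows C \<and> src C a = tgt C c}"

definition set_ideal :: "('a, 'm) cat_scheme \<Rightarrow> 'a set \<Rightarrow> 'a set" where
  "set_ideal C X = (\<Union>x\<in>X. arrow_ideal C x)"

definition independent_arrows :: "('a, 'm) cat_scheme \<Rightarrow> 'a \<Rightarrow> 'a \<Rightarrow> bool" where
  "independent_arrows C a b \<longleftrightarrow> arrow_ideal C a \<inter> arrow_ideal C b = {}"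

definition large_in :: "('a, 'm) cat_scheme \<Rightarrow> 'a set \<Rightarrow> 'a \<Rightarrow> bool" where
  "large_in C X a \<longleftrightarrow> X \<subseteq> arrow_ideal C a \<and>
    (\<forall>b\<in>arrow_ideal C a. \<exists>x\<in>X. \<not> independent_arrows C b x)"

definition aperiodic_cat :: "('a, 'm) cat_scheme \<Rightarrow> bool" where
  "aperiodic_cat C \<longleftrightarrow> (\<forall>a\<in>arrows C. \<forall>b\<in>arrows C. a \<noteq> b \<and> src C a = src C b \<longrightarrow>
    (\<exists>u\<in>arrows C. src C a = tgt C u \<and> independent_arrows C (a \<cdot>\<^bsub>C\<^esub> u) (b \<cdot>\<^bsub>C\<^esub> u)))"

definition cofinal_cat :: "('a, 'm) cat_scheme \<Rightarrow> bool" where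
  "cofinal_cat C \<longleftrightarrow> (\<forall>e\<in>idents C. \<forall>f\<in>idents C. \<exists>X. finite X \<and> large_in C X f \<and>
    (\<forall>x\<in>X. \<exists>a\<in>arrows C. tgt C a = e \<and> src C a = src C x))"


section \<open>Higher rank graphs\<close>

text \<open>\<open>\<nat>\<^sup>k\<close> is \<^typ>\<open>nat ^ 'k\<close>, whose library order is componentwise; \<open>k \<ge> 1\<close> since types are
  nonempty.\<close>

record ('a, 'k) hrg = "'a cat" +
  deg :: "'a \<Rightarrow> nat ^ 'k"

locale higher_rank_graph = category C
  for C :: "('a, 'k::finite, 'm) hrg_scheme" (structure) +
  assumes countable_arrows: "countable (arrows C)"
    and deg_ident: "e \<in> idents C \<Longrightarrow> deg C e = 0"
    and deg_cmp: "a \<in> arrows C \<Longrightarrow> b \<in> arrows C \<Longrightarrow> src C a = tgt C b \<Longrightarrow>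
      deg C (a \<cdot> b) = deg C a + deg C b"
    and unique_factorization: "a \<in> arrows C \<Longrightarrow> deg C a = m + n \<Longrightarrow>
      \<exists>!p\<in>arrows C \<times> arrows C. src C (fst p) = tgt C (snd p) \<and> a = fst p \<cdot> snd p \<and>
        deg C (fst p) = m \<and> deg C (snd p) = n"

definition no_sources :: "('a, 'k::finite, 'm) hrg_scheme \<Rightarrow> bool" where
  "no_sources C \<longleftrightarrow> (\<forall>e\<in>idents C. \<forall>m. \<exists>x\<in>arrows C. tgt C x = e \<and> deg C x = m)"

definition row_finite :: "('a, 'k::finite, 'm) hrg_scheme \<Rightarrow> bool" where
  "row_finite C \<longleftrightarrow> (\<forall>e\<in>idents C. \<forall>m. finite {x \<in> arrow_ideal C e. deg C x = m})"


section \<open>Inverse semigroups with zero\<close>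

text \<open>The following notions are meant for monoids whose multiplicative reduct is an inverse
  semigroup with zero; then inverses and the zero exist and are unique. (The inverse \<^const>\<open>m_inv\<close> of
  the library is the group inverse and is not suitable here.)\<close>

definition isg_inv :: "('s, 'm) monoid_scheme \<Rightarrow> 's \<Rightarrow> 's" where
  "isg_inv S s = (THE t. t \<in> carrier S \<and> s \<otimes>\<^bsub>S\<^esub> t \<otimes>\<^bsub>S\<^esub> s = s \<and> t \<otimes>\<^bsub>S\<^esub> s \<otimes>\<^bsub>S\<^esub> t = t)"

definition isg_zero :: "('s, 'm) monoid_scheme \<Rightarrow> 's" where
  "isg_zero S = (THE z. z \<in> carrier S \<and> (\<forall>s\<in>carrier S. z \<otimes>\<^bsub>S\<^esub> s = z \<and> s \<otimes>\<^bsub>S\<^esub> z = z))"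

definition isg_le :: "('s, 'm) monoid_scheme \<Rightarrow> 's \<Rightarrow> 's \<Rightarrow> bool" where
  "isg_le S a b \<longleftrightarrow> a = b \<otimes>\<^bsub>S\<^esub> (isg_inv S a \<otimes>\<^bsub>S\<^esub> a)"

definition nonzero_idempotents :: "('s, 'm) monoid_scheme \<Rightarrow> 's set" where
  "nonzero_idempotents S = {e \<in> carrier S. e \<otimes>\<^bsub>S\<^esub> e = e \<and> e \<noteq> isg_zero S}"

definition essential_idempotent :: "('s, 'm) monoid_scheme \<Rightarrow> 's \<Rightarrow> bool" where
  "essential_idempotent S e \<longleftrightarrow> e \<in> nonzero_idempotents S \<and>
    (\<forall>f\<in>nonzero_idempotents S. e \<otimes>\<^bsub>S\<^esub> f \<noteq> isg_zero S)"

definition essential_part :: "('s, 'm) monoid_scheme \<Rightarrow> ('s, 'm) monoid_scheme" where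
  "essential_part S = S\<lparr>carrier := {s \<in> carrier S.
     essential_idempotent S (isg_inv S s \<otimes>\<^bsub>S\<^esub> s) \<and>
     essential_idempotent S (s \<otimes>\<^bsub>S\<^esub> isg_inv S s)}\<rparr>"

definition sigma_congruence :: "('s, 'm) monoid_scheme \<Rightarrow> ('s \<times> 's) set" where
  "sigma_congruence S = {(s, t). s \<in> carrier S \<and> t \<in> carrier S \<and>
     (\<exists>z\<in>carrier S. isg_le S z s \<and> isg_le S z t)}"

definition lenz_congruence :: "('s, 'm) monoid_scheme \<Rightarrow> ('s \<times> 's) set" where
  "lenz_congruence S = {(s, t). s \<in> carrier S \<and> t \<in> carrier S \<and>
     (\<forall>x\<in>carrier S - {isg_zero S}. isg_le S x s \<longrightarrow>
        (\<exists>z\<in>carrier S - {isg_zero S}. isg_le S z x \<and> isg_le S z t)) \<and>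
     (\<forall>y\<in>carrier S - {isg_zero S}. isg_le S y t \<longrightarrow>
        (\<exists>z\<in>carrier S - {isg_zero S}. isg_le S z y \<and> isg_le S z s))}"

text \<open>The union below is the class of \<open>x \<otimes> y\<close> for any \<open>x \<in> X\<close>, \<open>y \<in> Y\<close> if \<open>r\<close> is a congruence.\<close>

definition quotient_monoid :: "('s, 'm) monoid_scheme \<Rightarrow> ('s \<times> 's) set \<Rightarrow> 's set monoid" where
  "quotient_monoid S r = \<lparr>carrier = carrier S // r,
     mult = (\<lambda>X Y. \<Union>x\<in>X. \<Union>y\<in>Y. r `` {x \<otimes>\<^bsub>S\<^esub> y}),
     one = r `` {\<one>\<^bsub>S\<^esub>}\<rparr>"


section \<open>The inverse monoid of bijective morphisms, and the derived group and monoid\<close>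

definition right_ideal :: "('a, 'm) cat_scheme \<Rightarrow> 'a set \<Rightarrow> bool" where
  "right_ideal C R \<longleftrightarrow> R \<subseteq> arrows C \<and> set_ideal C R \<subseteq> R"

definition fg_right_ideal :: "('a, 'm) cat_scheme \<Rightarrow> 'a set \<Rightarrow> bool" where
  "fg_right_ideal C R \<longleftrightarrow> right_ideal C R \<and> (\<exists>X. X \<subseteq> arrows C \<and> finite X \<and> R = set_ideal C X)"

text \<open>A bijective morphism from \<open>R\<^sub>1\<close> to \<open>R\<^sub>2\<close> is encoded as a partial function with domain \<open>R\<^sub>1\<close>
  and range \<open>R\<^sub>2\<close>, so that composition of partial bijections is the library's \<open>\<circ>\<^sub>m\<close>.\<close>

definition bij_morphism ::
    "('a, 'm) cat_scheme \<Rightarrow> ('a \<rightharpoonup> 'a) \<Rightarrow> 'a set \<Rightarrow> 'a set \<Rightarrow> bool" where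
  "bij_morphism C \<theta> R1 R2 \<longleftrightarrow> dom \<theta> = R1 \<and> bij_betw (the \<circ> \<theta>) R1 R2 \<and>
     (\<forall>r\<in>R1. src C (the (\<theta> r)) = src C r) \<and>
     (\<forall>r\<in>R1. \<forall>c\<in>arrows C. src C r = tgt C c \<longrightarrow>
        \<theta> (r \<cdot>\<^bsub>C\<^esub> c) = Some (the (\<theta> r) \<cdot>\<^bsub>C\<^esub> c))"

definition RC :: "('a, 'm) cat_scheme \<Rightarrow> ('a \<rightharpoonup> 'a) monoid" where
  "RC C = \<lparr>carrier = {\<theta>. \<exists>R1 R2. fg_right_ideal C R1 \<and> fg_right_ideal C R2 \<and> bij_morphism C \<theta> R1 R2},
     mult = (\<circ>\<^sub>m),
     one = Some |` arrows C\<rparr>"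

definition GC :: "('a, 'm) cat_scheme \<Rightarrow> ('a \<rightharpoonup> 'a) set monoid" where
  "GC C = quotient_monoid (essential_part (RC C)) (sigma_congruence (essential_part (RC C)))"

definition BC :: "('a, 'm) cat_scheme \<Rightarrow> ('a \<rightharpoonup> 'a) set monoid" where
  "BC C = quotient_monoid (RC C) (lenz_congruence (RC C))"


section \<open>The path groupoid of a higher rank graph\<close>

type_synonym ('a, 'k) tiling = "nat ^ 'k \<Rightarrow> nat ^ 'k \<Rightarrow> 'a"

text \<open>A tiling is a family indexed by the pairs \<open>m \<le> n\<close>; fixing its value at all other pairs makes
  equality of functions coincide with equality of families.\<close>

definition tilings :: "('a, 'k::finite, 'm) hrg_scheme \<Rightarrow> ('a, 'k) tiling set" where
  "tilings C = {w.
     (\<forall>m n. m \<le> n \<longrightarrow> w m n \<in> arrows C \<and> deg C (w m n) = n - m) \<and>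
     (\<forall>m. w m m \<in> idents C) \<and>
     (\<forall>m n p. m \<le> n \<and> n \<le> p \<longrightarrow> src C (w m n) = tgt C (w n p) \<and> w m n \<cdot>\<^bsub>C\<^esub> w n p = w m p) \<and>
     (\<forall>m n. \<not> m \<le> n \<longrightarrow> w m n = undefined)}"

definition tilings_at :: "('a, 'k::finite, 'm) hrg_scheme \<Rightarrow> 'a \<Rightarrow> ('a, 'k) tiling set" where
  "tilings_at C e = {w \<in> tilings C. w 0 0 = e}"

definition tshift :: "nat ^ 'k::finite \<Rightarrow> ('a, 'k) tiling \<Rightarrow> ('a, 'k) tiling" where
  "tshift p w = (\<lambda>m n. w (p + m) (p + n))"

definition prepend :: "('a, 'k::finite, 'm) hrg_scheme \<Rightarrow> 'a \<Rightarrow> ('a, 'k) tiling \<Rightarrow> ('a, 'k) tiling" where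
  "prepend C x w = (THE v. v \<in> tilings C \<and> v 0 (deg C x) = x \<and> tshift (deg C x) v = w)"

definition int_vec :: "nat ^ 'k::finite \<Rightarrow> int ^ 'k" where
  "int_vec m = (\<chi> i. int (m $ i))"

type_synonym ('a, 'k) gelem = "('a, 'k) tiling \<times> (int ^ 'k) \<times> ('a, 'k) tiling"

definition path_arrows :: "('a, 'k::finite, 'm) hrg_scheme \<Rightarrow> ('a, 'k) gelem set" where
  "path_arrows C = {(w1, n, w2). w1 \<in> tilings C \<and> w2 \<in> tilings C \<and>
     (\<exists>l m. n = int_vec l - int_vec m \<and> tshift l w1 = tshift m w2)}"

definition cylinder :: "('a, 'k::finite, 'm) hrg_scheme \<Rightarrow> 'a \<Rightarrow> 'a \<Rightarrow> ('a, 'k) gelem set" where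
  "cylinder C x y = {(prepend C x w, int_vec (deg C x) - int_vec (deg C y), prepend C y w) | w.
     w \<in> tilings_at C (src C x)}"

record 'g top_groupoid = "'g cat" +
  gtop :: "'g topology"

text \<open>The cylinder sets cover the groupoid and form a base, so the topology they generate is the
  one having them as a base.\<close>

definition path_groupoid :: "('a, 'k::finite, 'm) hrg_scheme \<Rightarrow> ('a, 'k) gelem top_groupoid" where
  "path_groupoid C = \<lparr>
     arrows = path_arrows C,
     idents = {(w, 0, w) | w. w \<in> tilings C},
     src = (\<lambda>(w1, n, w2). (w2, 0, w2)),
     tgt = (\<lambda>(w1, n, w2). (w1, 0, w1)),
     cmp = (\<lambda>(w1, m, w2) (w2', n, w3). (w1, m + n, w3)),
     gtop = topology_generated_by
       {cylinder C x y | x y. x \<in> arrows C \<and> y \<in> arrows C \<and> src C x = src C y}\<rparr>"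


section \<open>Groupoid homology\<close>

text \<open>A composable string \<open>(g\<^sub>1, \<dots>, g\<^sub>n)\<close> is a function on \<open>{1..n}\<close>, and the space of strings
  carries the subspace topology of the product topology. To have all chain groups in one type, the
  unit space (\<open>n = 0\<close>) is encoded as the strings of length one consisting of a unit.\<close>

definition strings :: "('g, 'm) top_groupoid_scheme \<Rightarrow> nat \<Rightarrow> (nat \<Rightarrow> 'g) set" where
  "strings G n = (if n = 0 then {1} \<rightarrow>\<^sub>E idents G
     else {s \<in> {1..n} \<rightarrow>\<^sub>E arrows G. \<forall>i\<in>{1..<n}. src G (s i) = tgt G (s (Suc i))})"

definition string_space :: "('g, 'm) top_groupoid_scheme \<Rightarrow> nat \<Rightarrow> (nat \<Rightarrow> 'g) topology" where
  "string_space G n = subtopology (product_topology (\<lambda>_. gtop G) {1..max 1 n}) (strings G n)"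

text \<open>For \<open>n \<ge> 2\<close> the case \<open>j = i\<close> does not occur if \<open>i = 0\<close> or \<open>i = n\<close>, so the outer faces delete
  \<open>g\<^sub>1\<close> and \<open>g\<^sub>n\<close>. For \<open>n = 1\<close> the two faces are source and range, whence \<open>\<partial>\<^sub>1\<close> below is the
  difference of the two pushforwards.\<close>

definition face :: "('g, 'm) top_groupoid_scheme \<Rightarrow> nat \<Rightarrow> nat \<Rightarrow> (nat \<Rightarrow> 'g) \<Rightarrow> nat \<Rightarrow> 'g" where
  "face G n i s = (if n = 1 then (\<lambda>j\<in>{1}. if i = 0 then src G (s 1) else tgt G (s 1))
     else (\<lambda>j\<in>{1..n - 1}. if j < i then s j else if j = i then s i \<cdot>\<^bsub>G\<^esub> s (Suc i) else s (Suc j)))"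

definition Cc :: "'x topology \<Rightarrow> ('x \<Rightarrow> int) set" where
  "Cc X = {f. continuous_map X (discrete_topology UNIV) f \<and>
     compactin X (X closure_of {x \<in> topspace X. f x \<noteq> 0}) \<and>
     (\<forall>x. x \<notin> topspace X \<longrightarrow> f x = 0)}"

text \<open>The sum runs over the part of the fibre where \<open>f\<close> does not vanish, which is finite if \<open>f\<close> is
  compactly supported and \<open>\<phi>\<close> is a local homeomorphism; the library's sum over an infinite fibre
  would be 0.\<close>

definition pushforward :: "'x topology \<Rightarrow> ('x \<Rightarrow> 'y) \<Rightarrow> ('x \<Rightarrow> int) \<Rightarrow> 'y \<Rightarrow> int" where
  "pushforward X \<phi> f y = (\<Sum>x | x \<in> topspace X \<and> \<phi> x = y \<and> f x \<noteq> 0. f x)"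

definition boundary_map ::
    "('g, 'm) top_groupoid_scheme \<Rightarrow> nat \<Rightarrow> ((nat \<Rightarrow> 'g) \<Rightarrow> int) \<Rightarrow> (nat \<Rightarrow> 'g) \<Rightarrow> int" where
  "boundary_map G n f t = (\<Sum>i\<le>n. (-1) ^ i * pushforward (string_space G n) (face G n i) f t)"

definition cycle_group ::
    "('g, 'm) top_groupoid_scheme \<Rightarrow> nat \<Rightarrow> ((nat \<Rightarrow> 'g) \<Rightarrow> int) monoid" where
  "cycle_group G n = \<lparr>
     carrier = {f \<in> Cc (string_space G n). n \<ge> 1 \<longrightarrow> boundary_map G n f = (\<lambda>_. 0)},
     mult = (\<lambda>f g x. f x + g x),
     one = (\<lambda>_. 0)\<rparr>"

definition groupoid_homology ::
    "('g, 'm) top_groupoid_scheme \<Rightarrow> nat \<Rightarrow> ((nat \<Rightarrow> 'g) \<Rightarrow> int) set monoid" where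
  "groupoid_homology G n =
     cycle_group G n Mod (boundary_map G (Suc n) ` Cc (string_space G (Suc n)))"

end

theory Submission
  imports Defs "HOL-Algebra.Bij"
begin

text \<open>The groupoid of \<open>C\<close> is the groupoid of germs of a group of homeomorphisms of the infinite path
  space \<open>X\<close> of \<open>C\<close>, and this group, as an abstract group, remembers its action on \<open>X\<close>.

  The group is the topological full group \<open>F\<close> of \<open>C\<close>: the bijections of \<open>X\<close> that locally replace an
  initial segment \<open>x\<close> of a path by another segment \<open>y\<close>. Aperiodicity makes \<open>y\<close> a function of the
  bijection and of \<open>x\<close>. An essential bijective morphism \<open>s\<close> acts on \<open>X\<close> by replacing segments in its
  domain, every element of \<open>F\<close> arises in this way because \<open>X\<close> is compact, and two morphisms act
  alike exactly if they have a common essential restriction. Hence \<open>F \<cong> GC C\<close>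
  (\<open>full_group_iso_GC\<close>).

  The reconstruction of the action from the group follows Fremlin's treatment of groups with many
  involutions. The group \<open>F\<close> contains, for every point and every neighbourhood of it, an involution
  that moves the point and is supported in the neighbourhood: by cofinality orbits are dense, and
  \<open>X\<close> has no isolated point, because an isolated path runs through a vertex from which it is the only
  path, and this contradicts aperiodicity as there are finitely many vertices
  (\<open>cyl_two_points\<close>). In such a group the elements supported in the support of an involution \<open>\<pi>\<close>
  are defined from \<open>\<pi>\<close> in terms of products alone (\<open>below_involution_eq\<close>). So a group isomorphism
  preserves inclusion of supports of involutions; by compactness the supports containing a point
  correspond to the supports containing a unique point of the other space, and this gives an
  equivariant homeomorphism (\<open>point_map_homeomorphism\<close>).

  An arrow of the groupoid of \<open>C\<close> is the germ of an element of \<open>F\<close> at a path: the middle component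
  in \<open>\<int>\<^sup>k\<close> of the arrow is the difference of the degrees of \<open>y\<close> and \<open>x\<close>, and the base sets \<open>Z(y, x)\<close>
  are sets of germs over cylinders. Therefore an equivariant homeomorphism induces an isomorphism
  of topological groupoids (\<open>germ_map_iso\<close>), and homology is invariant under those
  (\<open>homology_iso\<close>).\<close>

section \<open>Invariance of groupoid homology\<close>

text \<open>A topological isomorphism is given together with its inverse, so that every construction below is
  available in both directions through the sublocale \<open>inv\<close>; identities need no separate clause, being
  the arrows that equal their own source.\<close>

locale top_groupoid_iso =
  fixes G :: "('g, 'm) top_groupoid_scheme" and G' :: "('h, 'n) top_groupoid_scheme"
    and \<Phi> :: "'g \<Rightarrow> 'h" and \<Psi> :: "'h \<Rightarrow> 'g"
  assumes cat: "category G" and cat': "category G'"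
    and homeo: "homeomorphic_maps (gtop G) (gtop G') \<Phi> \<Psi>"
    and topspace_arrows: "topspace (gtop G) = arrows G"
    and topspace_arrows': "topspace (gtop G') = arrows G'"
    and src_map: "a \<in> arrows G \<Longrightarrow> src G' (\<Phi> a) = \<Phi> (src G a)"
    and tgt_map: "a \<in> arrows G \<Longrightarrow> tgt G' (\<Phi> a) = \<Phi> (tgt G a)"
    and cmp_map: "a \<in> arrows G \<Longrightarrow> b \<in> arrows G \<Longrightarrow> src G a = tgt G b \<Longrightarrow>
      \<Phi> (a \<cdot>\<^bsub>G\<^esub> b) = \<Phi> a \<cdot>\<^bsub>G'\<^esub> \<Phi> b"
begin

lemma map_in: "a \<in> arrows G \<Longrightarrow> \<Phi> a \<in> arrows G'"
  using homeo topspace_arrows topspace_arrows'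
  by (auto simp: homeomorphic_maps_def continuous_map_def Pi_iff)

lemma inv_in: "b \<in> arrows G' \<Longrightarrow> \<Psi> b \<in> arrows G"
  using homeo topspace_arrows topspace_arrows'
  by (auto simp: homeomorphic_maps_def continuous_map_def Pi_iff)

lemma inv_map: "a \<in> arrows G \<Longrightarrow> \<Psi> (\<Phi> a) = a"
  using homeo topspace_arrows by (auto simp: homeomorphic_maps_def)

lemma map_inv: "b \<in> arrows G' \<Longrightarrow> \<Phi> (\<Psi> b) = b"
  using homeo topspace_arrows' by (auto simp: homeomorphic_maps_def)

lemma src_in_arrows: "a \<in> arrows G \<Longrightarrow> src G a \<in> arrows G"
  and tgt_in_arrows: "a \<in> arrows G \<Longrightarrow> tgt G a \<in> arrows G"
  using cat by (auto dest: category.src_in category.tgt_in category.idents_subset)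

lemma sym: "top_groupoid_iso G' G \<Psi> \<Phi>"
proof (rule top_groupoid_iso.intro)
  show "category G'" "category G" by (rule cat' cat)+
  show "homeomorphic_maps (gtop G') (gtop G) \<Psi> \<Phi>"
    using homeo by (rule iffD1[OF homeomorphic_maps_sym])
  show "topspace (gtop G') = arrows G'" "topspace (gtop G) = arrows G"
    by (rule topspace_arrows topspace_arrows')+
  show s: "src G (\<Psi> a) = \<Psi> (src G' a)" if "a \<in> arrows G'" for a
    using that by (metis inv_in inv_map map_inv src_in_arrows src_map)
  show t: "tgt G (\<Psi> a) = \<Psi> (tgt G' a)" if "a \<in> arrows G'" for a
    using that by (metis inv_in inv_map map_inv tgt_in_arrows tgt_map)
  show "\<Psi> (a \<cdot>\<^bsub>G'\<^esub> b) = \<Psi> a \<cdot>\<^bsub>G\<^esub> \<Psi> b"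
    if "a \<in> arrows G'" "b \<in> arrows G'" "src G' a = tgt G' b" for a b
  proof -
    have "src G (\<Psi> a) = tgt G (\<Psi> b)" using that s t by metis
    then show ?thesis
      using that cmp_map[of "\<Psi> a" "\<Psi> b"] category.cmp_closed[OF cat, of "\<Psi> a" "\<Psi> b"]
      by (metis inv_in inv_map map_inv)
  qed
qed

lemma map_ident: "a \<in> idents G \<Longrightarrow> \<Phi> a \<in> idents G'"
  by (metis cat cat' category.idents_subset category.src_ident category.src_in map_in src_map subsetD)

end

lemma face_in_strings:
  fixes G :: "('g, 'm) top_groupoid_scheme"
  assumes "category G" "n \<ge> 1" "s \<in> strings G n" "i \<le> n"
  shows "face G n i s \<in> strings G (n - 1)"
proof (cases "n = 1")
  case True
  then have "s 1 \<in> arrows G" using assms by (auto simp: strings_def)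
  then show ?thesis
    using True category.src_in[OF assms(1)] category.tgt_in[OF assms(1)]
    by (auto simp: strings_def face_def)
next
  case False
  then have n: "n \<ge> 2" using assms by simp
  have a: "s j \<in> arrows G" if "1 \<le> j" "j \<le> n" for j
    using assms that n by (auto simp: strings_def)
  have c: "src G (s j) = tgt G (s (Suc j))" if "1 \<le> j" "j < n" for j
    using assms that n by (auto simp: strings_def)
  have m: "s j \<cdot>\<^bsub>G\<^esub> s (Suc j) \<in> arrows G" "tgt G (s j \<cdot>\<^bsub>G\<^esub> s (Suc j)) = tgt G (s j)"
      "src G (s j \<cdot>\<^bsub>G\<^esub> s (Suc j)) = src G (s (Suc j))" if "1 \<le> j" "j < n" for j
    using that a[of j] a[of "Suc j"] c[of j] category.cmp_closed[OF assms(1)]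
      category.tgt_cmp[OF assms(1)] category.src_cmp[OF assms(1)] by auto
  define s' where "s' = face G n i s"
  have s': "s' j = (if j < i then s j else if j = i then s i \<cdot>\<^bsub>G\<^esub> s (Suc i) else s (Suc j))"
    if "1 \<le> j" "j < n" for j
    using False that by (auto simp: s'_def face_def)
  have ar: "s' j \<in> arrows G" if "1 \<le> j" "j < n" for j
    using that a[of j] a[of "Suc j"] m(1)[of j] unfolding s'[OF that] by auto
  have "src G (s' j) = tgt G (s' (Suc j))" if "1 \<le> j" "Suc j < n" for j
  proof -
    have j: "1 \<le> Suc j" "Suc j < n" "j < n" using that by auto
    consider "Suc j < i" | "Suc j = i" | "j = i" | "i < j" by linarith
    then show ?thesis
    proof cases
      case 1 then show ?thesis using s' c that j by simp
    next
      case 2 then show ?thesis using s' c[of j] m(2)[of "Suc j"] that j by simp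
    next
      case 3 then show ?thesis using s' c[of "Suc j"] m(3)[of j] that j by simp
    next
      case 4 then show ?thesis using s' c[of "Suc j"] that j by simp
    qed
  qed
  moreover have "s' \<in> extensional {1..n - 1}" using False by (simp add: s'_def face_def)
  ultimately show ?thesis
    using n ar unfolding s'_def[symmetric] by (auto simp: strings_def PiE_iff)
qed

context top_groupoid_iso begin

definition string_map :: "nat \<Rightarrow> (nat \<Rightarrow> 'g) \<Rightarrow> nat \<Rightarrow> 'h" where
  "string_map n s = (\<lambda>j\<in>{1..max 1 n}. \<Phi> (s j))"

lemma string_in_arrows: "s \<in> strings G n \<Longrightarrow> j \<in> {1..max 1 n} \<Longrightarrow> s j \<in> arrows G"
  using category.idents_subset[OF cat] by (auto simp: strings_def PiE_iff split: if_splits)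

lemma string_map_in:
  assumes "s \<in> strings G n" shows "string_map n s \<in> strings G' n"
proof (cases "n = 0")
  case True
  then show ?thesis using assms map_ident by (auto simp: strings_def string_map_def)
next
  case False
  then have n: "max 1 n = n" by simp
  have "s j \<in> arrows G" if "1 \<le> j" "j \<le> n" for j
    using string_in_arrows[OF assms, of j] that n by simp
  moreover have "src G (s j) = tgt G (s (Suc j))" if "1 \<le> j" "j < n" for j
    using assms False that by (simp add: strings_def)
  ultimately show ?thesis using False
    by (simp add: strings_def string_map_def n PiE_iff map_in src_map tgt_map)
qed

lemma topspace_string_space: "topspace (string_space G n) = strings G n"
proof -
  have "strings G n \<subseteq> (\<Pi>\<^sub>E j\<in>{1..max 1 n}. arrows G)"
  proof
    fix s assume s: "s \<in> strings G n"
    then have "s \<in> extensional {1..max 1 n}"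
      by (cases "n = 0") (simp_all add: strings_def PiE_iff)
    then show "s \<in> (\<Pi>\<^sub>E j\<in>{1..max 1 n}. arrows G)"
      using string_in_arrows[OF s] by (simp add: PiE_iff)
  qed
  then show ?thesis by (simp add: string_space_def topspace_arrows Int_absorb1)
qed

lemma string_map_continuous:
  "continuous_map (string_space G n) (string_space G' n) (string_map n)"
proof -
  have "continuous_map (string_space G n) (gtop G') (\<lambda>s. \<Phi> (s j))" if "j \<in> {1..max 1 n}" for j
  proof -
    have "continuous_map (string_space G n) (gtop G) (\<lambda>s. s j)"
      unfolding string_space_def
      by (intro continuous_map_from_subtopology continuous_map_product_projection that)
    then have "continuous_map (string_space G n) (gtop G') (\<Phi> \<circ> (\<lambda>s. s j))"
      using homeo by (intro continuous_map_compose) (auto simp: homeomorphic_maps_def)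
    then show ?thesis by (simp add: o_def)
  qed
  then show ?thesis
    using string_map_in topspace_string_space
    unfolding string_space_def[of G']
    by (auto simp: continuous_map_in_subtopology continuous_map_componentwise string_map_def)
qed

end

sublocale top_groupoid_iso \<subseteq> inv: top_groupoid_iso G' G \<Psi> \<Phi>
  by (rule sym)

context top_groupoid_iso begin

lemma inv_string_map: "s \<in> strings G n \<Longrightarrow> inv.string_map n (string_map n s) = s"
  apply (rule ext)
  subgoal for j
    using string_in_arrows[of s n j]
    by (cases "n = 0") (auto simp: string_map_def inv.string_map_def inv_map strings_def PiE_iff extensional_def)
  done

end

context top_groupoid_iso begin

lemma string_homeo:
  "homeomorphic_maps (string_space G n) (string_space G' n) (string_map n) (inv.string_map n)"
  using string_map_continuous inv.string_map_continuous inv_string_map inv.inv_string_map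
  by (auto simp: homeomorphic_maps_def topspace_string_space inv.topspace_string_space)

lemma face_string_map:
  assumes "n \<ge> 1" "s \<in> strings G n" "i \<le> n"
  shows "face G' n i (string_map n s) = string_map (n - 1) (face G n i s)"
proof (cases "n = 1")
  case True
  then have "s 1 \<in> arrows G" using string_in_arrows[OF assms(2)] by simp
  then show ?thesis using True by (auto simp: face_def string_map_def src_map tgt_map)
next
  case False
  then have n: "max 1 n = n" "max 1 (n - 1) = n - 1" "n \<ge> 2" using assms by auto
  have "\<Phi> (s j \<cdot>\<^bsub>G\<^esub> s (Suc j)) = \<Phi> (s j) \<cdot>\<^bsub>G'\<^esub> \<Phi> (s (Suc j))" if "1 \<le> j" "j < n" for j
    using that assms n by (intro cmp_map) (auto simp: strings_def)
  then show ?thesis using n False assms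
    by (auto simp: face_def string_map_def fun_eq_iff)
qed

end

context top_groupoid_iso begin

text \<open>The value outside the strings is 0, as for the elements of \<^const>\<open>Cc\<close>; this makes \<open>chain_map\<close>
  invertible on all functions supported on strings.\<close>

definition chain_map :: "nat \<Rightarrow> ((nat \<Rightarrow> 'g) \<Rightarrow> int) \<Rightarrow> (nat \<Rightarrow> 'h) \<Rightarrow> int" where
  "chain_map n f t = (if t \<in> strings G' n then f (inv.string_map n t) else 0)"

lemma Cc_transport:
  assumes "homeomorphic_maps X Y a b" "f \<in> Cc X"
  shows "(\<lambda>y. if y \<in> topspace Y then f (b y) else 0) \<in> Cc Y"
proof -
  let ?g = "\<lambda>y. if y \<in> topspace Y then f (b y) else 0"
  have a: "continuous_map X Y a" "homeomorphic_map X Y a"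
    using assms(1) by (auto simp: homeomorphic_maps_def homeomorphic_map_maps)
  have "continuous_map Y (discrete_topology UNIV) (f \<circ> b)"
    using assms by (intro continuous_map_compose[of _ X]) (auto simp: homeomorphic_maps_def Cc_def)
  then have 1: "continuous_map Y (discrete_topology UNIV) ?g"
    by (rule continuous_map_eq) auto
  have "{y \<in> topspace Y. ?g y \<noteq> 0} = a ` {x \<in> topspace X. f x \<noteq> 0}"
    using assms(1) unfolding homeomorphic_maps_def continuous_map_def
    by (auto simp: image_iff Pi_iff) metis+
  then have "Y closure_of {y \<in> topspace Y. ?g y \<noteq> 0} = a ` (X closure_of {x \<in> topspace X. f x \<noteq> 0})"
    using homeomorphic_map_closure_of[OF a(2)] by auto
  then show ?thesis
    using 1 assms(2) image_compactin[OF _ a(1)] by (auto simp: Cc_def)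
qed

end

context top_groupoid_iso begin

lemma chain_map_Cc: "f \<in> Cc (string_space G n) \<Longrightarrow> chain_map n f \<in> Cc (string_space G' n)"
  using Cc_transport[OF string_homeo] unfolding chain_map_def[abs_def]
  by (simp add: inv.topspace_string_space)

text \<open>The fibres of a face map over corresponding strings are in bijection, by naturality of the faces.\<close>

lemma pushforward_chain_map:
  assumes "n \<ge> 1" "i \<le> n" "t \<in> strings G (n - 1)"
  shows "pushforward (string_space G' n) (face G' n i) (chain_map n f) (string_map (n - 1) t)
    = pushforward (string_space G n) (face G n i) f t"
proof -
  have F: "face G n i s \<in> strings G (n - 1)" if "s \<in> strings G n" for s
    using face_in_strings[OF cat] assms that by simp
  have "bij_betw (string_map n) {s \<in> strings G n. face G n i s = t \<and> f s \<noteq> 0}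
      {s \<in> strings G' n. face G' n i s = string_map (n - 1) t \<and> chain_map n f s \<noteq> 0}"
  proof (rule bij_betw_byWitness[where f' = "inv.string_map n"])
    show "string_map n ` {s \<in> strings G n. face G n i s = t \<and> f s \<noteq> 0}
        \<subseteq> {s \<in> strings G' n. face G' n i s = string_map (n - 1) t \<and> chain_map n f s \<noteq> 0}"
      using assms by (auto simp: string_map_in face_string_map chain_map_def inv_string_map)
    show "inv.string_map n ` {s \<in> strings G' n. face G' n i s = string_map (n - 1) t \<and> chain_map n f s \<noteq> 0}
        \<subseteq> {s \<in> strings G n. face G n i s = t \<and> f s \<noteq> 0}"
      using assms
      by (auto simp: inv.string_map_in inv.face_string_map chain_map_def inv_string_map split: if_splits)
  qed (auto simp: inv_string_map inv.inv_string_map)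
  note reindex = sum.reindex_bij_betw[OF this, of "chain_map n f", symmetric]
  show ?thesis
    unfolding pushforward_def topspace_string_space inv.topspace_string_space reindex
    by (rule sum.cong) (auto simp: chain_map_def string_map_in inv_string_map)
qed

lemma boundary_outside_strings:
  assumes "n \<ge> 1" "t \<notin> strings G (n - 1)"
  shows "boundary_map G n f t = 0"
proof -
  have "pushforward (string_space G n) (face G n i) f t = 0" if "i \<le> n" for i
    unfolding pushforward_def topspace_string_space
    using face_in_strings[OF cat assms(1) _ that] assms(2) by (intro sum.neutral) blast
  then show ?thesis by (simp add: boundary_map_def)
qed

end

context top_groupoid_iso begin

lemma boundary_chain_map:
  assumes n: "n \<ge> 1"
  shows "boundary_map G' n (chain_map n f) = chain_map (n - 1) (boundary_map G n f)"
proof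
  fix t
  show "boundary_map G' n (chain_map n f) t = chain_map (n - 1) (boundary_map G n f) t"
  proof (cases "t \<in> strings G' (n - 1)")
    case True
    define u where "u = inv.string_map (n - 1) t"
    have u: "u \<in> strings G (n - 1)" "string_map (n - 1) u = t"
      using True inv.string_map_in inv.inv_string_map by (auto simp: u_def)
    have "boundary_map G' n (chain_map n f) t = boundary_map G n f u"
      unfolding boundary_map_def using pushforward_chain_map[OF n _ u(1)] u(2)
      by (intro sum.cong) auto
    then show ?thesis using True by (simp add: chain_map_def u_def)
  next
    case False
    then show ?thesis using inv.boundary_outside_strings[OF n] by (simp add: chain_map_def)
  qed
qed

lemma chain_map_inverse:
  assumes "\<And>s. s \<notin> strings G n \<Longrightarrow> f s = 0"
  shows "inv.chain_map n (chain_map n f) = f"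
  using assms by (auto simp: fun_eq_iff chain_map_def inv.chain_map_def string_map_in inv_string_map)

lemma chain_map_add: "chain_map n (\<lambda>x. f x + g x) = (\<lambda>x. chain_map n f x + chain_map n g x)"
  by (auto simp: chain_map_def)

lemma Cc_outside: "f \<in> Cc (string_space G n) \<Longrightarrow> s \<notin> strings G n \<Longrightarrow> f s = 0"
  by (simp add: Cc_def topspace_string_space)

lemma cycle_chain_map:
  assumes "f \<in> carrier (cycle_group G n)"
  shows "chain_map n f \<in> carrier (cycle_group G' n)"
proof -
  have "chain_map (n - 1) (\<lambda>_. 0) = (\<lambda>_. 0)" by (auto simp: chain_map_def)
  then show ?thesis
    using assms by (simp add: cycle_group_def chain_map_Cc boundary_chain_map)
qed

definition boundaries :: "nat \<Rightarrow> ((nat \<Rightarrow> 'g) \<Rightarrow> int) set" where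
  "boundaries n = boundary_map G (Suc n) ` Cc (string_space G (Suc n))"

lemma boundaries_outside: "b \<in> boundaries n \<Longrightarrow> s \<notin> strings G n \<Longrightarrow> b s = 0"
  using boundary_outside_strings[of "Suc n"] by (auto simp: boundaries_def)

end

context top_groupoid_iso begin

lemma chain_map_boundaries_subset: "chain_map n ` boundaries n \<subseteq> inv.boundaries n"
proof -
  have "chain_map n (boundary_map G (Suc n) f) = boundary_map G' (Suc n) (chain_map (Suc n) f)" for f
    using boundary_chain_map[of "Suc n" f] by simp
  then show ?thesis
    using chain_map_Cc[of _ "Suc n"] by (auto simp: boundaries_def inv.boundaries_def)
qed

end

context top_groupoid_iso begin

lemma chain_map_boundaries: "chain_map n ` boundaries n = inv.boundaries n"
proof
  have "b \<in> chain_map n ` boundaries n" if "b \<in> inv.boundaries n" for b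
  proof
    show "b = chain_map n (inv.chain_map n b)"
      using inv.chain_map_inverse inv.boundaries_outside[OF that] by metis
    show "inv.chain_map n b \<in> boundaries n"
      using inv.chain_map_boundaries_subset that by auto
  qed
  then show "inv.boundaries n \<subseteq> chain_map n ` boundaries n" by blast
qed (rule chain_map_boundaries_subset)

text \<open>Homology classes are handled as sets of chains, so an isomorphism of homology is obtained by taking
  images under the chain map.\<close>

lemma homology_carrier:
  "K \<in> carrier (groupoid_homology G n) \<longleftrightarrow>
     (\<exists>z\<in>carrier (cycle_group G n). K = {\<lambda>x. b x + z x | b. b \<in> boundaries n})"
  by (auto simp: groupoid_homology_def FactGroup_def RCOSETS_def r_coset_def boundaries_def
      cycle_group_def)

lemma homology_class_inverse:
  assumes "K \<in> carrier (groupoid_homology G n)"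
  shows "inv.chain_map n ` chain_map n ` K = K"
proof -
  obtain z where z: "z \<in> carrier (cycle_group G n)" "K = {\<lambda>x. b x + z x | b. b \<in> boundaries n}"
    using assms homology_carrier by blast
  have "inv.chain_map n (chain_map n k) = k" if k: "k \<in> K" for k
  proof (rule chain_map_inverse)
    obtain b where b: "b \<in> boundaries n" "k = (\<lambda>x. b x + z x)" using k z by blast
    have "z \<in> Cc (string_space G n)" using z by (simp add: cycle_group_def)
    then show "k s = 0" if "s \<notin> strings G n" for s
      using boundaries_outside[OF b(1) that] Cc_outside[OF _ that] b(2) by simp
  qed
  then show ?thesis by (simp add: image_image)
qed

end

context top_groupoid_iso begin

lemma homology_class_map:
  assumes "K \<in> carrier (groupoid_homology G n)"
  shows "chain_map n ` K \<in> carrier (groupoid_homology G' n)"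
proof -
  obtain z where z: "z \<in> carrier (cycle_group G n)" "K = {\<lambda>x. b x + z x | b. b \<in> boundaries n}"
    using assms homology_carrier by blast
  have "chain_map n ` K = {\<lambda>x. b x + chain_map n z x | b. b \<in> chain_map n ` boundaries n}"
    unfolding z(2) Setcompr_eq_image image_image chain_map_add ..
  also have "\<dots> = {\<lambda>x. b x + chain_map n z x | b. b \<in> inv.boundaries n}"
    by (simp only: chain_map_boundaries)
  finally show ?thesis
    using cycle_chain_map[OF z(1)] inv.homology_carrier by blast
qed

end

context top_groupoid_iso begin

theorem homology_iso: "groupoid_homology G n \<cong> groupoid_homology G' n"
proof (rule is_isoI[OF isoI])
  show "(`) (chain_map n) \<in> hom (groupoid_homology G n) (groupoid_homology G' n)"
  proof (rule homI)
    fix K L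
    show "chain_map n ` (K \<otimes>\<^bsub>groupoid_homology G n\<^esub> L) =
        chain_map n ` K \<otimes>\<^bsub>groupoid_homology G' n\<^esub> chain_map n ` L"
      by (simp add: groupoid_homology_def FactGroup_def set_mult_def cycle_group_def
          chain_map_add image_UN)
  qed (rule homology_class_map)
  show "bij_betw ((`) (chain_map n)) (carrier (groupoid_homology G n))
      (carrier (groupoid_homology G' n))"
    by (rule bij_betw_byWitness[where f' = "(`) (inv.chain_map n)"])
      (simp_all add: homology_class_inverse inv.homology_class_inverse image_subset_iff
        homology_class_map inv.homology_class_map)
qed

end

section \<open>Reconstruction of a space from a group of homeomorphisms\<close>

definition centralizer :: "('g, 'm) monoid_scheme \<Rightarrow> 'g set \<Rightarrow> 'g set" where
  "centralizer F S = {g \<in> carrier F. \<forall>s\<in>S. g \<otimes>\<^bsub>F\<^esub> s = s \<otimes>\<^bsub>F\<^esub> g}"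

text \<open>If \<open>p\<close> is an involution in a rich group of homeomorphisms, these are elements of square 1 that live on
  the support of \<open>p\<close>, and all restrictions of \<open>p\<close> to invariant clopen sets are among them.\<close>

definition commuting_conjugates :: "('g, 'm) monoid_scheme \<Rightarrow> 'g \<Rightarrow> 'g set" where
  "commuting_conjugates F p = {f \<in> centralizer F {p}. f \<otimes>\<^bsub>F\<^esub> f = \<one>\<^bsub>F\<^esub> \<and>
     (\<forall>g\<in>centralizer F {p}. f \<otimes>\<^bsub>F\<^esub> (g \<otimes>\<^bsub>F\<^esub> f \<otimes>\<^bsub>F\<^esub> inv\<^bsub>F\<^esub> g) = (g \<otimes>\<^bsub>F\<^esub> f \<otimes>\<^bsub>F\<^esub> inv\<^bsub>F\<^esub> g) \<otimes>\<^bsub>F\<^esub> f)}"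

text \<open>The elements that commute with all \<open>commuting_conjugates\<close> act with square 1 on the support of \<open>p\<close>,
  so their squares live off the support; what commutes with these squares lives on the support.
  The definition refers to the group only, hence is preserved by isomorphisms.\<close>

definition below_involution :: "('g, 'm) monoid_scheme \<Rightarrow> 'g \<Rightarrow> 'g set" where
  "below_involution F p =
     centralizer F {f \<otimes>\<^bsub>F\<^esub> f | f. f \<in> centralizer F (commuting_conjugates F p)}"

definition involution :: "('g, 'm) monoid_scheme \<Rightarrow> 'g \<Rightarrow> bool" where
  "involution F p \<longleftrightarrow> p \<in> carrier F \<and> p \<otimes>\<^bsub>F\<^esub> p = \<one>\<^bsub>F\<^esub>"

lemma centralizer_iso:
  assumes "group F" "group F'" "h \<in> iso F F'" "S \<subseteq> carrier F" "g \<in> carrier F"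
  shows "h g \<in> centralizer F' (h ` S) \<longleftrightarrow> g \<in> centralizer F S"
proof -
  have "h g \<otimes>\<^bsub>F'\<^esub> h s = h s \<otimes>\<^bsub>F'\<^esub> h g \<longleftrightarrow> g \<otimes>\<^bsub>F\<^esub> s = s \<otimes>\<^bsub>F\<^esub> g" if "s \<in> S" for s
  proof -
    have s: "s \<in> carrier F" using that assms by blast
    then have "h (g \<otimes>\<^bsub>F\<^esub> s) = h g \<otimes>\<^bsub>F'\<^esub> h s" "h (s \<otimes>\<^bsub>F\<^esub> g) = h s \<otimes>\<^bsub>F'\<^esub> h g"
      using assms by (auto simp: iso_iff hom_def)
    moreover have "h (g \<otimes>\<^bsub>F\<^esub> s) = h (s \<otimes>\<^bsub>F\<^esub> g) \<longleftrightarrow> g \<otimes>\<^bsub>F\<^esub> s = s \<otimes>\<^bsub>F\<^esub> g"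
      using assms s by (intro inj_on_eq_iff[of h "carrier F"])
        (auto simp: iso_iff intro: monoid.m_closed[OF group.is_monoid])
    ultimately show ?thesis by simp
  qed
  then show ?thesis using assms by (auto simp: centralizer_def iso_iff)
qed

lemma centralizer_iso_image:
  assumes "group F" "group F'" "h \<in> iso F F'" "S \<subseteq> carrier F"
  shows "centralizer F' (h ` S) = h ` centralizer F S"
proof -
  have "centralizer F' (h ` S) \<subseteq> h ` carrier F" "centralizer F S \<subseteq> carrier F"
    using assms(3) by (auto simp: centralizer_def iso_iff)
  then show ?thesis using centralizer_iso[OF assms] by blast
qed

lemma commuting_conjugates_iso:
  assumes "group F" "group F'" "h \<in> iso F F'" "p \<in> carrier F"
  shows "commuting_conjugates F' (h p) = h ` commuting_conjugates F p"
proof -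
  interpret F: group F by fact
  interpret F': group F' by fact
  have hinj: "inj_on h (carrier F)" and hsurj: "carrier F' = h ` carrier F"
    using assms(3) by (auto simp: iso_iff)
  interpret group_hom F F' h
    using assms by unfold_locales (simp add: iso_iff)
  have C: "centralizer F' {h p} = h ` centralizer F {p}"
    using centralizer_iso_image[OF assms(1-3), of "{p}"] assms(4) by simp
  have Cc: "centralizer F {p} \<subseteq> carrier F" by (auto simp: centralizer_def)
  have inj: "h x = h y \<longleftrightarrow> x = y" if "x \<in> carrier F" "y \<in> carrier F" for x y
    using inj_on_eq_iff[OF hinj] that by blast
  have sq: "h f \<otimes>\<^bsub>F'\<^esub> h f = \<one>\<^bsub>F'\<^esub> \<longleftrightarrow> f \<otimes>\<^bsub>F\<^esub> f = \<one>\<^bsub>F\<^esub>" if "f \<in> carrier F" for f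
    using that inj[of "f \<otimes>\<^bsub>F\<^esub> f" "\<one>\<^bsub>F\<^esub>"] by simp
  have cc: "h f \<otimes>\<^bsub>F'\<^esub> (h g \<otimes>\<^bsub>F'\<^esub> h f \<otimes>\<^bsub>F'\<^esub> inv\<^bsub>F'\<^esub> h g) = (h g \<otimes>\<^bsub>F'\<^esub> h f \<otimes>\<^bsub>F'\<^esub> inv\<^bsub>F'\<^esub> h g) \<otimes>\<^bsub>F'\<^esub> h f \<longleftrightarrow>
      f \<otimes>\<^bsub>F\<^esub> (g \<otimes>\<^bsub>F\<^esub> f \<otimes>\<^bsub>F\<^esub> inv\<^bsub>F\<^esub> g) = (g \<otimes>\<^bsub>F\<^esub> f \<otimes>\<^bsub>F\<^esub> inv\<^bsub>F\<^esub> g) \<otimes>\<^bsub>F\<^esub> f"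
    if "f \<in> carrier F" "g \<in> carrier F" for f g
    using that inj[of "f \<otimes>\<^bsub>F\<^esub> (g \<otimes>\<^bsub>F\<^esub> f \<otimes>\<^bsub>F\<^esub> inv\<^bsub>F\<^esub> g)" "(g \<otimes>\<^bsub>F\<^esub> f \<otimes>\<^bsub>F\<^esub> inv\<^bsub>F\<^esub> g) \<otimes>\<^bsub>F\<^esub> f"] by simp
  have "h f \<in> commuting_conjugates F' (h p) \<longleftrightarrow> f \<in> commuting_conjugates F p"
    if f: "f \<in> carrier F" for f
  proof -
    have "h f \<in> h ` centralizer F {p} \<longleftrightarrow> f \<in> centralizer F {p}"
      using inj_on_image_mem_iff[OF hinj f Cc] .
    then show ?thesis
      unfolding commuting_conjugates_def C using sq[OF f] cc[OF f] Cc by auto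
  qed
  moreover have "commuting_conjugates F' (h p) \<subseteq> h ` carrier F" "commuting_conjugates F p \<subseteq> carrier F"
    using Cc by (auto simp: commuting_conjugates_def C)
  ultimately show ?thesis by blast
qed

lemma below_involution_iso:
  assumes "group F" "group F'" "h \<in> iso F F'" "p \<in> carrier F"
  shows "below_involution F' (h p) = h ` below_involution F p"
proof -
  interpret F: group F by fact
  have 1: "commuting_conjugates F p \<subseteq> carrier F"
    by (auto simp: commuting_conjugates_def centralizer_def)
  let ?C = "centralizer F (commuting_conjugates F p)"
  have 2: "{f \<otimes>\<^bsub>F'\<^esub> f | f. f \<in> h ` ?C} = h ` {f \<otimes>\<^bsub>F\<^esub> f | f. f \<in> ?C}"
  proof -
    have "h f \<otimes>\<^bsub>F'\<^esub> h f = h (f \<otimes>\<^bsub>F\<^esub> f)" if "f \<in> ?C" for f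
      using assms(3) that by (simp add: centralizer_def iso_iff hom_def)
    then show ?thesis by (auto simp: Setcompr_eq_image image_image)
  qed
  have "{f \<otimes>\<^bsub>F\<^esub> f | f. f \<in> ?C} \<subseteq> carrier F" by (auto simp: centralizer_def)
  then show ?thesis
    unfolding below_involution_def commuting_conjugates_iso[OF assms]
      centralizer_iso_image[OF assms(1-3) 1] 2
    by (rule centralizer_iso_image[OF assms(1-3)])
qed

lemma involution_iso:
  assumes "group F" "group F'" "h \<in> iso F F'" "p \<in> carrier F"
  shows "involution F' (h p) \<longleftrightarrow> involution F p"
proof -
  interpret F: group F by fact
  interpret F': group F' by fact
  have hinj: "inj_on h (carrier F)" and hsurj: "carrier F' = h ` carrier F"
    using assms(3) by (auto simp: iso_iff)
  interpret group_hom F F' h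
    using assms by unfold_locales (simp add: iso_iff)
  have "h (p \<otimes>\<^bsub>F\<^esub> p) = h \<one>\<^bsub>F\<^esub> \<longleftrightarrow> p \<otimes>\<^bsub>F\<^esub> p = \<one>\<^bsub>F\<^esub>"
    using assms(4) by (intro inj_on_eq_iff[OF hinj]) auto
  then show ?thesis using assms(4) by (simp add: involution_def)
qed

text \<open>The action of a group of homeomorphisms of a compact Hausdorff space with small involutions at every
  point (\<open>local_involution\<close>) and with the part of fullness that the reconstruction uses: an involution may
  be cut down to an invariant clopen set. The group acts through \<open>act\<close> rather than consisting of
  functions, so that only the abstract group enters the statements.\<close>

locale full_action = group F
  for F :: "('g, 'm) monoid_scheme" (structure) +
  fixes X :: "'x topology" and act :: "'g \<Rightarrow> 'x \<Rightarrow> 'x"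
  assumes compact: "compact_space X" and Hausdorff: "Hausdorff_space X"
    and act_continuous: "g \<in> carrier F \<Longrightarrow> continuous_map X X (act g)"
    and act_one: "w \<in> topspace X \<Longrightarrow> act \<one> w = w"
    and act_mult: "f \<in> carrier F \<Longrightarrow> g \<in> carrier F \<Longrightarrow> w \<in> topspace X \<Longrightarrow>
      act (f \<otimes> g) w = act f (act g w)"
    and faithful: "g \<in> carrier F \<Longrightarrow> (\<And>w. w \<in> topspace X \<Longrightarrow> act g w = w) \<Longrightarrow> g = \<one>"
    and involution_support_closed: "involution F p \<Longrightarrow> closedin X {w \<in> topspace X. act p w \<noteq> w}"
    and involution_cut: "involution F p \<Longrightarrow> openin X U \<Longrightarrow> closedin X U \<Longrightarrow>
      (\<And>w. w \<in> U \<Longrightarrow> act p w \<in> U) \<Longrightarrow>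
      \<exists>q\<in>carrier F. \<forall>w\<in>topspace X. act q w = (if w \<in> U then act p w else w)"
    and local_involution: "openin X U \<Longrightarrow> w \<in> U \<Longrightarrow>
      \<exists>p. involution F p \<and> act p w \<noteq> w \<and> (\<forall>v\<in>topspace X - U. act p v = v)"
begin

abbreviation "supp g \<equiv> {w \<in> topspace X. act g w \<noteq> w}"

lemma act_in: "g \<in> carrier F \<Longrightarrow> w \<in> topspace X \<Longrightarrow> act g w \<in> topspace X"
  using act_continuous by (auto simp: continuous_map_def)

lemma act_inv: 
  assumes "g \<in> carrier F" "w \<in> topspace X"
  shows "act (inv g) (act g w) = w" "act g (act (inv g) w) = w"
  using assms act_mult[of "inv g" g w] act_mult[of g "inv g" w] act_one by auto

lemma act_eqI:
  assumes "f \<in> carrier F" "g \<in> carrier F" "\<And>w. w \<in> topspace X \<Longrightarrow> act f w = act g w"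
  shows "f = g"
proof -
  have "inv g \<otimes> f = \<one>"
    using assms act_inv by (intro faithful) (auto simp: act_mult)
  then show ?thesis using assms by (metis inv_equality inv_inv inv_closed)
qed

lemma act_involution: "involution F p \<Longrightarrow> w \<in> topspace X \<Longrightarrow> act p (act p w) = w"
  using act_mult[of p p w] act_one by (simp add: involution_def)

lemma involutionI:
  assumes "p \<in> carrier F" "\<And>w. w \<in> topspace X \<Longrightarrow> act p (act p w) = w"
  shows "involution F p"
  using assms faithful[of "p \<otimes> p"] by (simp add: involution_def act_mult)

lemma moved_neighbourhood:
  assumes "g \<in> carrier F" "w \<in> topspace X" "act g w \<noteq> w" "openin X U" "w \<in> U"
  obtains A where "openin X A" "w \<in> A" "A \<subseteq> U" "\<forall>v\<in>A. act g v \<notin> A"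
proof -
  obtain B C where BC: "openin X B" "openin X C" "act g w \<in> B" "w \<in> C" "disjnt B C"
    using Hausdorff assms act_in unfolding Hausdorff_space_def by metis
  let ?A = "{v \<in> topspace X. act g v \<in> B} \<inter> C \<inter> U"
  have "openin X ?A"
    using BC assms by (intro openin_Int openin_continuous_map_preimage[OF act_continuous])
  then show thesis using BC assms by (intro that[of ?A]) (auto simp: disjnt_iff)
qed

lemma support_open: "g \<in> carrier F \<Longrightarrow> openin X (supp g)"
proof (subst openin_subopen, intro ballI)
  fix w assume g: "g \<in> carrier F" and w: "w \<in> supp g"
  then have w': "w \<in> topspace X" "act g w \<noteq> w" by auto
  obtain A where A: "openin X A" "w \<in> A" "A \<subseteq> topspace X" "\<forall>v\<in>A. act g v \<notin> A"
    by (rule moved_neighbourhood[OF g w' openin_topspace w'(1)])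
  have "A \<subseteq> supp g"
  proof
    fix v assume "v \<in> A"
    then show "v \<in> supp g" using A(3) A(4) by auto
  qed
  then show "\<exists>T. openin X T \<and> w \<in> T \<and> T \<subseteq> supp g" using A by blast
qed

text \<open>Let \<open>p\<close> move \<open>w\<close> to \<open>w'\<close>, and let \<open>q\<close> move \<open>w'\<close> but fix \<open>w\<close>. If \<open>q p q p\<close> were 1, then
  \<open>p (q w') = q w = w\<close>, hence \<open>q w' = w'\<close>.\<close>

lemma local_noninvolution:
  assumes U: "openin X U" and w: "w \<in> U"
  shows "\<exists>g\<in>carrier F. g \<otimes> g \<noteq> \<one> \<and> (\<forall>v\<in>topspace X - U. act g v = v)"
proof -
  obtain p where p: "involution F p" "act p w \<noteq> w" "\<forall>v\<in>topspace X - U. act p v = v"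
    using local_involution[OF U w] by blast
  have pc: "p \<in> carrier F" using p(1) by (simp add: involution_def)
  have wX: "w \<in> topspace X" using U w openin_subset by blast
  let ?w' = "act p w"
  have w'X: "?w' \<in> topspace X" using act_in[OF pc wX] .
  have "?w' \<in> U" using p act_involution[OF p(1) wX] w'X by (metis DiffI)
  moreover have "openin X (U - {w})"
    using U Hausdorff wX by (intro openin_diff closedin_Hausdorff_singleton) auto
  ultimately obtain q where q: "involution F q" "act q ?w' \<noteq> ?w'"
      "\<forall>v\<in>topspace X - (U - {w}). act q v = v"
    using local_involution[of "U - {w}" ?w'] p(2) by blast
  have qc: "q \<in> carrier F" using q(1) by (simp add: involution_def)
  let ?w'' = "act q ?w'"
  have w''X: "?w'' \<in> topspace X" using act_in[OF qc w'X] .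
  have "(q \<otimes> p) \<otimes> (q \<otimes> p) \<noteq> \<one>"
  proof
    assume "(q \<otimes> p) \<otimes> (q \<otimes> p) = \<one>"
    then have "act q (act p ?w'') = w"
      using act_one[OF wX] pc qc w'X w''X wX act_in by (metis act_mult m_closed)
    then have "act p ?w'' = act q w"
      using act_involution[OF q(1), of "act p ?w''"] act_in[OF pc w''X] by simp
    also have "act q w = w" using q(3) wX by blast
    finally have "?w'' = act p w" using act_involution[OF p(1) w''X] by simp
    then show False using q(2) by simp
  qed
  moreover have "act (q \<otimes> p) v = v" if "v \<in> topspace X - U" for v
    using that p(3) q(3) pc qc by (simp add: act_mult)
  ultimately show ?thesis using pc qc by blast
qed

text \<open>Supports of involutions are clopen, so the space is zero-dimensional.\<close>

lemma clopen_neighbourhood: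
  assumes "openin X U" "w \<in> U"
  obtains A where "openin X A" "closedin X A" "w \<in> A" "A \<subseteq> U"
proof -
  obtain p where p: "involution F p" "act p w \<noteq> w" "\<forall>v\<in>topspace X - U. act p v = v"
    using local_involution[OF assms] by blast
  have "w \<in> topspace X" using assms openin_subset by blast
  then show thesis
    using p support_open involution_support_closed
    by (intro that[of "supp p"]) (auto simp: involution_def)
qed

lemma commute_iff:
  assumes "f \<in> carrier F" "g \<in> carrier F"
  shows "f \<otimes> g = g \<otimes> f \<longleftrightarrow> (\<forall>w\<in>topspace X. act f (act g w) = act g (act f w))"
  using assms act_eqI[of "f \<otimes> g" "g \<otimes> f"] act_mult by (metis m_closed)

lemma disjoint_commute:
  assumes "f \<in> carrier F" "g \<in> carrier F" "\<And>w. w \<in> topspace X \<Longrightarrow> act f w = w \<or> act g w = w"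
  shows "f \<otimes> g = g \<otimes> f"
  unfolding commute_iff[OF assms(1,2)] using assms act_in
  by (metis act_inv(1))

text \<open>Otherwise \<open>f\<close> moves some small open set \<open>A\<close> off itself, away from the support of \<open>p\<close>. An element \<open>g\<close>
  supported in \<open>A\<close> commutes with \<open>p\<close>, so \<open>f\<close> commutes with \<open>g f g\<^sup>-\<^sup>1\<close>. On \<open>A\<close> the two products are
  \<open>g\<^sup>-\<^sup>1\<close> and \<open>g\<close>, whence \<open>g\<^sup>2 = 1\<close>; but \<open>g\<close> can be chosen with \<open>g\<^sup>2 \<noteq> 1\<close>.\<close>

lemma commuting_conjugates_support:
  assumes p: "involution F p" and f: "f \<in> commuting_conjugates F p"
    and w: "w \<in> topspace X" "act p w = w"
  shows "act f w = w"
proof (rule ccontr)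
  assume fw: "act f w \<noteq> w"
  have pc: "p \<in> carrier F" using p by (simp add: involution_def)
  have fc: "f \<in> carrier F" "f \<otimes> f = \<one>" "f \<otimes> p = p \<otimes> f"
    using f by (auto simp: commuting_conjugates_def centralizer_def)
  have "openin X (topspace X - supp p)" using involution_support_closed[OF p] by blast
  then obtain A where A: "openin X A" "w \<in> A" "A \<subseteq> topspace X - supp p"
      "\<And>v. v \<in> A \<Longrightarrow> act f v \<notin> A"
    using moved_neighbourhood[OF fc(1) w(1) fw] w by (metis (mono_tags, lifting) DiffI mem_Collect_eq)
  obtain g where g: "g \<in> carrier F" "g \<otimes> g \<noteq> \<one>" "\<And>v. v \<in> topspace X - A \<Longrightarrow> act g v = v"
    using local_noninvolution[OF A(1,2)] by blast
  have gp: "g \<in> centralizer F {p}"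
    using disjoint_commute[OF g(1) pc] g A by (auto simp: centralizer_def)
  have com: "f \<otimes> (g \<otimes> f \<otimes> inv g) = (g \<otimes> f \<otimes> inv g) \<otimes> f"
    using f gp by (auto simp: commuting_conjugates_def)
  have ginv: "act (inv g) v = v" if "v \<in> topspace X - A" for v
    using g that act_inv(1)[OF g(1), of v] by auto
  have gA: "act g v \<in> A" "act (inv g) v \<in> A" if "v \<in> A" for v
  proof -
    have v: "v \<in> topspace X" using that A by blast
    show "act g v \<in> A"
      using ginv[of "act g v"] act_inv[OF g(1) v] act_in[OF g(1) v] that by (metis DiffI)
    show "act (inv g) v \<in> A"
      using g(3)[of "act (inv g) v"] act_inv[OF g(1) v] act_in[of "inv g" v] g(1) v that
      by (metis DiffI inv_closed)
  qed
  have ff: "act f (act f v) = v" if "v \<in> topspace X" for v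
    using fc that act_mult[of f f v] act_one by simp
  have "act g v = act (inv g) v" if v: "v \<in> topspace X" for v
  proof (cases "v \<in> A")
    case True
    let ?k = "g \<otimes> f \<otimes> inv g"
    have k: "act ?k u = act g (act f (act (inv g) u))" if "u \<in> topspace X" for u
      using that g fc act_in by (simp add: act_mult)
    have 1: "act f (act ?k v) = act (inv g) v"
    proof -
      let ?u = "act (inv g) v"
      have u: "?u \<in> A" "?u \<in> topspace X" using gA True A by blast+
      then have "act g (act f ?u) = act f ?u"
        using g(3)[of "act f ?u"] A(4) act_in[OF fc(1)] by blast
      then show ?thesis using k v ff u by simp
    qed
    have 2: "act ?k (act f v) = act g v"
    proof -
      have "act f v \<in> topspace X - A" using A(4)[OF True] act_in[OF fc(1) v] by blast
      then show ?thesis using k[of "act f v"] ginv[of "act f v"] ff[OF v] by simp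
    qed
    have "act f (act ?k v) = act ?k (act f v)"
      using com commute_iff[of f ?k] fc g v by simp
    then show ?thesis using 1 2 by simp
  next
    case False
    then show ?thesis using g(3) ginv v by simp
  qed
  then have "act (g \<otimes> g) v = v" if "v \<in> topspace X" for v
    using that g act_mult act_inv(2)[OF g(1)] act_inv(1)[OF g(1)] by (metis)
  then show False using faithful[of "g \<otimes> g"] g by blast
qed

text \<open>A conjugate of \<open>q\<close> by an element commuting with \<open>p\<close> is \<open>p\<close> cut down to another invariant set, and any
  two cuts of \<open>p\<close> commute.\<close>

lemma cut_in_commuting_conjugates:
  assumes p: "involution F p" and U: "openin X U" "closedin X U"
    and inv: "\<And>w. w \<in> U \<Longrightarrow> act p w \<in> U"
    and q: "q \<in> carrier F" "\<And>w. w \<in> topspace X \<Longrightarrow> act q w = (if w \<in> U then act p w else w)"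
  shows "q \<in> commuting_conjugates F p"
proof -
  have pc: "p \<in> carrier F" using p by (simp add: involution_def)
  have UX: "U \<subseteq> topspace X" using U openin_subset by blast
  have inv': "act p w \<in> U \<longleftrightarrow> w \<in> U" if "w \<in> topspace X" for w
    using inv act_involution[OF p that] by metis
  have qinv: "involution F q"
    using q act_in[OF pc] act_involution[OF p] inv UX by (intro involutionI) auto
  have "q \<otimes> p = p \<otimes> q"
    unfolding commute_iff[OF q(1) pc] using q(2) act_in[OF pc] inv' by auto
  moreover have "q \<otimes> (g \<otimes> q \<otimes> inv g) = (g \<otimes> q \<otimes> inv g) \<otimes> q"
    if g: "g \<in> carrier F" "g \<otimes> p = p \<otimes> g" for g
  proof -
    let ?k = "g \<otimes> q \<otimes> inv g"
    have kc: "?k \<in> carrier F" using g q by simp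
    have gp: "act g (act p v) = act p (act g v)" if "v \<in> topspace X" for v
      using commute_iff[OF g(1) pc] g(2) that by blast
    have k: "act ?k v = (if act (inv g) v \<in> U then act p v else v)" if v: "v \<in> topspace X" for v
    proof -
      have "act ?k v = act g (act q (act (inv g) v))"
        using v g q act_in by (simp add: act_mult)
      then show ?thesis
        using q(2)[of "act (inv g) v"] gp[of "act (inv g) v"] act_in[of "inv g" v] g(1) v
        by (simp add: act_inv)
    qed
    have gp': "act (inv g) (act p v) = act p (act (inv g) v)" if v: "v \<in> topspace X" for v
      using gp[of "act (inv g) v"] g(1) v act_in[of "inv g" v] act_in[OF pc] act_inv[OF g(1)]
      by (metis inv_closed)
    have "act q (act ?k v) = act ?k (act q v)" if v: "v \<in> topspace X" for v
    proof -
      have "act p v \<in> topspace X" "act (inv g) v \<in> topspace X" using v act_in pc g by auto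
      then show ?thesis
        using k q(2) v gp' inv' by auto
    qed
    then show ?thesis using commute_iff[OF q(1) kc] by blast
  qed
  ultimately show ?thesis
    using q(1) qinv by (auto simp: commuting_conjugates_def centralizer_def involution_def)
qed

text \<open>Since \<open>f\<close> commutes with all cuts of \<open>p\<close>, it preserves their supports. These separate \<open>w\<close> from
  every point other than \<open>w\<close> and \<open>p w\<close>, so \<open>f\<close> maps \<open>w\<close> to one of these two points.\<close>

lemma square_fixes_support:
  assumes p: "involution F p" and f: "f \<in> centralizer F (commuting_conjugates F p)"
    and w: "w \<in> topspace X" "act p w \<noteq> w"
  shows "act (f \<otimes> f) w = w"
proof -
  have pc: "p \<in> carrier F" using p by (simp add: involution_def)
  have fc: "f \<in> carrier F" using f by (simp add: centralizer_def)
  have fw: "act f w \<in> topspace X" using act_in[OF fc] w by blast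
  have "act f w = w \<or> act f w = act p w"
  proof (rule ccontr)
    assume a: "\<not> ?thesis"
    have "closedin X {act f w, act p (act f w)}"
      using Hausdorff fw act_in[OF pc] by (intro closedin_Hausdorff_finite) auto
    moreover have "w \<notin> {act f w, act p (act f w)}"
      using a act_involution[OF p] fw w by (metis insertE singletonD)
    ultimately obtain A where A: "openin X A" "closedin X A" "w \<in> A"
        "A \<subseteq> topspace X - {act f w, act p (act f w)}"
      using clopen_neighbourhood[of "topspace X - {act f w, act p (act f w)}" w] w
      by (metis Diff_iff closedin_def)
    \<comment> \<open>The smallest invariant set containing \<open>A\<close>.\<close>
    define U where "U = A \<union> {v \<in> topspace X. act p v \<in> A}"
    have U: "openin X U" "closedin X U"
      unfolding U_def using A openin_continuous_map_preimage[OF act_continuous[OF pc]]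
        closedin_continuous_map_preimage[OF act_continuous[OF pc]]
      by (simp_all add: openin_Un closedin_Un)
    have AX: "A \<subseteq> topspace X" using A by blast
    have inv: "act p v \<in> U" if "v \<in> U" for v
      using that act_involution[OF p] act_in[OF pc] AX by (auto simp: U_def)
    obtain q where q: "q \<in> carrier F" "\<And>w. w \<in> topspace X \<Longrightarrow> act q w = (if w \<in> U then act p w else w)"
      using involution_cut[OF p U inv] by blast
    have "q \<in> commuting_conjugates F p"
      by (rule cut_in_commuting_conjugates[OF p U inv q])
    then have "f \<otimes> q = q \<otimes> f" using f by (simp add: centralizer_def)
    then have c: "act f (act q w) = act q (act f w)"
      using commute_iff[OF fc q(1)] w by blast
    have "w \<in> U" "act f w \<notin> U" using A a w fw by (auto simp: U_def)
    then have "act f (act p w) = act f w" using c q(2) w fw by simp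
    then show False
      using act_inv(1)[OF fc] act_in[OF pc] w by metis
  qed
  moreover have "f \<otimes> p = p \<otimes> f"
  proof -
    have "p \<in> commuting_conjugates F p"
      using act_in[OF pc]
      by (intro cut_in_commuting_conjugates[OF p openin_topspace closedin_topspace _ pc]) auto
    then show ?thesis using f by (simp add: centralizer_def)
  qed
  ultimately show ?thesis
    using act_mult[OF fc fc w(1)] commute_iff[OF fc pc] act_involution[OF p] w by metis
qed

theorem below_involution_eq:
  assumes p: "involution F p"
  shows "below_involution F p =
    {f \<in> carrier F. \<forall>w\<in>topspace X. act p w = w \<longrightarrow> act f w = w}"
proof (intro subset_antisym subsetI CollectI conjI ballI impI)
  fix f assume f: "f \<in> below_involution F p"
  then show fc: "f \<in> carrier F" by (simp add: below_involution_def centralizer_def)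
  fix w assume w: "w \<in> topspace X" "act p w = w"
  show "act f w = w"
  proof (rule ccontr)
    assume "act f w \<noteq> w"
    moreover have "openin X (topspace X - supp p)"
      using involution_support_closed[OF p] by blast
    ultimately obtain A where A: "openin X A" "w \<in> A" "A \<subseteq> topspace X - supp p"
        "\<And>v. v \<in> A \<Longrightarrow> act f v \<notin> A"
      using moved_neighbourhood[OF fc w(1)] w by (metis (mono_tags, lifting) DiffI mem_Collect_eq)
    obtain g where g: "g \<in> carrier F" "g \<otimes> g \<noteq> \<one>" "\<And>v. v \<in> topspace X - A \<Longrightarrow> act g v = v"
      using local_noninvolution[OF A(1,2)] by blast
    have "g \<otimes> k = k \<otimes> g" if k: "k \<in> commuting_conjugates F p" for k
    proof (rule disjoint_commute[OF g(1)])
      show "k \<in> carrier F" using k by (simp add: commuting_conjugates_def centralizer_def)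
      show "act g v = v \<or> act k v = v" if "v \<in> topspace X" for v
        using g(3) A(3) that commuting_conjugates_support[OF p k] by blast
    qed
    then have "g \<in> centralizer F (commuting_conjugates F p)"
      using g(1) by (simp add: centralizer_def)
    then have "f \<otimes> (g \<otimes> g) = (g \<otimes> g) \<otimes> f"
      using f by (auto simp: below_involution_def centralizer_def)
    then have c: "act f (act (g \<otimes> g) v) = act (g \<otimes> g) (act f v)" if "v \<in> topspace X" for v
      using commute_iff[OF fc, of "g \<otimes> g"] g that by simp
    have "act (g \<otimes> g) v = v" if v: "v \<in> topspace X" for v
    proof (cases "v \<in> A")
      case True
      have "act g (act f v) = act f v" using A(4)[OF True] g(3) act_in[OF fc v] by blast
      then have "act (g \<otimes> g) (act f v) = act f v"
        using act_mult[OF g(1) g(1)] act_in[OF fc v] by simp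
      then have "act f (act (g \<otimes> g) v) = act f v" using c[OF v] by simp
      then show ?thesis
        using act_inv(1)[OF fc] act_in[of "g \<otimes> g"] g(1) v by (metis m_closed)
    next
      case False
      then show ?thesis using g v by (simp add: act_mult)
    qed
    then show False using faithful[of "g \<otimes> g"] g by blast
  qed
next
  fix f assume f: "f \<in> {f \<in> carrier F. \<forall>w\<in>topspace X. act p w = w \<longrightarrow> act f w = w}"
  have "f \<otimes> (g \<otimes> g) = (g \<otimes> g) \<otimes> f" if g: "g \<in> centralizer F (commuting_conjugates F p)" for g
  proof -
    have gc: "g \<in> carrier F" using g by (simp add: centralizer_def)
    show ?thesis
      using f gc square_fixes_support[OF p g] by (intro disjoint_commute) auto
  qed
  then show "f \<in> below_involution F p"
    using f by (auto simp: below_involution_def centralizer_def)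
qed

end

text \<open>The inverse isomorphism \<open>h'\<close> is a parameter so that exchanging the two actions is an involution on
  the instances of this locale.\<close>

locale isomorphic_full_actions =
  A: full_action F X act + B: full_action F' X' act'
  for F :: "('g, 'm) monoid_scheme" and X :: "'x topology" and act
    and F' :: "('h, 'n) monoid_scheme" and X' :: "'y topology" and act' +
  fixes h :: "'g \<Rightarrow> 'h" and h' :: "'h \<Rightarrow> 'g"
  assumes h_iso: "h \<in> iso F F'"
    and h'_iso: "h' \<in> iso F' F"
    and h'_h: "g \<in> carrier F \<Longrightarrow> h' (h g) = g"
    and h_h': "k \<in> carrier F' \<Longrightarrow> h (h' k) = k"
begin

lemma h_in: "g \<in> carrier F \<Longrightarrow> h g \<in> carrier F'"
  using h_iso by (auto simp: iso_iff)

lemma h_mult: "f \<in> carrier F \<Longrightarrow> g \<in> carrier F \<Longrightarrow> h (f \<otimes>\<^bsub>F\<^esub> g) = h f \<otimes>\<^bsub>F'\<^esub> h g"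
  using h_iso by (auto simp: iso_iff hom_def)

lemma h_inj: "f \<in> carrier F \<Longrightarrow> g \<in> carrier F \<Longrightarrow> h f = h g \<longleftrightarrow> f = g"
  using h_iso by (auto simp: iso_iff inj_on_eq_iff)

lemma h'_in: "g \<in> carrier F' \<Longrightarrow> h' g \<in> carrier F"
  using h'_iso by (auto simp: iso_iff)

lemma involution_h: "p \<in> carrier F \<Longrightarrow> involution F' (h p) \<longleftrightarrow> involution F p"
  by (rule involution_iso[OF A.is_group B.is_group h_iso])

lemma sym: "isomorphic_full_actions F' X' act' F X act h' h"
  by (intro isomorphic_full_actions.intro isomorphic_full_actions_axioms.intro
      A.full_action_axioms B.full_action_axioms h'_iso h_iso h'_h h_h')

lemma support_mono_h:
  assumes "involution F p" "q \<in> carrier F" "A.supp q \<subseteq> A.supp p"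
  shows "B.supp (h q) \<subseteq> B.supp (h p)"
proof -
  have p: "p \<in> carrier F" "involution F' (h p)"
    using assms(1) involution_h by (auto simp: involution_def)
  have "q \<in> below_involution F p"
    using assms unfolding A.below_involution_eq[OF assms(1)] by auto
  then have "h q \<in> below_involution F' (h p)"
    unfolding below_involution_iso[OF A.is_group B.is_group h_iso p(1)] by blast
  then show ?thesis unfolding B.below_involution_eq[OF p(2)] by auto
qed

text \<open>The supports of the images of the involutions that move \<open>w\<close> have the finite intersection property: a
  small involution at \<open>w\<close> lies below finitely many of them, its image lies below their images, and it is
  not trivial. A point common to all of these closed sets exists by compactness.\<close>

lemma corresponding_point_exists:
  assumes w: "w \<in> topspace X"
  obtains v where "v \<in> topspace X'" "\<And>p. involution F p \<Longrightarrow> act p w \<noteq> w \<Longrightarrow> act' (h p) v \<noteq> v"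
proof -
  let ?P = "{p. involution F p \<and> act p w \<noteq> w}"
  let ?\<U> = "(\<lambda>p. B.supp (h p)) ` ?P"
  have "closedin X' C" if "C \<in> ?\<U>" for C
    using that B.involution_support_closed involution_h by (auto simp: involution_def)
  moreover have "\<Inter>\<F> \<noteq> {}" if \<F>: "finite \<F>" "\<F> \<subseteq> ?\<U>" for \<F>
  proof -
    obtain Q where Q: "finite Q" "Q \<subseteq> ?P" "\<F> = (\<lambda>p. B.supp (h p)) ` Q"
      using finite_subset_image[OF \<F>] by blast
    define U where "U = topspace X \<inter> (\<Inter>p\<in>Q. A.supp p)"
    have "openin X U"
    proof (cases "Q = {}")
      case False
      have "openin X (A.supp p)" if "p \<in> Q" for p
        using Q(2) that by (intro A.support_open) (auto simp: involution_def)
      then show ?thesis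
        unfolding U_def using Q(1) False by (intro openin_Int openin_topspace openin_INT2)
    qed (simp add: U_def)
    moreover have "w \<in> U" using Q w by (auto simp: U_def)
    ultimately obtain k where k: "involution F k" "act k w \<noteq> w" "\<forall>v\<in>topspace X - U. act k v = v"
      using A.local_involution by blast
    have kc: "k \<in> carrier F" using k by (simp add: involution_def)
    have "k \<noteq> \<one>\<^bsub>F\<^esub>" using k(2) A.act_one[OF w] by auto
    then have "h k \<noteq> \<one>\<^bsub>F'\<^esub>"
      using h_inj[OF kc A.one_closed] hom_one[of h F F'] h_iso A.is_group B.is_group by (simp add: iso_iff)
    then obtain v where v: "v \<in> B.supp (h k)"
      using B.faithful[OF h_in[OF kc]] by blast
    have "v \<in> B.supp (h p)" if "p \<in> Q" for p
    proof -
      have "A.supp k \<subseteq> A.supp p" using k(3) that by (auto simp: U_def)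
      then show ?thesis using support_mono_h[OF _ kc, of p] that Q(2) v by blast
    qed
    then show ?thesis using Q(3) by blast
  qed
  ultimately have ne: "\<Inter>?\<U> \<noteq> {}"
    using B.compact[unfolded compact_space_fip, rule_format, of ?\<U>] by simp
  then obtain v where v: "v \<in> \<Inter>?\<U>" by blast
  obtain p where "p \<in> ?P" using A.local_involution[OF openin_topspace w] by blast
  then have "v \<in> topspace X'" using v by blast
  then show thesis using v by (intro that[of v]) auto
qed

end

sublocale isomorphic_full_actions \<subseteq> inv: isomorphic_full_actions F' X' act' F X act h' h
  by (rule sym)

context isomorphic_full_actions begin

definition corresponds :: "'x \<Rightarrow> 'y \<Rightarrow> bool" where
  "corresponds w v \<longleftrightarrow> w \<in> topspace X \<and> v \<in> topspace X' \<and>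
     (\<forall>p. involution F p \<longrightarrow> (act' (h p) v \<noteq> v \<longleftrightarrow> act p w \<noteq> w))"

lemma points_separated:
  assumes "w \<in> topspace X" "u \<in> topspace X"
    and "\<And>p. involution F p \<Longrightarrow> act p w \<noteq> w \<Longrightarrow> act p u \<noteq> u"
  shows "w = u"
proof (rule ccontr)
  assume "w \<noteq> u"
  then obtain U where U: "openin X U" "w \<in> U" "u \<notin> U"
    using A.Hausdorff assms unfolding Hausdorff_space_def disjnt_iff by metis
  then show False using A.local_involution[OF U(1,2)] assms by blast
qed

text \<open>Going to the other space and back yields a point moved by every involution that moves \<open>w\<close>; such a
  point can only be \<open>w\<close>, so neither of the two passages enlarged the set of involutions.\<close>

lemma corresponds_exists:
  assumes w: "w \<in> topspace X"
  shows "\<exists>v. corresponds w v"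
proof -
  obtain v where v: "v \<in> topspace X'" "\<And>p. involution F p \<Longrightarrow> act p w \<noteq> w \<Longrightarrow> act' (h p) v \<noteq> v"
    using corresponding_point_exists[OF w] by blast
  obtain u where u: "u \<in> topspace X" "\<And>p. involution F' p \<Longrightarrow> act' p v \<noteq> v \<Longrightarrow> act (h' p) u \<noteq> u"
    using inv.corresponding_point_exists[OF v(1)] by blast
  have vu: "act p u \<noteq> u" if "involution F p" "act' (h p) v \<noteq> v" for p
    using u(2)[of "h p"] that involution_h h'_h by (auto simp: involution_def)
  have "w = u" using points_separated[OF w u(1)] v(2) vu by blast
  then show ?thesis using w v vu by (auto simp: corresponds_def)
qed

end

context isomorphic_full_actions begin

lemma corresponds_imp_inv:
  assumes "corresponds w v" shows "inv.corresponds v w"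
proof -
  have "act (h' p) w \<noteq> w \<longleftrightarrow> act' p v \<noteq> v" if p: "involution F' p" for p
  proof -
    have pc: "p \<in> carrier F'" using p by (simp add: involution_def)
    then have "involution F (h' p)" using p inv.involution_h by simp
    then show ?thesis using assms h_h'[OF pc] unfolding corresponds_def by metis
  qed
  then show ?thesis using assms by (simp add: corresponds_def inv.corresponds_def)
qed

lemma corresponds_unique_left: "corresponds w v \<Longrightarrow> corresponds u v \<Longrightarrow> w = u"
  using points_separated[of w u] by (auto simp: corresponds_def)

end

context isomorphic_full_actions begin

lemma corresponds_sym: "corresponds w v \<longleftrightarrow> inv.corresponds v w"
  using corresponds_imp_inv inv.corresponds_imp_inv by blast

lemma corresponds_unique_right: "corresponds w v \<Longrightarrow> corresponds w u \<Longrightarrow> v = u"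
  using inv.corresponds_unique_left unfolding corresponds_sym by blast

text \<open>Involutions moving \<open>g w\<close> are the conjugates by \<open>g\<close> of the involutions moving \<open>w\<close>.\<close>

lemma corresponds_act:
  assumes wv: "corresponds w v" and g: "g \<in> carrier F"
  shows "corresponds (act g w) (act' (h g) v)"
proof -
  have w: "w \<in> topspace X" "v \<in> topspace X'" using wv by (auto simp: corresponds_def)
  have "act' (h p) (act' (h g) v) \<noteq> act' (h g) v \<longleftrightarrow> act p (act g w) \<noteq> act g w" if p: "involution F p" for p
  proof -
    let ?q = "inv\<^bsub>F\<^esub> g \<otimes>\<^bsub>F\<^esub> p \<otimes>\<^bsub>F\<^esub> g"
    have pc: "p \<in> carrier F" using p by (simp add: involution_def)
    have ig: "h (inv\<^bsub>F\<^esub> g) = inv\<^bsub>F'\<^esub> (h g)"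
      using g h_iso group_hom.hom_inv[of F F' h g] A.is_group B.is_group
      by (simp add: group_hom_def group_hom_axioms_def iso_iff)
    have 1: "act ?q w = act (inv\<^bsub>F\<^esub> g) (act p (act g w))"
      using g pc w A.act_in by (simp add: A.act_mult)
    have 2: "act' (h ?q) v = act' (inv\<^bsub>F'\<^esub> (h g)) (act' (h p) (act' (h g) v))"
      using g pc w B.act_in h_in by (simp add: h_mult ig B.act_mult)
    have "?q \<otimes>\<^bsub>F\<^esub> ?q = inv\<^bsub>F\<^esub> g \<otimes>\<^bsub>F\<^esub> (p \<otimes>\<^bsub>F\<^esub> p) \<otimes>\<^bsub>F\<^esub> g"
      using g pc by (simp add: A.m_assoc A.inv_solve_left' flip: A.m_assoc[of g "inv\<^bsub>F\<^esub> g"])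
    then have "involution F ?q" using p g pc by (simp add: involution_def)
    then have "act' (h ?q) v \<noteq> v \<longleftrightarrow> act ?q w \<noteq> w" using wv by (simp add: corresponds_def)
    moreover have "act ?q w = w \<longleftrightarrow> act p (act g w) = act g w"
      unfolding 1 using g pc w A.act_in A.act_inv by metis
    moreover have "act' (h ?q) v = v \<longleftrightarrow> act' (h p) (act' (h g) v) = act' (h g) v"
      unfolding 2 using h_in[OF g] h_in[OF pc] w B.act_in B.act_inv by metis
    ultimately show ?thesis by simp
  qed
  then show ?thesis using w g A.act_in B.act_in h_in by (simp add: corresponds_def)
qed

definition point_map :: "'x \<Rightarrow> 'y" where
  "point_map w = (THE v. corresponds w v)"

lemma corresponds_iff: "corresponds w v \<longleftrightarrow> w \<in> topspace X \<and> v = point_map w"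
proof -
  have "corresponds w (point_map w)" if "w \<in> topspace X"
    unfolding point_map_def using corresponds_exists[OF that] corresponds_unique_right
    by (metis theI)
  then show ?thesis using corresponds_unique_right by (auto simp: corresponds_def)
qed

lemma point_map_in: "w \<in> topspace X \<Longrightarrow> point_map w \<in> topspace X'"
  using corresponds_iff by (auto simp: corresponds_def)

lemma point_map_act:
  "w \<in> topspace X \<Longrightarrow> g \<in> carrier F \<Longrightarrow> point_map (act g w) = act' (h g) (point_map w)"
  using corresponds_act corresponds_iff by metis

lemma point_map_support:
  "involution F p \<Longrightarrow> w \<in> topspace X \<Longrightarrow> act' (h p) (point_map w) \<noteq> point_map w \<longleftrightarrow> act p w \<noteq> w"
  using corresponds_iff[of w "point_map w"] by (simp add: corresponds_def)

text \<open>Supports of involutions form a base, and \<open>point_map\<close> respects them.\<close>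

lemma point_map_continuous: "continuous_map X X' point_map"
  unfolding continuous_map_def
proof (intro conjI allI impI)
  show "point_map \<in> topspace X \<rightarrow> topspace X'" using point_map_in by blast
  fix U assume U: "openin X' U"
  show "openin X {w \<in> topspace X. point_map w \<in> U}"
  proof (subst openin_subopen, intro ballI)
    fix w assume w: "w \<in> {w \<in> topspace X. point_map w \<in> U}"
    obtain p where p: "involution F' p" "act' p (point_map w) \<noteq> point_map w"
        "\<forall>v\<in>topspace X' - U. act' p v = v"
      using B.local_involution[OF U] w by blast
    have q: "involution F (h' p)" "h (h' p) = p" "h' p \<in> carrier F"
      using p(1) inv.involution_h h_h' h'_in by (auto simp: involution_def)
    have "act p' v \<noteq> v \<longleftrightarrow> act' p (point_map v) \<noteq> point_map v" if "p' = h' p" "v \<in> topspace X" for p' v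
      using point_map_support[OF q(1)] q(2) that by simp
    then have "A.supp (h' p) \<subseteq> {w \<in> topspace X. point_map w \<in> U}" "w \<in> A.supp (h' p)"
      using p w point_map_in by auto
    then show "\<exists>T. openin X T \<and> w \<in> T \<and> T \<subseteq> {w \<in> topspace X. point_map w \<in> U}"
      using A.support_open[OF q(3)] by blast
  qed
qed

end

context isomorphic_full_actions begin

lemma inv_point_map: "w \<in> topspace X \<Longrightarrow> inv.point_map (point_map w) = w"
  using corresponds_iff corresponds_sym inv.corresponds_iff by metis

end

context isomorphic_full_actions begin

theorem point_map_homeomorphism: "homeomorphic_maps X X' point_map inv.point_map"
proof -
  have "point_map (inv.point_map v) = v" if "v \<in> topspace X'" for v
    using that corresponds_iff corresponds_sym inv.corresponds_iff by metis
  then show ?thesis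
    using point_map_continuous inv.point_map_continuous inv_point_map
    by (simp add: homeomorphic_maps_def)
qed

end

section \<open>Groupoids of germs\<close>

text \<open>\<open>germ\<close> presents the groupoid \<open>G\<close> as the groupoid of germs of the action: each arrow is the germ of a
  group element at a point, germs at a point are equal if the elements agree near it, and the germs of
  one element over an open set form an open set. All structure of \<open>G\<close> is thereby expressed by the
  action, which is why equivariantly homeomorphic actions have isomorphic germ groupoids.\<close>

locale germ_groupoid = full_action F X act
  for F :: "('g, 'm) monoid_scheme" (structure) and X :: "'x topology" and act +
  fixes G :: "('e, 'r) top_groupoid_scheme" and germ :: "'g \<Rightarrow> 'x \<Rightarrow> 'e"
  assumes cat: "category G"
    and arrows_germ: "arrows G = {germ f w | f w. f \<in> carrier F \<and> w \<in> topspace X}"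
    and germ_eq_iff: "f \<in> carrier F \<Longrightarrow> g \<in> carrier F \<Longrightarrow> w \<in> topspace X \<Longrightarrow> v \<in> topspace X \<Longrightarrow>
      germ f w = germ g v \<longleftrightarrow> w = v \<and> (\<exists>U. openin X U \<and> w \<in> U \<and> (\<forall>u\<in>U. act f u = act g u))"
    and src_germ: "f \<in> carrier F \<Longrightarrow> w \<in> topspace X \<Longrightarrow> src G (germ f w) = germ \<one> w"
    and tgt_germ: "f \<in> carrier F \<Longrightarrow> w \<in> topspace X \<Longrightarrow> tgt G (germ f w) = germ \<one> (act f w)"
    and cmp_germ: "f \<in> carrier F \<Longrightarrow> g \<in> carrier F \<Longrightarrow> w \<in> topspace X \<Longrightarrow>
      germ f (act g w) \<cdot>\<^bsub>G\<^esub> germ g w = germ (f \<otimes> g) w"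
    and open_germs: "openin (gtop G) V \<longleftrightarrow> V \<subseteq> arrows G \<and>
      (\<forall>f\<in>carrier F. \<forall>w\<in>topspace X. germ f w \<in> V \<longrightarrow>
        (\<exists>U. openin X U \<and> w \<in> U \<and> germ f ` U \<subseteq> V))"
begin

lemma topspace_germs: "topspace (gtop G) = arrows G"
proof -
  have "germ f ` topspace X \<subseteq> arrows G" if "f \<in> carrier F" for f
    using that by (auto simp: arrows_germ)
  then have "openin (gtop G) (arrows G)"
    unfolding open_germs using openin_topspace by blast
  then show ?thesis
    using open_germs[of "topspace (gtop G)"] openin_subset by auto
qed

lemma germ_in: "f \<in> carrier F \<Longrightarrow> w \<in> topspace X \<Longrightarrow> germ f w \<in> arrows G"
  by (auto simp: arrows_germ)

end

locale isomorphic_germ_groupoids =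
  A: germ_groupoid F X act G germ + B: germ_groupoid F' X' act' G' germ' +
  isomorphic_full_actions F X act F' X' act' h h'
  for F :: "('g, 'm) monoid_scheme" and X :: "'x topology" and act
    and G :: "('e, 'r) top_groupoid_scheme" and germ
    and F' :: "('h, 'n) monoid_scheme" and X' :: "'y topology" and act'
    and G' :: "('f, 's) top_groupoid_scheme" and germ' and h and h'
begin

lemma sym_germs: "isomorphic_germ_groupoids F' X' act' G' germ' F X act G germ h' h"
  by (intro isomorphic_germ_groupoids.intro A.germ_groupoid_axioms B.germ_groupoid_axioms sym)

definition germ_map :: "'e \<Rightarrow> 'f" where
  "germ_map a = (THE b. \<exists>f\<in>carrier F. \<exists>w\<in>topspace X. a = germ f w \<and> b = germ' (h f) (point_map w))"

lemma germ_transport: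
  assumes "f \<in> carrier F" "g \<in> carrier F" "w \<in> topspace X" "v \<in> topspace X" "germ f w = germ g v"
  shows "germ' (h f) (point_map w) = germ' (h g) (point_map v)"
proof -
  obtain U where U: "openin X U" "w \<in> U" "\<forall>u\<in>U. act f u = act g u" and wv: "w = v"
    using A.germ_eq_iff[of f g w v] assms by blast
  let ?V = "{v \<in> topspace X'. inv.point_map v \<in> U}"
  have 1: "openin X' ?V"
    using point_map_homeomorphism U(1) unfolding homeomorphic_maps_def
    by (blast intro: openin_continuous_map_preimage)
  have 2: "point_map w \<in> ?V" using U assms point_map_in inv_point_map by simp
  have 3: "act' (h f) u = act' (h g) u" if "u \<in> ?V" for u
  proof -
    have u: "inv.point_map u \<in> topspace X" "point_map (inv.point_map u) = u"
      using that inv.point_map_in point_map_homeomorphism by (auto simp: homeomorphic_maps_def)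
    have "point_map (act f (inv.point_map u)) = point_map (act g (inv.point_map u))"
      using U that by simp
    then show ?thesis using u assms by (simp add: point_map_act)
  qed
  have "\<exists>U. openin X' U \<and> point_map w \<in> U \<and> (\<forall>u\<in>U. act' (h f) u = act' (h g) u)"
    by (rule exI[of _ ?V], intro conjI ballI) (rule 1 2 3, assumption?)+
  then show ?thesis
    using wv B.germ_eq_iff[OF h_in[OF assms(1)] h_in[OF assms(2)]
        point_map_in[OF assms(3)] point_map_in[OF assms(4)]] by simp
qed

lemma germ_map_germ:
  assumes "f \<in> carrier F" "w \<in> topspace X"
  shows "germ_map (germ f w) = germ' (h f) (point_map w)"
  unfolding germ_map_def
proof (rule the_equality)
  show "\<exists>g\<in>carrier F. \<exists>v\<in>topspace X. germ f w = germ g v \<and>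
      germ' (h f) (point_map w) = germ' (h g) (point_map v)"
    using assms by blast
qed (use assms germ_transport in metis)

lemma germ_map_in: "a \<in> arrows G \<Longrightarrow> germ_map a \<in> arrows G'"
  using germ_map_germ B.germ_in h_in point_map_in by (auto simp: A.arrows_germ)

lemma germ_map_continuous: "continuous_map (gtop G) (gtop G') germ_map"
  unfolding continuous_map_def A.topspace_germs B.topspace_germs
proof (intro conjI allI impI)
  show "germ_map \<in> arrows G \<rightarrow> arrows G'" using germ_map_in by blast
  fix V assume V: "openin (gtop G') V"
  show "openin (gtop G) {a \<in> arrows G. germ_map a \<in> V}"
    unfolding A.open_germs
  proof (intro conjI ballI impI)
    fix f w assume f: "f \<in> carrier F" and w: "w \<in> topspace X"
      and "germ f w \<in> {a \<in> arrows G. germ_map a \<in> V}"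
    then have "germ' (h f) (point_map w) \<in> V" by (simp add: germ_map_germ)
    then obtain U where U: "openin X' U" "point_map w \<in> U" "germ' (h f) ` U \<subseteq> V"
      using V h_in[OF f] point_map_in[OF w] unfolding B.open_germs by blast
    let ?U = "{u \<in> topspace X. point_map u \<in> U}"
    have "openin X ?U" using U point_map_continuous openin_continuous_map_preimage by blast
    moreover have "germ f ` ?U \<subseteq> {a \<in> arrows G. germ_map a \<in> V}"
      using f U A.germ_in germ_map_germ by auto
    ultimately show "\<exists>U. openin X U \<and> w \<in> U \<and> germ f ` U \<subseteq> {a \<in> arrows G. germ_map a \<in> V}"
      using U w by blast
  qed auto
qed

lemma h_one: "h \<one>\<^bsub>F\<^esub> = \<one>\<^bsub>F'\<^esub>"
  using hom_one[of h F F'] h_iso A.is_group B.is_group by (simp add: iso_iff)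

end

sublocale isomorphic_germ_groupoids \<subseteq>
  inv: isomorphic_germ_groupoids F' X' act' G' germ' F X act G germ h' h
  by (rule sym_germs)

context isomorphic_germ_groupoids begin

lemma inv_germ_map:
  assumes "a \<in> arrows G" shows "inv.germ_map (germ_map a) = a"
  using assms germ_map_germ inv.germ_map_germ h_in point_map_in h'_h inv_point_map
  by (auto simp: A.arrows_germ)

end

context isomorphic_germ_groupoids begin

theorem germ_map_iso: "top_groupoid_iso G G' germ_map inv.germ_map"
proof (rule top_groupoid_iso.intro)
  show "homeomorphic_maps (gtop G) (gtop G') germ_map inv.germ_map"
    using germ_map_continuous inv.germ_map_continuous inv_germ_map inv.inv_germ_map
    by (simp add: homeomorphic_maps_def A.topspace_germs B.topspace_germs)
  fix a assume "a \<in> arrows G"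
  then obtain f w where a: "f \<in> carrier F" "w \<in> topspace X" "a = germ f w"
    by (auto simp: A.arrows_germ)
  show "src G' (germ_map a) = germ_map (src G a)"
    using a h_in point_map_in by (simp add: germ_map_germ A.src_germ B.src_germ h_one)
  show "tgt G' (germ_map a) = germ_map (tgt G a)"
    using a h_in point_map_in A.act_in
    by (simp add: germ_map_germ A.tgt_germ B.tgt_germ h_one point_map_act)
  fix b assume "b \<in> arrows G" and ab: "src G a = tgt G b"
  then obtain g v where b: "g \<in> carrier F" "v \<in> topspace X" "b = germ g v"
    by (auto simp: A.arrows_germ)
  have "germ \<one>\<^bsub>F\<^esub> w = germ \<one>\<^bsub>F\<^esub> (act g v)"
    using ab a b by (simp add: A.src_germ A.tgt_germ)
  then have "w = act g v" using A.germ_eq_iff a b A.act_in by simp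
  then show "germ_map (a \<cdot>\<^bsub>G\<^esub> b) = germ_map a \<cdot>\<^bsub>G'\<^esub> germ_map b"
    using a b h_in point_map_in A.act_in
    by (simp add: germ_map_germ A.cmp_germ B.cmp_germ point_map_act h_mult)
qed (rule A.cat B.cat A.topspace_germs B.topspace_germs)+

end

section \<open>Paths in a higher rank graph\<close>

lemma nat_vec_add_diff: "(m::nat ^ 'k::finite) \<le> n \<Longrightarrow> m + (n - m) = n"
  by (simp add: vec_eq_iff less_eq_vec_def)

lemma nat_vec_le_add: "(m::nat ^ 'k::finite) \<le> m + n" "(n::nat ^ 'k::finite) \<le> m + n" "0 \<le> m"
  by (simp_all add: less_eq_vec_def)

lemma nat_vec_bounded: "\<exists>j. (n::nat ^ 'k::finite) \<le> vec j"
proof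
  show "n \<le> vec (Max (range (\<lambda>i. n $ i)))" by (simp add: less_eq_vec_def)
qed

lemma vec_nat_mono: "i \<le> j \<Longrightarrow> (vec i :: nat ^ 'k::finite) \<le> vec j"
  by (simp add: less_eq_vec_def)

lemma int_vec_add: "int_vec (m + n) = int_vec m + int_vec n"
  by (simp add: int_vec_def vec_eq_iff)

lemma int_vec_inj: "int_vec m = int_vec n \<longleftrightarrow> m = n"
  by (simp add: int_vec_def vec_eq_iff)

context category begin

lemma ideal_iff: "b \<in> arrow_ideal C a \<longleftrightarrow> (\<exists>c\<in>arrows C. src C a = tgt C c \<and> b = a \<cdot> c)"
  by (auto simp: arrow_ideal_def)

lemma ident_in: "e \<in> idents C \<Longrightarrow> e \<in> arrows C"
  using idents_subset by blast

lemma src_in_arrows: "a \<in> arrows C \<Longrightarrow> src C a \<in> arrows C"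
  by (simp add: src_in ident_in)

lemma ideal_self: "a \<in> arrows C \<Longrightarrow> a \<in> arrow_ideal C a"
  unfolding ideal_iff using cmp_src src_in tgt_ident src_in_arrows by metis

lemma ideal_arrow: "a \<in> arrows C \<Longrightarrow> b \<in> arrow_ideal C a \<Longrightarrow> b \<in> arrows C"
  unfolding ideal_iff using cmp_closed by blast

lemma ideal_tgt: "a \<in> arrows C \<Longrightarrow> b \<in> arrow_ideal C a \<Longrightarrow> tgt C b = tgt C a"
  unfolding ideal_iff using tgt_cmp by blast

lemma ideal_cmp: "a \<in> arrows C \<Longrightarrow> b \<in> arrows C \<Longrightarrow> src C a = tgt C b \<Longrightarrow> a \<cdot> b \<in> arrow_ideal C a"
  unfolding ideal_iff by blast

lemma ideal_trans:
  assumes "a \<in> arrows C" "b \<in> arrow_ideal C a" "c \<in> arrow_ideal C b"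
  shows "c \<in> arrow_ideal C a"
proof -
  obtain d where d: "d \<in> arrows C" "src C a = tgt C d" "b = a \<cdot> d"
    using assms(2) unfolding ideal_iff by blast
  obtain e where e: "e \<in> arrows C" "src C b = tgt C e" "c = b \<cdot> e"
    using assms(3) unfolding ideal_iff by blast
  have de: "src C d = tgt C e" using d e assms(1) by (simp add: src_cmp)
  then have "c = a \<cdot> (d \<cdot> e)" using d e assms(1) cmp_assoc by simp
  then show ?thesis using d e de assms(1) by (auto simp: cmp_closed tgt_cmp intro!: ideal_cmp)
qed

lemma ideal_cmp_mono:
  assumes "a \<in> arrows C" "b \<in> arrows C" "src C a = tgt C b" "c \<in> arrow_ideal C b"
  shows "a \<cdot> c \<in> arrow_ideal C (a \<cdot> b)"
proof -
  obtain d where d: "d \<in> arrows C" "src C b = tgt C d" "c = b \<cdot> d"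
    using assms(4) unfolding ideal_iff by blast
  then have "a \<cdot> c = (a \<cdot> b) \<cdot> d" using assms cmp_assoc by simp
  then show ?thesis using d assms by (simp add: ideal_cmp cmp_closed src_cmp)
qed

end

context higher_rank_graph begin

lemma factorization_unique:
  assumes "a \<in> arrows C" "b \<in> arrows C" "src C a = tgt C b"
    and "a' \<in> arrows C" "b' \<in> arrows C" "src C a' = tgt C b'"
    and eq: "a \<cdot> b = a' \<cdot> b'" and d: "deg C a = deg C a'"
  shows "a = a'" "b = b'"
proof -
  have "deg C a + deg C b = deg C a + deg C b'"
    using deg_cmp[OF assms(1-3)] deg_cmp[OF assms(4-6)] eq d by metis
  then have db: "deg C b = deg C b'" by simp
  have "deg C (a \<cdot> b) = deg C a + deg C b" "a \<cdot> b \<in> arrows C"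
    by (rule deg_cmp[OF assms(1-3)], rule cmp_closed[OF assms(1-3)])
  from unique_factorization[OF this(2,1)]
  have "(a, b) = (a', b')" using assms db by (elim ex1E) (metis SigmaI fst_conv snd_conv)
  then show "a = a'" "b = b'" by auto
qed

lemma cancel_left:
  "a \<in> arrows C \<Longrightarrow> b \<in> arrows C \<Longrightarrow> c \<in> arrows C \<Longrightarrow> src C a = tgt C b \<Longrightarrow> src C a = tgt C c \<Longrightarrow>
    a \<cdot> b = a \<cdot> c \<Longrightarrow> b = c"
  using factorization_unique(2) by blast

lemma factorization:
  assumes "x \<in> arrows C" "n \<le> deg C x"
  obtains a b where "a \<in> arrows C" "b \<in> arrows C" "src C a = tgt C b" "x = a \<cdot> b" "deg C a = n"
    "deg C b = deg C x - n"
proof -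
  have "deg C x = n + (deg C x - n)" using nat_vec_add_diff[OF assms(2)] by simp
  from ex1_implies_ex[OF unique_factorization[OF assms(1) this]] show thesis
    using that by auto
qed

lemma deg_zero_ident: assumes "a \<in> arrows C" "deg C a = 0" shows "a \<in> idents C"
proof -
  have t: "tgt C a \<in> arrows C" "src C (tgt C a) = tgt C a" "deg C (tgt C a) = 0"
    "src C a \<in> arrows C" "tgt C (src C a) = src C a"
    using assms tgt_in src_in by (auto simp: ident_in src_ident tgt_ident deg_ident)
  have "a \<cdot> src C a = tgt C a \<cdot> a" using assms by (simp add: cmp_src tgt_cmp_left)
  then have "a = tgt C a"
    using factorization_unique(1)[of a "src C a" "tgt C a" a] t assms by simp
  then show ?thesis using tgt_in[OF assms(1)] by simp
qed

lemma ideal_deg: "a \<in> arrows C \<Longrightarrow> b \<in> arrow_ideal C a \<Longrightarrow> deg C a \<le> deg C b"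
  unfolding ideal_iff by (auto simp: deg_cmp nat_vec_le_add)

text \<open>Factor the longer segment at the degree of the shorter one; the two resulting factorizations of \<open>x\<close>
  agree.\<close>

lemma ideal_comparable:
  assumes "a \<in> arrows C" "b \<in> arrows C" "x \<in> arrow_ideal C a" "x \<in> arrow_ideal C b"
    and d: "deg C a \<le> deg C b"
  shows "b \<in> arrow_ideal C a"
proof -
  obtain c where c: "c \<in> arrows C" "src C a = tgt C c" "x = a \<cdot> c"
    using assms(3) unfolding ideal_iff by blast
  obtain e where e: "e \<in> arrows C" "src C b = tgt C e" "x = b \<cdot> e"
    using assms(4) unfolding ideal_iff by blast
  obtain a' f where f: "a' \<in> arrows C" "f \<in> arrows C" "src C a' = tgt C f" "b = a' \<cdot> f" "deg C a' = deg C a"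
    using factorization[OF assms(2) d] by blast
  have fe: "src C f = tgt C e" using e f by (simp add: src_cmp)
  then have "x = a' \<cdot> (f \<cdot> e)" using e f cmp_assoc by simp
  then have "a = a'"
    using factorization_unique(1)[of a c a' "f \<cdot> e"] c f e fe assms(1) by (simp add: cmp_closed tgt_cmp)
  then show ?thesis using f by (simp add: ideal_cmp)
qed

lemma ideal_same_deg:
  assumes "a \<in> arrows C" "b \<in> arrow_ideal C a" "deg C b = deg C a" shows "b = a"
proof -
  obtain c where c: "c \<in> arrows C" "src C a = tgt C c" "b = a \<cdot> c"
    using assms(2) unfolding ideal_iff by blast
  then have "deg C c = 0" using assms deg_cmp[of a c] by simp
  then have "c \<in> idents C" using c deg_zero_ident by blast
  then show ?thesis using c tgt_ident cmp_src[OF assms(1)] by simp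
qed

lemma ideal_unique_deg:
  "a \<in> arrows C \<Longrightarrow> b \<in> arrows C \<Longrightarrow> x \<in> arrow_ideal C a \<Longrightarrow> x \<in> arrow_ideal C b \<Longrightarrow>
    deg C a = deg C b \<Longrightarrow> a = b"
  using ideal_comparable[of a b x] ideal_same_deg[of a b] by auto

lemma prefix_exists:
  assumes "x \<in> arrows C" "n \<le> deg C x"
  obtains a where "a \<in> arrows C" "deg C a = n" "x \<in> arrow_ideal C a"
  using factorization[OF assms] ideal_cmp by metis

lemma tiling_arrow: "w \<in> tilings C \<Longrightarrow> m \<le> n \<Longrightarrow> w m n \<in> arrows C"
  and tiling_deg: "w \<in> tilings C \<Longrightarrow> m \<le> n \<Longrightarrow> deg C (w m n) = n - m"
  and tiling_ident: "w \<in> tilings C \<Longrightarrow> w m m \<in> idents C"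
  and tiling_src_tgt: "w \<in> tilings C \<Longrightarrow> m \<le> n \<Longrightarrow> n \<le> p \<Longrightarrow> src C (w m n) = tgt C (w n p)"
  and tiling_cmp: "w \<in> tilings C \<Longrightarrow> m \<le> n \<Longrightarrow> n \<le> p \<Longrightarrow> w m n \<cdot> w n p = w m p"
  and tiling_undef: "w \<in> tilings C \<Longrightarrow> \<not> m \<le> n \<Longrightarrow> w m n = undefined"
  by (auto simp: tilings_def)

lemma tiling_prefix: 
  assumes "w \<in> tilings C"
  shows "w 0 n \<in> arrows C" "deg C (w 0 n) = n" "tgt C (w 0 n) = w 0 0"
    "m \<le> n \<Longrightarrow> w 0 n \<in> arrow_ideal C (w 0 m)" "w m m = src C (w 0 m)"
proof -
  show "w 0 n \<in> arrows C" "deg C (w 0 n) = n"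
    using assms tiling_arrow tiling_deg[of w 0 n] nat_vec_le_add(3)[of n] by auto
  have "tgt C (w 0 n) = src C (w 0 0)"
    using tiling_src_tgt[OF assms, of 0 0 n] nat_vec_le_add(3)[of n] by simp
  then show "tgt C (w 0 n) = w 0 0" using tiling_ident[OF assms] src_ident by simp
  show "w 0 n \<in> arrow_ideal C (w 0 m)" if "m \<le> n"
    unfolding ideal_iff using tiling_cmp[OF assms _ that, of 0] nat_vec_le_add(3)[of m] tiling_arrow[OF assms]
      tiling_src_tgt[OF assms _ that, of 0] that by metis
  show "w m m = src C (w 0 m)"
    using tiling_src_tgt[OF assms, of 0 m m] nat_vec_le_add(3)[of m] tiling_ident[OF assms] tgt_ident by simp
qed

lemma tiling_prefixI:
  assumes "w \<in> tilings C" "a \<in> arrows C" "w 0 n \<in> arrow_ideal C a"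
  shows "w 0 (deg C a) = a"
proof -
  have "deg C a \<le> n" using ideal_deg[OF assms(2,3)] tiling_prefix(2)[OF assms(1)] by simp
  then show ?thesis
    using ideal_unique_deg[OF tiling_prefix(1)[OF assms(1)] assms(2) tiling_prefix(4)[OF assms(1)] assms(3)]
      tiling_prefix(2)[OF assms(1)] by simp
qed

text \<open>A tiling is determined by its initial segments \<open>w 0 p\<close>, and cofinally many of them suffice.\<close>

lemma tiling_eqI:
  assumes w: "w \<in> tilings C" and v: "v \<in> tilings C" and eq: "\<And>n. \<exists>p\<ge>n. w 0 p = v 0 p"
  shows "w = v"
proof -
  have eq0: "w 0 n = v 0 n" for n
  proof -
    obtain p where "p \<ge> n" "w 0 p = v 0 p" using eq by blast
    then show ?thesis
      using tiling_prefixI[OF w tiling_prefix(1)[OF v, of n], of p] tiling_prefix(4)[OF v, of n p]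
        tiling_prefix(2)[OF v] by simp
  qed
  have "w m n = v m n" for m n
  proof (cases "m \<le> n")
    case True
    have "w 0 m \<cdot> w m n = w 0 m \<cdot> v m n"
      using tiling_cmp[OF w _ True, of 0] tiling_cmp[OF v _ True, of 0] eq0 nat_vec_le_add(3)[of m] by simp
    then show ?thesis
      using cancel_left[of "w 0 m" "w m n" "v m n"] tiling_prefix(1)[OF w] tiling_arrow[OF w True]
        tiling_arrow[OF v True] tiling_src_tgt[OF w _ True, of 0] tiling_src_tgt[OF v _ True, of 0]
        eq0 nat_vec_le_add(3)[of m] by simp
  qed (simp add: tiling_undef[OF w] tiling_undef[OF v])
  then show ?thesis by blast
qed

text \<open>The segment from \<open>m\<close> to \<open>n\<close> is what remains of \<open>P n\<close> after cancelling \<open>P m\<close>.\<close>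

lemma tiling_of_prefixes:
  assumes P: "\<And>n. P n \<in> arrows C" "\<And>n. deg C (P n) = n"
    and coh: "\<And>m n. m \<le> n \<Longrightarrow> P n \<in> arrow_ideal C (P m)"
  obtains w where "w \<in> tilings C" "\<And>n. w 0 n = P n"
proof -
  define w where "w m n = (if m \<le> n then THE b. b \<in> arrows C \<and> src C (P m) = tgt C b \<and> P m \<cdot> b = P n
    else undefined)" for m n
  have ex1: "\<exists>!b. b \<in> arrows C \<and> src C (P m) = tgt C b \<and> P m \<cdot> b = P n" if "m \<le> n" for m n
  proof -
    have "\<exists>b\<in>arrows C. src C (P m) = tgt C b \<and> P n = P m \<cdot> b"
      using coh[OF that] unfolding ideal_iff .
    then show ?thesis using cancel_left[OF P(1)[of m]] by metis
  qed
  have wI: "w m n = b" if "m \<le> n" "b \<in> arrows C" "src C (P m) = tgt C b" "P m \<cdot> b = P n" for m n b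
    unfolding w_def using that the1_equality[OF ex1[OF that(1)]] by simp
  have w: "w m n \<in> arrows C" "src C (P m) = tgt C (w m n)" "P m \<cdot> w m n = P n" if "m \<le> n" for m n
    using theI'[OF ex1[OF that]] that by (auto simp: w_def)
  have dw: "deg C (w m n) = n - m" if "m \<le> n" for m n
  proof -
    have "m + deg C (w m n) = m + (n - m)"
      using deg_cmp[OF P(1) w(1,2)[OF that]] w(3)[OF that] P(2) nat_vec_add_diff[OF that] by simp
    then show ?thesis by simp
  qed
  have sw: "src C (w m n) = src C (P n)" if "m \<le> n" for m n
    using w[OF that] src_cmp[OF P(1), of "w m n" m] by simp
  have cw: "w m n \<cdot> w n p = w m p" if "m \<le> n" "n \<le> p" for m n p
  proof -
    have s: "src C (w m n) = tgt C (w n p)" using sw[OF that(1)] w(2)[OF that(2)] by simp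
    have "P m \<cdot> (w m n \<cdot> w n p) = P p"
      using w[OF that(1)] w[OF that(2)] s P(1) cmp_assoc[of "P m" "w m n" "w n p"] by simp
    then show ?thesis
      using that w[OF that(1)] w[OF that(2)] s
      by (intro wI[symmetric]) (auto simp: cmp_closed tgt_cmp)
  qed
  have id: "w m m \<in> idents C" for m
  proof -
    have "w m m = src C (P m)"
      using P(1)[of m] src_in[OF P(1), of m] by (intro wI) (auto simp: ident_in tgt_ident cmp_src)
    then show ?thesis using src_in[OF P(1)] by simp
  qed
  have "src C (w m n) = tgt C (w n p)" if "m \<le> n" "n \<le> p" for m n p
    using sw[OF that(1)] w(2)[OF that(2)] by simp
  moreover have "w m n = undefined" if "\<not> m \<le> n" for m n using that by (simp add: w_def)
  ultimately have "w \<in> tilings C" by (simp add: tilings_def w(1) dw id cw)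
  moreover have "w 0 n = P n" for n
  proof (rule wI)
    have "P 0 \<in> idents C" using P deg_zero_ident by blast
    moreover have "tgt C (P n) = tgt C (P 0)"
      using ideal_tgt[OF P(1) coh] nat_vec_le_add(3)[of n] by blast
    ultimately show "src C (P 0) = tgt C (P n)" "P 0 \<cdot> P n = P n"
      using tgt_cmp_left[OF P(1), of n] by (auto simp: src_ident tgt_ident)
  qed (rule nat_vec_le_add(3) P(1))+
  ultimately show thesis using that by blast
qed

text \<open>A chain of longer and longer arrows has initial segments of every degree, and these are coherent.\<close>

lemma tiling_of_sequence:
  fixes p :: "nat \<Rightarrow> 'a"
  assumes p: "\<And>j. p j \<in> arrows C" and step: "\<And>j. p (Suc j) \<in> arrow_ideal C (p j)"
    and cofin: "\<And>n. \<exists>j. n \<le> deg C (p j)"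
  obtains w where "w \<in> tilings C" "\<And>j. w 0 (deg C (p j)) = p j"
proof -
  have mono: "p (i + k) \<in> arrow_ideal C (p i)" for i k
  proof (induction k)
    case (Suc k)
    then show ?case using step[of "i + k"] ideal_trans[OF p[of i]] by simp
  qed (simp add: ideal_self p)
  have common: "\<exists>j. p j \<in> arrow_ideal C a \<and> p j \<in> arrow_ideal C b"
    if "a \<in> arrows C" "b \<in> arrows C" "p i \<in> arrow_ideal C a" "p k \<in> arrow_ideal C b" for a b i k
    using ideal_trans[OF that(1,3) mono, of k] ideal_trans[OF that(2,4) mono, of i]
    by (metis add.commute)
  have "\<exists>a\<in>arrows C. deg C a = n \<and> (\<exists>j. p j \<in> arrow_ideal C a)" for n
    using cofin[of n] prefix_exists[OF p] by metis
  then obtain P where P: "\<And>n. P n \<in> arrows C" "\<And>n. deg C (P n) = n" "\<And>n. \<exists>j. p j \<in> arrow_ideal C (P n)"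
    by metis
  have coh: "P n \<in> arrow_ideal C (P m)" if mn: "m \<le> n" for m n
  proof -
    obtain j where "p j \<in> arrow_ideal C (P m)" "p j \<in> arrow_ideal C (P n)"
      using common[OF P(1) P(1)] P(3)[of m] P(3)[of n] by metis
    then show ?thesis using ideal_comparable P mn by metis
  qed
  obtain w where w: "w \<in> tilings C" "\<And>n. w 0 n = P n"
    using tiling_of_prefixes[OF P(1,2) coh] by metis
  moreover have "w 0 (deg C (p j)) = p j" for j
  proof -
    obtain i where "p i \<in> arrow_ideal C (P (deg C (p j)))" "p i \<in> arrow_ideal C (p j)"
      using common[OF P(1) p] P(3) ideal_self[OF p] by metis
    then show ?thesis using ideal_unique_deg[OF P(1) p] P(2) w(2) by metis
  qed
  ultimately show thesis using that by blast
qed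

lemma tshift_tiling: "w \<in> tilings C \<Longrightarrow> tshift p w \<in> tilings C"
proof -
  assume w: "w \<in> tilings C"
  have le: "p + m \<le> p + n \<longleftrightarrow> m \<le> n" for m n :: "nat ^ 'k" by (simp add: less_eq_vec_def)
  have "(p + n) - (p + m) = n - m" for m n :: "nat ^ 'k" by (simp add: vec_eq_iff)
  then show ?thesis
    using w unfolding tilings_def tshift_def by (simp add: le)
qed

lemma tshift_zero: "tshift p w 0 0 = w p p" by (simp add: tshift_def)

lemma tshift_prefix: "w \<in> tilings C \<Longrightarrow> w 0 p \<cdot> tshift p w 0 n = w 0 (p + n)"
  using tiling_cmp[of w 0 p "p + n"] nat_vec_le_add(1)[of p n] nat_vec_le_add(3)[of p] by (simp add: tshift_def)

lemma tshift_tshift: "tshift m (tshift n w) = tshift (n + m) w"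
  by (simp add: tshift_def add.assoc)

lemma prepend_exists:
  assumes x: "x \<in> arrows C" and w: "w \<in> tilings C" "w 0 0 = src C x"
  shows "\<exists>v\<in>tilings C. v 0 (deg C x) = x \<and> tshift (deg C x) v = w"
proof -
  \<comment> \<open>The diagonal degrees are cofinal in \<open>\<nat>\<^sup>k\<close>.\<close>
  define p where "p j = x \<cdot> w 0 (vec j)" for j :: nat
  have c: "src C x = tgt C (w 0 n)" for n using w tiling_prefix(3) by metis
  have pa: "p j \<in> arrows C" for j
    using cmp_closed[OF x tiling_prefix(1)[OF w(1)] c] by (simp add: p_def)
  have pd: "deg C (p j) = deg C x + vec j" for j
    using deg_cmp[OF x tiling_prefix(1)[OF w(1)] c] tiling_prefix(2)[OF w(1)] by (simp add: p_def)
  have "p (Suc j) \<in> arrow_ideal C (p j)" for j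
    unfolding p_def
    by (rule ideal_cmp_mono[OF x tiling_prefix(1)[OF w(1)] c tiling_prefix(4)[OF w(1)]])
      (simp add: less_eq_vec_def)
  moreover have "\<exists>j. n \<le> deg C (p j)" for n
  proof -
    obtain j where "n \<le> vec j" using nat_vec_bounded by blast
    then have "n \<le> deg C (p j)" unfolding pd by (rule order_trans[OF _ nat_vec_le_add(2)])
    then show ?thesis ..
  qed
  ultimately obtain v where v: "v \<in> tilings C" "\<And>j. v 0 (deg C (p j)) = p j"
    using tiling_of_sequence[of p] pa by metis
  have v0: "v 0 (deg C x + vec j) = x \<cdot> w 0 (vec j)" for j using v(2)[of j] pd by (simp add: p_def)
  have z: "vec 0 = (0::nat ^ 'k)" by (simp add: vec_eq_iff)
  have vx: "v 0 (deg C x) = x"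
    using v0[of 0] w(2) cmp_src[OF x] by (simp add: z)
  have "tshift (deg C x) v = w"
  proof (rule tiling_eqI[OF tshift_tiling[OF v(1)] w(1)])
    fix n :: "nat ^ 'k"
    obtain j where j: "n \<le> vec j" using nat_vec_bounded by blast
    have "x \<cdot> tshift (deg C x) v 0 (vec j) = x \<cdot> w 0 (vec j)"
      using tshift_prefix[OF v(1), of "deg C x" "vec j"] v0 vx by simp
    moreover have "src C x = tgt C (tshift (deg C x) v 0 (vec j))"
      using tiling_prefix(3)[OF tshift_tiling[OF v(1)]] tiling_prefix(5)[OF v(1)] vx by (simp add: tshift_zero)
    ultimately have "tshift (deg C x) v 0 (vec j) = w 0 (vec j)"
      using cancel_left[OF x] c tiling_prefix(1)[OF w(1)] tiling_prefix(1)[OF tshift_tiling[OF v(1)]] by blast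
    then show "\<exists>p\<ge>n. tshift (deg C x) v 0 p = w 0 p" using j by blast
  qed
  then show ?thesis using v(1) vx by blast
qed

lemma tiling_eq_prefix_shift:
  assumes "v \<in> tilings C" "w \<in> tilings C" "v 0 p = w 0 p" "tshift p v = tshift p w"
  shows "v = w"
proof (rule tiling_eqI[OF assms(1,2)])
  fix n
  have "v 0 (p + n) = w 0 (p + n)"
    using tshift_prefix[OF assms(1), of p n] tshift_prefix[OF assms(2), of p n] assms(3,4) by simp
  then show "\<exists>q\<ge>n. v 0 q = w 0 q" using nat_vec_le_add(2) by blast
qed

lemma tilings_atD: "w \<in> tilings_at C e \<Longrightarrow> w \<in> tilings C" "w \<in> tilings_at C e \<Longrightarrow> w 0 0 = e"
  by (auto simp: tilings_at_def)

lemma prepend_spec: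
  assumes "x \<in> arrows C" "w \<in> tilings_at C (src C x)"
  shows "prepend C x w \<in> tilings C \<and> prepend C x w 0 (deg C x) = x \<and>
    tshift (deg C x) (prepend C x w) = w"
proof -
  have "\<exists>!v. v \<in> tilings C \<and> v 0 (deg C x) = x \<and> tshift (deg C x) v = w"
    using prepend_exists[OF assms(1), of w] tilings_atD[OF assms(2)] tiling_eq_prefix_shift by metis
  from theI'[OF this] show ?thesis unfolding prepend_def .
qed

lemmas prepend_tiling = prepend_spec[THEN conjunct1]
  and prepend_initial = prepend_spec[THEN conjunct2, THEN conjunct1]
  and prepend_shift = prepend_spec[THEN conjunct2, THEN conjunct2]

definition cyl :: "'a \<Rightarrow> ('a, 'k) tiling set" where
  "cyl x = {w \<in> tilings C. w 0 (deg C x) = x}"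

lemma tail_in:
  assumes "w \<in> cyl x" shows "tshift (deg C x) w \<in> tilings_at C (src C x)"
  using assms tshift_tiling[of w] tiling_prefix(5)[of w "deg C x"]
  by (auto simp: cyl_def tilings_at_def tshift_zero)

lemma cyl_arrow: "w \<in> cyl x \<Longrightarrow> x \<in> arrows C"
  unfolding cyl_def using tiling_prefix(1)[of w "deg C x"] by simp

lemma cyl_prepend:
  assumes "w \<in> cyl x" shows "w = prepend C x (tshift (deg C x) w)"
proof -
  have x: "x \<in> arrows C" using cyl_arrow assms .
  have w: "w \<in> tilings C" "w 0 (deg C x) = x" using assms by (auto simp: cyl_def)
  show ?thesis
    using tiling_eq_prefix_shift[OF w(1) prepend_tiling[OF x tail_in[OF assms]], of "deg C x"]
      prepend_initial[OF x tail_in[OF assms]] prepend_shift[OF x tail_in[OF assms]] w by simp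
qed

lemma prepend_in_cyl: "x \<in> arrows C \<Longrightarrow> w \<in> tilings_at C (src C x) \<Longrightarrow> prepend C x w \<in> cyl x"
  by (simp add: cyl_def prepend_tiling prepend_initial)

lemma cyl_eq: "x \<in> arrows C \<Longrightarrow> cyl x = prepend C x ` tilings_at C (src C x)"
  using cyl_prepend tail_in prepend_in_cyl by blast

lemma prefix_in_cyl: "w \<in> tilings C \<Longrightarrow> w \<in> cyl (w 0 n)"
  by (simp add: cyl_def tiling_prefix)

lemma cyl_mono: "x \<in> arrows C \<Longrightarrow> y \<in> arrow_ideal C x \<Longrightarrow> cyl y \<subseteq> cyl x"
  unfolding cyl_def
proof clarify
  fix w assume "x \<in> arrows C" "y \<in> arrow_ideal C x" "w \<in> tilings C" "w 0 (deg C y) = y"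
  then show "w 0 (deg C x) = x" using tiling_prefixI[of w x "deg C y"] by simp
qed

lemma cyl_ideal: "w \<in> cyl x \<Longrightarrow> deg C x \<le> n \<Longrightarrow> w 0 n \<in> arrow_ideal C x"
  using tiling_prefix(4)[of w "deg C x" n] by (auto simp: cyl_def)

lemma prepend_prefix:
  assumes "x \<in> arrows C" "w \<in> tilings_at C (src C x)"
  shows "prepend C x w 0 (deg C x + n) = x \<cdot> w 0 n"
  using tshift_prefix[OF prepend_tiling[OF assms], of "deg C x" n] prepend_initial[OF assms]
    prepend_shift[OF assms] by simp

lemma prepend_inj:
  "x \<in> arrows C \<Longrightarrow> v \<in> tilings_at C (src C x) \<Longrightarrow> w \<in> tilings_at C (src C x) \<Longrightarrow>
    prepend C x v = prepend C x w \<Longrightarrow> v = w"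
  using prepend_shift by metis

lemma prepend_at: "x \<in> arrows C \<Longrightarrow> w \<in> tilings_at C (src C x) \<Longrightarrow> prepend C x w \<in> tilings_at C (tgt C x)"
  using prepend_tiling prepend_initial tiling_prefix(3) by (metis (mono_tags, lifting) mem_Collect_eq tilings_at_def)

lemma prepend_cmp:
  assumes x: "x \<in> arrows C" and y: "y \<in> arrows C" and xy: "src C x = tgt C y"
    and w: "w \<in> tilings_at C (src C y)"
  shows "prepend C (x \<cdot> y) w = prepend C x (prepend C y w)"
proof -
  have xya: "x \<cdot> y \<in> arrows C" "src C (x \<cdot> y) = src C y" "deg C (x \<cdot> y) = deg C x + deg C y"
    using x y xy by (auto simp: cmp_closed src_cmp deg_cmp)
  have yw: "prepend C y w \<in> tilings_at C (src C x)" using prepend_at[OF y w] xy by simp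
  let ?v = "prepend C x (prepend C y w)"
  have "?v 0 (deg C x + deg C y) = x \<cdot> y"
    using prepend_prefix[OF x yw] prepend_initial[OF y w] by simp
  moreover have "tshift (deg C x + deg C y) ?v = w"
    using prepend_shift[OF x yw] prepend_shift[OF y w] by (simp flip: tshift_tshift)
  ultimately show ?thesis
    using tiling_eq_prefix_shift[OF prepend_tiling[OF xya(1)] prepend_tiling[OF x yw], of w "deg C x + deg C y"]
      prepend_initial[OF xya(1)] prepend_shift[OF xya(1)] w xya by simp
qed

lemma tiling_at_src: "w \<in> tilings_at C e \<Longrightarrow> src C (w 0 n) = w n n" "w \<in> tilings_at C e \<Longrightarrow> tgt C (w 0 n) = e"
  using tiling_prefix tilings_atD by metis+

lemma prepend_split:
  assumes x: "x \<in> arrows C" and w: "w \<in> tilings_at C (src C x)"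
  shows "tshift n w \<in> tilings_at C (src C (x \<cdot> w 0 n))"
    "prepend C x w = prepend C (x \<cdot> w 0 n) (tshift n w)"
proof -
  have wt: "w \<in> tilings C" using tilings_atD w by blast
  have a: "w 0 n \<in> arrows C" "src C x = tgt C (w 0 n)" "w \<in> cyl (w 0 n)" "deg C (w 0 n) = n"
    using tiling_prefix(1,2)[OF wt] tiling_at_src(2)[OF w] prefix_in_cyl[OF wt] by simp_all
  have t: "tshift n w \<in> tilings_at C (src C (w 0 n))" using tail_in[OF a(3)] a(4) by simp
  then show "tshift n w \<in> tilings_at C (src C (x \<cdot> w 0 n))" using src_cmp[OF x a(1,2)] by simp
  show "prepend C x w = prepend C (x \<cdot> w 0 n) (tshift n w)"
    using prepend_cmp[OF x a(1,2) t] cyl_prepend[OF a(3)] a(4) by simp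
qed

end

section \<open>The infinite path space\<close>

context higher_rank_graph begin

lemma independent_cyl:
  assumes "independent_arrows C a b" shows "cyl a \<inter> cyl b = {}"
proof (rule ccontr)
  assume "cyl a \<inter> cyl b \<noteq> {}"
  then obtain w where w: "w \<in> cyl a" "w \<in> cyl b" by blast
  have "w 0 (deg C a + deg C b) \<in> arrow_ideal C a \<inter> arrow_ideal C b"
    using cyl_ideal[OF w(1)] cyl_ideal[OF w(2)] nat_vec_le_add by blast
  then show False using assms by (auto simp: independent_arrows_def)
qed

lemma prefix_cyl_iff:
  assumes w: "w \<in> tilings C" and v: "v \<in> cyl (w 0 n)" and n: "deg C x \<le> n"
  shows "v \<in> cyl x \<longleftrightarrow> w \<in> cyl x"
proof -
  have vt: "v \<in> tilings C" "v 0 n = w 0 n" using v tiling_prefix(2)[OF w] by (auto simp: cyl_def)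
  have "v 0 (deg C x) = w 0 (deg C x)"
    using tiling_prefixI[OF vt(1) tiling_prefix(1)[OF w, of "deg C x"], of n]
      tiling_prefix(4)[OF w n] vt(2) tiling_prefix(2)[OF w] by simp
  then show ?thesis using vt w by (simp add: cyl_def)
qed

lemma cyl_prefix_mono: "w \<in> tilings C \<Longrightarrow> m \<le> n \<Longrightarrow> cyl (w 0 n) \<subseteq> cyl (w 0 m)"
  using cyl_mono tiling_prefix by blast

lemma cyl_subset_tilings: "cyl x \<subseteq> tilings C"
  by (auto simp: cyl_def)

text \<open>The topology generated by the cylinders. The initial segments of a path are directed, so the
  cylinders containing a given path form a neighbourhood base that can be indexed by degrees.\<close>

definition path_topology :: "('a, 'k) tiling topology" where
  "path_topology = topology (\<lambda>V. V \<subseteq> tilings C \<and> (\<forall>w\<in>V. \<exists>n. cyl (w 0 n) \<subseteq> V))"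

lemma openin_path: "openin path_topology V \<longleftrightarrow> V \<subseteq> tilings C \<and> (\<forall>w\<in>V. \<exists>n. cyl (w 0 n) \<subseteq> V)"
proof -
  have "istopology (\<lambda>V. V \<subseteq> tilings C \<and> (\<forall>w\<in>V. \<exists>n. cyl (w 0 n) \<subseteq> V))"
    unfolding istopology_def
  proof (rule conjI, intro allI impI, goal_cases)
    case (1 S T)
    have "\<exists>n. cyl (w 0 n) \<subseteq> S \<inter> T" if w: "w \<in> S" "w \<in> T" for w
    proof -
      obtain m n where "cyl (w 0 m) \<subseteq> S" "cyl (w 0 n) \<subseteq> T" using 1 w by blast
      moreover have "w \<in> tilings C" using 1 w by blast
      ultimately have "cyl (w 0 (m + n)) \<subseteq> S \<inter> T"
        using cyl_prefix_mono[of w m "m + n"] cyl_prefix_mono[of w n "m + n"] nat_vec_le_add by blast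
      then show ?thesis ..
    qed
    then show ?case using 1 by blast
  next
    case 2
    show ?case by (intro allI impI) (meson Sup_least UnionE Union_upper subset_trans)
  qed
  then show ?thesis by (simp add: path_topology_def topology_inverse')
qed

lemma topspace_path: "topspace path_topology = tilings C"
proof -
  have "openin path_topology (tilings C)" unfolding openin_path using cyl_subset_tilings by blast
  then show ?thesis
    using openin_subset[of path_topology "tilings C"] openin_path[of "topspace path_topology"] by auto
qed

lemma cyl_open: "openin path_topology (cyl x)"
  unfolding openin_path
proof (intro conjI ballI cyl_subset_tilings)
  fix w assume "w \<in> cyl x"
  then show "\<exists>n. cyl (w 0 n) \<subseteq> cyl x" by (intro exI[of _ "deg C x"]) (simp add: cyl_def)
qed

lemma tilings_separated:
  assumes "w \<in> tilings C" "v \<in> tilings C" "w \<noteq> v"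
  obtains n where "m \<le> n" "w 0 n \<noteq> v 0 n" "cyl (w 0 n) \<inter> cyl (v 0 n) = {}"
proof -
  obtain n where n: "\<And>p. p \<ge> n \<Longrightarrow> w 0 p \<noteq> v 0 p" using tiling_eqI[OF assms(1,2)] assms(3) by blast
  then have "w 0 (m + n) \<noteq> v 0 (m + n)" using nat_vec_le_add by blast
  moreover from this have "cyl (w 0 (m + n)) \<inter> cyl (v 0 (m + n)) = {}"
    using tiling_prefix(2)[OF assms(1)] tiling_prefix(2)[OF assms(2)] by (auto simp: cyl_def)
  ultimately show thesis using that nat_vec_le_add by blast
qed

lemma path_Hausdorff: "Hausdorff_space path_topology"
  unfolding Hausdorff_space_def topspace_path
proof (intro allI impI)
  fix w v assume wv: "w \<in> tilings C \<and> v \<in> tilings C \<and> w \<noteq> v"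
  then obtain n where "cyl (w 0 n) \<inter> cyl (v 0 n) = {}" using tilings_separated[of w v 0] by metis
  then show "\<exists>U V. openin path_topology U \<and> openin path_topology V \<and> w \<in> U \<and> v \<in> V \<and> disjnt U V"
    using cyl_open prefix_in_cyl wv unfolding disjnt_def by metis
qed

text \<open>The orbit relation of the path groupoid.\<close>

definition tail_equivalent :: "('a, 'k) tiling \<Rightarrow> ('a, 'k) tiling \<Rightarrow> bool" where
  "tail_equivalent v w \<longleftrightarrow> (\<exists>x y u. x \<in> arrows C \<and> y \<in> arrows C \<and> src C x = src C y \<and>
     u \<in> tilings_at C (src C x) \<and> v = prepend C x u \<and> w = prepend C y u)"

end

locale path_graph = higher_rank_graph C
  for C :: "('a, 'k::finite) hrg" (structure) +
  assumes row_finite: "row_finite C" and aperiodic: "aperiodic_cat C" and cofinal: "cofinal_cat C"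
    and finite_idents: "finite (idents C)" and no_sources: "no_sources C"
begin

text \<open>Without sources an arrow can be prolonged by one step in each of the \<open>k\<close> directions forever.\<close>

lemma tilings_at_nonempty:
  assumes e: "e \<in> idents C" obtains w where "w \<in> tilings_at C e"
proof -
  let ?P = "\<lambda>n x. x \<in> arrows C \<and> tgt C x = e \<and> deg C x = vec n"
  have "\<exists>p. \<forall>n. ?P n (p n) \<and> p (Suc n) \<in> arrow_ideal C (p n)"
  proof (rule dependent_nat_choice)
    have "vec 0 = (0::nat ^ 'k)" by (simp add: vec_eq_iff)
    then show "\<exists>x. ?P 0 x" using e deg_ident tgt_ident ident_in by metis
    fix x n assume x: "?P n x"
    obtain c where c: "c \<in> arrows C" "tgt C c = src C x" "deg C c = vec 1"
      using no_sources src_in x unfolding no_sources_def by metis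
    then have "?P (Suc n) (x \<cdot> c)"
      using x by (simp add: cmp_closed tgt_cmp deg_cmp vec_eq_iff)
    then show "\<exists>y. ?P (Suc n) y \<and> y \<in> arrow_ideal C x" using x c ideal_cmp by metis
  qed
  then obtain p where p: "\<And>n. p n \<in> arrows C" "\<And>n. tgt C (p n) = e" "\<And>n. deg C (p n) = vec n"
      "\<And>n. p (Suc n) \<in> arrow_ideal C (p n)" by blast
  obtain w where w: "w \<in> tilings C" "\<And>j. w 0 (deg C (p j)) = p j"
    using tiling_of_sequence[of p] p nat_vec_bounded by metis
  have "w 0 0 = e" using tiling_prefix(3)[OF w(1), of "deg C (p 0)"] w(2)[of 0] p(2) by simp
  then show thesis using that w(1) by (simp add: tilings_at_def)
qed

lemma cyl_nonempty: assumes "x \<in> arrows C" obtains w where "w \<in> cyl x"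
  using tilings_at_nonempty[OF src_in[OF assms]] prepend_in_cyl[OF assms] by metis

lemma finite_degree: "finite {x \<in> arrows C. deg C x = n}"
proof -
  have "{x \<in> arrows C. deg C x = n} \<subseteq> (\<Union>e\<in>idents C. {x \<in> arrow_ideal C e. deg C x = n})"
  proof
    fix x assume x: "x \<in> {x \<in> arrows C. deg C x = n}"
    then have "x = tgt C x \<cdot> x" "tgt C x \<in> idents C" by (auto simp: tgt_cmp_left tgt_in)
    then have "x \<in> arrow_ideal C (tgt C x)"
      using x ident_in src_ident by (auto simp: ideal_iff)
    then show "x \<in> (\<Union>e\<in>idents C. {x \<in> arrow_ideal C e. deg C x = n})"
      using x tgt_in by auto
  qed
  then show ?thesis
    using finite_idents row_finite unfolding row_finite_def by (meson finite_UN_I finite_subset)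
qed

text \<open>Koenig's lemma. If every path enters the bar \<open>\<U>\<close>, but arrows of arbitrarily large degree avoid it, then
  among the finitely many arrows of a given degree one has arbitrarily long prolongations that avoid
  \<open>\<U>\<close> (\<open>bad\<close>). Bad arrows have bad prolongations, and these build a path that never enters \<open>\<U>\<close>.\<close>

lemma bar_uniform:
  assumes U: "\<U> \<subseteq> arrows C"
    and bar: "\<And>w. w \<in> tilings C \<Longrightarrow> \<exists>n. \<exists>u\<in>\<U>. w 0 n \<in> arrow_ideal C u"
  shows "\<exists>N. \<forall>x\<in>arrows C. vec N \<le> deg C x \<longrightarrow> (\<exists>u\<in>\<U>. x \<in> arrow_ideal C u)"
proof (rule ccontr)
  assume neg: "\<not> ?thesis"
  define good where "good x \<longleftrightarrow> (\<exists>u\<in>\<U>. x \<in> arrow_ideal C u)" for x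
  define bad where "bad x \<longleftrightarrow> (\<forall>j. \<exists>y\<in>arrow_ideal C x. vec j \<le> deg C y \<and> \<not> good y)" for x
  have good_ideal: "good y" if "good x" "y \<in> arrow_ideal C x" for x y
    using that U ideal_trans unfolding good_def by blast
  have pigeonhole: "\<exists>x\<in>S. bad x"
    if S: "finite S" and ex: "\<And>j. \<exists>x\<in>S. \<exists>y\<in>arrow_ideal C x. vec j \<le> deg C y \<and> \<not> good y" for S
  proof (rule ccontr)
    assume "\<not> (\<exists>x\<in>S. bad x)"
    then obtain J where J: "\<And>x y. x \<in> S \<Longrightarrow> y \<in> arrow_ideal C x \<Longrightarrow> vec (J x) \<le> deg C y \<Longrightarrow> good y"
      unfolding bad_def by metis
    obtain x y where xy: "x \<in> S" "y \<in> arrow_ideal C x" "vec (Max (J ` S)) \<le> deg C y" "\<not> good y"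
      using ex by blast
    have "vec (J x) \<le> (vec (Max (J ` S)) :: nat ^ 'k)" using xy(1) S by (intro vec_nat_mono) simp
    then show False using J xy order_trans by metis
  qed
  let ?P = "\<lambda>n x. x \<in> arrows C \<and> deg C x = vec n \<and> bad x"
  have "\<exists>p. \<forall>n. ?P n (p n) \<and> p (Suc n) \<in> arrow_ideal C (p n)"
  proof (rule dependent_nat_choice)
    have "\<exists>x\<in>{x \<in> arrows C. deg C x = vec 0}. bad x"
    proof (rule pigeonhole[OF finite_degree])
      fix j
      obtain y where y: "y \<in> arrows C" "vec j \<le> deg C y" "\<not> good y" using neg unfolding good_def by blast
      have "vec 0 \<le> deg C y" by (simp add: less_eq_vec_def)
      then show "\<exists>x\<in>{x \<in> arrows C. deg C x = vec 0}. \<exists>y\<in>arrow_ideal C x. vec j \<le> deg C y \<and> \<not> good y"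
        using prefix_exists[OF y(1), of "vec 0"] y(2,3) by blast
    qed
    then show "\<exists>x. ?P 0 x" by blast
  next
    fix x n assume x: "?P n x"
    let ?S = "{x' \<in> arrow_ideal C x. deg C x' = vec (Suc n)}"
    have "\<exists>x'\<in>?S. bad x'"
    proof (rule pigeonhole)
      have "?S \<subseteq> {x \<in> arrows C. deg C x = vec (Suc n)}" using x ideal_arrow by blast
      then show "finite ?S" using finite_degree finite_subset by blast
      fix j
      obtain y where y: "y \<in> arrow_ideal C x" "vec (max j (Suc n)) \<le> deg C y" "\<not> good y"
        using x unfolding bad_def by blast
      have le: "vec j \<le> deg C y" "vec (Suc n) \<le> deg C y"
        using order_trans[OF vec_nat_mono y(2)] by auto
      have ya: "y \<in> arrows C" using x y ideal_arrow by blast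
      obtain x' where x': "x' \<in> arrows C" "deg C x' = vec (Suc n)" "y \<in> arrow_ideal C x'"
        using prefix_exists[OF ya le(2)] by metis
      have "x' \<in> arrow_ideal C x"
        using ideal_comparable[of x x' y] x x' y(1) vec_nat_mono[of n "Suc n"] by simp
      then show "\<exists>x'\<in>?S. \<exists>y\<in>arrow_ideal C x'. vec j \<le> deg C y \<and> \<not> good y"
        using x' y(3) le(1) by blast
    qed
    then show "\<exists>y. ?P (Suc n) y \<and> y \<in> arrow_ideal C x" using x ideal_arrow by blast
  qed
  then obtain p where p: "\<And>n. p n \<in> arrows C" "\<And>n. deg C (p n) = vec n" "\<And>n. bad (p n)"
      "\<And>n. p (Suc n) \<in> arrow_ideal C (p n)" by blast
  obtain w where w: "w \<in> tilings C" "\<And>j. w 0 (deg C (p j)) = p j"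
    using tiling_of_sequence[of p] p nat_vec_bounded by metis
  obtain n where n: "good (w 0 n)" using bar[OF w(1)] unfolding good_def by blast
  obtain j where "n \<le> vec j" using nat_vec_bounded by blast
  then have "p j \<in> arrow_ideal C (w 0 n)"
    using tiling_prefix(4)[OF w(1), of n "vec j"] w(2)[of j] p(2) by simp
  then have "good (p j)" using n good_ideal by blast
  moreover obtain y where "y \<in> arrow_ideal C (p j)" "\<not> good y" using p(3)[of j] unfolding bad_def by blast
  ultimately show False using good_ideal by blast
qed

lemma path_compact: "compact_space path_topology"
  unfolding compact_space_alt topspace_path
proof (intro allI impI)
  fix \<V> :: "('a, 'k) tiling set set"
  assume "(\<forall>U\<in>\<V>. openin path_topology U) \<and> tilings C \<subseteq> \<Union>\<V>"
  then have V: "\<And>U. U \<in> \<V> \<Longrightarrow> openin path_topology U" "tilings C \<subseteq> \<Union>\<V>" by auto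
  let ?\<U> = "{x \<in> arrows C. \<exists>V\<in>\<V>. cyl x \<subseteq> V}"
  have "\<exists>n. \<exists>u\<in>?\<U>. w 0 n \<in> arrow_ideal C u" if w: "w \<in> tilings C" for w
  proof -
    obtain U where U: "U \<in> \<V>" "w \<in> U" using V(2) w by blast
    then obtain n where "cyl (w 0 n) \<subseteq> U" using V(1) unfolding openin_path by blast
    then have "w 0 n \<in> ?\<U>" using U(1) tiling_prefix(1)[OF w] by blast
    then show ?thesis using ideal_self[OF tiling_prefix(1)[OF w]] by blast
  qed
  then obtain N where N: "\<And>x. x \<in> arrows C \<Longrightarrow> vec N \<le> deg C x \<Longrightarrow> \<exists>u\<in>?\<U>. x \<in> arrow_ideal C u"
    using bar_uniform[of ?\<U>] by blast
  let ?D = "{x \<in> arrows C. deg C x = vec N}"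
  have "\<forall>x\<in>?D. \<exists>V. V \<in> \<V> \<and> cyl x \<subseteq> V"
  proof
    fix x assume x: "x \<in> ?D"
    obtain u where "u \<in> ?\<U>" "x \<in> arrow_ideal C u" using N[of x] x by auto
    then show "\<exists>V. V \<in> \<V> \<and> cyl x \<subseteq> V" using cyl_mono[of u x] by blast
  qed
  from bchoice[OF this] obtain F where F: "\<And>x. x \<in> ?D \<Longrightarrow> F x \<in> \<V>" "\<And>x. x \<in> ?D \<Longrightarrow> cyl x \<subseteq> F x"
    by blast
  have 1: "tilings C \<subseteq> \<Union>(F ` ?D)"
  proof
    fix w assume w: "w \<in> tilings C"
    have "w 0 (vec N) \<in> ?D" using tiling_prefix(1,2)[OF w] by simp
    then show "w \<in> \<Union>(F ` ?D)" using F(2) prefix_in_cyl[OF w] by blast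
  qed
  have 2: "finite (F ` ?D)" by (rule finite_imageI[OF finite_degree])
  have 3: "F ` ?D \<subseteq> \<V>" using F(1) by (rule image_subsetI)
  show "\<exists>\<F>. finite \<F> \<and> \<F> \<subseteq> \<V> \<and> tilings C \<subseteq> \<Union>\<F>"
    by (rule exI[of _ "F ` ?D"], intro conjI) (rule 1 2 3)+
qed

text \<open>Suppose that \<open>u\<close> is the only path at the source of \<open>x\<close>. Its diagonal segments are infinitely many, the
  vertices finitely many, so two distinct segments \<open>a\<close> and \<open>b\<close> of \<open>u\<close> end at the same vertex. For every \<open>c\<close>
  the arrows \<open>a c\<close> and \<open>b c\<close> are both segments of \<open>u\<close>, hence dependent, contrary to aperiodicity.\<close>

lemma cyl_two_points:
  assumes x: "x \<in> arrows C"
  obtains w v where "w \<in> cyl x" "v \<in> cyl x" "w \<noteq> v"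
proof (rule ccontr)
  assume "\<not> thesis"
  then have single: "\<forall>w\<in>cyl x. \<forall>v\<in>cyl x. w = v" using that by blast
  obtain u where u: "u \<in> tilings_at C (src C x)" using tilings_at_nonempty src_in[OF x] by blast
  have ut: "u \<in> tilings C" using u tilings_atD by blast
  let ?a = "\<lambda>j::nat. u 0 (vec j)"
  have "range (\<lambda>j. src C (?a j)) \<subseteq> idents C" using src_in tiling_prefix(1)[OF ut] by blast
  then have "\<not> inj (\<lambda>j. src C (?a j))"
    using finite_idents finite_subset finite_imageD infinite_UNIV_nat by metis
  then obtain i j where ij: "i \<noteq> j" "src C (?a i) = src C (?a j)" by (auto simp: inj_def)
  have "(vec i :: nat ^ 'k) \<noteq> vec j" using ij(1) by (simp add: vec_eq_iff)
  then have "?a i \<noteq> ?a j" using tiling_prefix(2)[OF ut] by metis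
  then obtain c where c: "c \<in> arrows C" "src C (?a i) = tgt C c"
      "independent_arrows C (?a i \<cdot> c) (?a j \<cdot> c)"
    using aperiodic ij(2) tiling_prefix(1)[OF ut] unfolding aperiodic_cat_def by metis
  obtain t where t: "t \<in> tilings_at C (src C c)" using tilings_at_nonempty src_in[OF c(1)] by blast
  have ext: "prepend C (?a k \<cdot> c) t \<in> cyl (?a k \<cdot> c)" "prepend C (?a k \<cdot> c) t \<in> tilings_at C (src C x)"
    if k: "src C (?a k) = tgt C c" for k
  proof -
    have 1: "?a k \<cdot> c \<in> arrows C" "src C (?a k \<cdot> c) = src C c" "tgt C (?a k \<cdot> c) = src C x"
      using k c tiling_prefix(1)[OF ut] tiling_at_src(2)[OF u] by (auto simp: cmp_closed src_cmp tgt_cmp)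
    show "prepend C (?a k \<cdot> c) t \<in> cyl (?a k \<cdot> c)" "prepend C (?a k \<cdot> c) t \<in> tilings_at C (src C x)"
      using 1 t prepend_in_cyl[of "?a k \<cdot> c" t] prepend_at[of "?a k \<cdot> c" t] by auto
  qed
  have "prepend C (?a i \<cdot> c) t = prepend C (?a j \<cdot> c) t"
    using single prepend_in_cyl[OF x] prepend_inj[OF x] ext(2) c(2) ij(2) by metis
  then show False using independent_cyl[OF c(3)] ext(1) c(2) ij(2) by (metis disjoint_iff)
qed

text \<open>Orbits are dense: by cofinality a sufficiently long initial segment of \<open>w\<close> begins with one of finitely
  many arrows whose sources are joined by an arrow to the source of \<open>x\<close>.\<close>

lemma orbit_meets:
  assumes w: "w \<in> tilings C" and x: "x \<in> arrows C"
  obtains v where "v \<in> cyl x" "tail_equivalent v w"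
proof -
  obtain X where X: "finite X" "large_in C X (w 0 0)"
      "\<And>z. z \<in> X \<Longrightarrow> \<exists>a\<in>arrows C. tgt C a = src C x \<and> src C a = src C z"
    using cofinal src_in[OF x] tiling_ident[OF w] unfolding cofinal_cat_def by metis
  have e: "w 0 0 \<in> arrows C" using tiling_prefix(1)[OF w] .
  have Xa: "z \<in> arrows C" if "z \<in> X" for z
    using that X(2) e ideal_arrow unfolding large_in_def by blast
  define n where "n = (\<Sum>z\<in>X. deg C z)"
  have n: "deg C z \<le> n" if "z \<in> X" for z
    unfolding n_def using X(1) that by (auto simp: less_eq_vec_def sum_component intro: member_le_sum)
  have "w 0 n \<in> arrow_ideal C (w 0 0)" using tiling_prefix(4)[OF w] nat_vec_le_add(3) by blast
  then obtain z b where z: "z \<in> X" "b \<in> arrow_ideal C (w 0 n)" "b \<in> arrow_ideal C z"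
    using X(2) unfolding large_in_def independent_arrows_def by blast
  have "w 0 n \<in> arrow_ideal C z"
    using ideal_comparable[OF Xa[OF z(1)] tiling_prefix(1)[OF w] z(3,2)] n[OF z(1)] tiling_prefix(2)[OF w] by simp
  then have wz: "w \<in> cyl z" using tiling_prefixI[OF w Xa[OF z(1)]] w by (simp add: cyl_def)
  obtain a where a: "a \<in> arrows C" "tgt C a = src C x" "src C a = src C z" using X(3)[OF z(1)] by blast
  let ?u = "tshift (deg C z) w"
  have xa: "x \<cdot> a \<in> arrows C" "src C (x \<cdot> a) = src C z" using a x by (auto simp: cmp_closed src_cmp)
  have u: "?u \<in> tilings_at C (src C z)" using tail_in[OF wz] .
  have "prepend C (x \<cdot> a) ?u \<in> cyl x"
    using prepend_in_cyl[OF xa(1), of ?u] u xa(2) cyl_mono[OF x ideal_cmp[OF x a(1)]] a(2) by auto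
  moreover have "tail_equivalent (prepend C (x \<cdot> a) ?u) w"
    unfolding tail_equivalent_def using xa u Xa[OF z(1)] cyl_prepend[OF wz] by metis
  ultimately show thesis using that by blast
qed

text \<open>A dense orbit meets a cylinder around a second point of \<open>cyl x\<close> that does not contain \<open>w\<close>.\<close>

lemma orbit_other:
  assumes w: "w \<in> cyl x"
  obtains v where "v \<in> cyl x" "v \<noteq> w" "tail_equivalent v w"
proof -
  have x: "x \<in> arrows C" using cyl_arrow[OF w] .
  obtain v1 where v1: "v1 \<in> cyl x" "v1 \<noteq> w" using cyl_two_points[OF x] by metis
  have t: "w \<in> tilings C" "v1 \<in> tilings C" using w v1 cyl_subset_tilings by blast+
  obtain n where n: "deg C x \<le> n" "cyl (w 0 n) \<inter> cyl (v1 0 n) = {}"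
    using tilings_separated[OF t v1(2)[symmetric]] by metis
  obtain v where v: "v \<in> cyl (v1 0 n)" "tail_equivalent v w"
    using orbit_meets[OF t(1) tiling_prefix(1)[OF t(2)]] by metis
  have "v \<in> cyl x" using v(1) prefix_cyl_iff[OF t(2) v(1) n(1)] v1(1) by simp
  moreover have "v \<noteq> w" using v(1) n(2) prefix_in_cyl[OF t(1)] by blast
  ultimately show thesis using that v(2) by blast
qed

end

section \<open>The topological full group\<close>

context higher_rank_graph begin

definition replaces :: "(('a, 'k) tiling \<Rightarrow> ('a, 'k) tiling) \<Rightarrow> 'a \<Rightarrow> 'a \<Rightarrow> bool" where
  "replaces f x y \<longleftrightarrow> x \<in> arrows C \<and> y \<in> arrows C \<and> src C x = src C y \<and>
     (\<forall>u\<in>tilings_at C (src C x). f (prepend C x u) = prepend C y u)"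

lemma replaces_arrows: "replaces f x y \<Longrightarrow> x \<in> arrows C" "replaces f x y \<Longrightarrow> y \<in> arrows C"
  "replaces f x y \<Longrightarrow> src C x = src C y"
  by (auto simp: replaces_def)

lemma replaces_cyl: assumes "replaces f x y" "w \<in> cyl x"
  shows "f w \<in> cyl y" "tshift (deg C y) (f w) = tshift (deg C x) w"
proof -
  let ?u = "tshift (deg C x) w"
  have u: "?u \<in> tilings_at C (src C x)" "?u \<in> tilings_at C (src C y)"
    using tail_in[OF assms(2)] assms(1) by (auto simp: replaces_def)
  have fw: "f w = prepend C y ?u"
    using assms(1) u cyl_prepend[OF assms(2)] unfolding replaces_def by metis
  have y: "y \<in> arrows C" using replaces_arrows[OF assms(1)] by blast
  show "f w \<in> cyl y" "tshift (deg C y) (f w) = ?u"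
    unfolding fw by (rule prepend_in_cyl[OF y u(2)], rule prepend_shift[OF y u(2)])
qed

lemma replaces_cmp:
  assumes "replaces f x y" "c \<in> arrows C" "src C x = tgt C c"
  shows "replaces f (x \<cdot> c) (y \<cdot> c)"
proof -
  have xy: "x \<in> arrows C" "y \<in> arrows C" "src C y = tgt C c" "src C x = src C y"
    using assms by (auto simp: replaces_def)
  have "f (prepend C (x \<cdot> c) u) = prepend C (y \<cdot> c) u" if u: "u \<in> tilings_at C (src C c)" for u
  proof -
    have "prepend C c u \<in> tilings_at C (src C x)" using prepend_at[OF assms(2) u] assms(3) by simp
    then have "f (prepend C x (prepend C c u)) = prepend C y (prepend C c u)"
      using assms(1) by (simp add: replaces_def)
    then show ?thesis
      using prepend_cmp[OF xy(1) assms(2,3) u] prepend_cmp[OF xy(2) assms(2) xy(3) u] by simp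
  qed
  then show ?thesis
    using xy assms by (simp add: replaces_def cmp_closed src_cmp)
qed

text \<open>Replacements may be refined along a path. The degrees of both segments grow by the same amount, which
  makes the difference of the degrees an invariant of the germ.\<close>

lemma replaces_prefix:
  assumes "replaces f x y" "w \<in> cyl x"
  shows "replaces f (w 0 (deg C x + k)) (f w 0 (deg C y + k))"
proof -
  have xy: "x \<in> arrows C" "y \<in> arrows C" "src C x = src C y" using assms by (auto simp: replaces_def)
  let ?u = "tshift (deg C x) w"
  have u: "?u \<in> tilings_at C (src C x)" using tail_in[OF assms(2)] .
  have fw: "f w \<in> cyl y" "tshift (deg C y) (f w) = ?u" using replaces_cyl[OF assms] by auto
  have "w 0 (deg C x + k) = x \<cdot> ?u 0 k"
    using tshift_prefix[of w "deg C x" k] assms(2) by (simp add: cyl_def)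
  moreover have "f w 0 (deg C y + k) = y \<cdot> ?u 0 k"
    using tshift_prefix[of "f w" "deg C y" k] fw by (simp add: cyl_def)
  moreover have "?u 0 k \<in> arrows C" "tgt C (?u 0 k) = src C x"
    using tiling_prefix(1) tilings_atD u tiling_at_src(2) by metis+
  ultimately show ?thesis using replaces_cmp[OF assms(1)] by simp
qed

lemma replaces_deep:
  assumes "replaces f x y" "w \<in> cyl x"
  obtains x' y' where "replaces f x' y'" "w \<in> cyl x'" "n \<le> deg C x'" "n \<le> deg C y'"
    "cyl x' \<subseteq> cyl x"
proof -
  have w: "w \<in> tilings C" using assms cyl_subset_tilings by blast
  have fw: "f w \<in> tilings C" using replaces_cyl(1)[OF assms] cyl_subset_tilings by blast
  have wx: "w 0 (deg C x) = x" using assms(2) by (simp add: cyl_def)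
  show thesis
  proof (rule that[OF replaces_prefix[OF assms, of n] prefix_in_cyl[OF w]])
    show "n \<le> deg C (w 0 (deg C x + n))" "n \<le> deg C (f w 0 (deg C y + n))"
      unfolding tiling_prefix(2)[OF w] tiling_prefix(2)[OF fw] by (rule nat_vec_le_add(2))+
    show "cyl (w 0 (deg C x + n)) \<subseteq> cyl x"
      using cyl_prefix_mono[OF w nat_vec_le_add(1)[of "deg C x" n]] unfolding wx .
  qed
qed

lemma replaces_at:
  assumes "replaces f x y" "w \<in> cyl x" "deg C x \<le> n"
  shows "replaces f (w 0 n) (f w 0 (deg C y + (n - deg C x)))"
  using replaces_prefix[OF assms(1,2), of "n - deg C x"] nat_vec_add_diff[OF assms(3)] by simp

definition full_group_maps :: "(('a, 'k) tiling \<Rightarrow> ('a, 'k) tiling) set" where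
  "full_group_maps = {f \<in> Bij (tilings C). \<forall>w\<in>tilings C. \<exists>x y. replaces f x y \<and> w \<in> cyl x}"

definition full_group :: "(('a, 'k) tiling \<Rightarrow> ('a, 'k) tiling) monoid" where
  "full_group = BijGroup (tilings C)\<lparr>carrier := full_group_maps\<rparr>"

lemma full_group_carrier: "carrier full_group = full_group_maps"
  by (simp add: full_group_def)

lemma full_group_local:
  assumes "f \<in> full_group_maps" "w \<in> tilings C"
  obtains x y where "replaces f x y" "w \<in> cyl x" "f w \<in> cyl y" "n \<le> deg C x" "n \<le> deg C y"
proof -
  obtain x y where "replaces f x y" "w \<in> cyl x" using assms unfolding full_group_maps_def by blast
  then obtain x' y' where "replaces f x' y'" "w \<in> cyl x'" "n \<le> deg C x'" "n \<le> deg C y'"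
    using replaces_deep by metis
  then show thesis using that replaces_cyl(1) by blast
qed

lemma full_group_in: "f \<in> full_group_maps \<Longrightarrow> w \<in> tilings C \<Longrightarrow> f w \<in> tilings C"
  by (auto simp: full_group_maps_def dest: Bij_imp_funcset)

lemma replaces_compose:
  assumes "replaces g x y" "replaces f y z" shows "replaces (compose (tilings C) f g) x z"
  using assms prepend_tiling by (auto simp: replaces_def compose_def)

lemma replaces_inverse:
  assumes "f \<in> Bij (tilings C)" "replaces f x y"
  shows "replaces (restrict (inv_into (tilings C) f) (tilings C)) y x"
proof -
  have inj: "inj_on f (tilings C)" using assms(1) by (simp add: Bij_def bij_betw_def)
  have "inv_into (tilings C) f (prepend C y u) = prepend C x u" if u: "u \<in> tilings_at C (src C x)" for u
    using assms(2) u prepend_tiling inv_into_f_f[OF inj, of "prepend C x u"] by (simp add: replaces_def)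
  then show ?thesis using assms(2) prepend_tiling by (auto simp: replaces_def)
qed

lemma compose_full_group:
  assumes f: "f \<in> full_group_maps" and g: "g \<in> full_group_maps"
  shows "compose (tilings C) f g \<in> full_group_maps"
  unfolding full_group_maps_def
proof (intro CollectI conjI ballI)
  show "compose (tilings C) f g \<in> Bij (tilings C)"
    using f g by (simp add: full_group_maps_def compose_Bij)
  fix w assume w: "w \<in> tilings C"
  obtain a b where ab: "replaces f a b" "g w \<in> cyl a"
    using full_group_local[OF f full_group_in[OF g w]] by metis
  obtain x y where xy: "replaces g x y" "w \<in> cyl x" "g w \<in> cyl y" "deg C a \<le> deg C y"
    using full_group_local[OF g w, of "deg C a"] by metis
  have "replaces f (g w 0 (deg C y)) (f (g w) 0 (deg C b + (deg C y - deg C a)))"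
    by (rule replaces_at[OF ab xy(4)])
  moreover have "g w 0 (deg C y) = y" using xy(3) by (simp add: cyl_def)
  ultimately show "\<exists>x y. replaces (compose (tilings C) f g) x y \<and> w \<in> cyl x"
    using replaces_compose[OF xy(1)] xy(2) by metis
qed

lemma replaces_id: "x \<in> arrows C \<Longrightarrow> replaces (\<lambda>w\<in>tilings C. w) x x"
  using prepend_tiling by (simp add: replaces_def)

lemma group_full_group: "group full_group"
  unfolding full_group_def
proof (rule subgroup.subgroup_is_group[OF subgroup.intro group_BijGroup])
  show "full_group_maps \<subseteq> carrier (BijGroup (tilings C))"
    by (auto simp: full_group_maps_def BijGroup_def)
  show "\<one>\<^bsub>BijGroup (tilings C)\<^esub> \<in> full_group_maps"
    using prefix_in_cyl replaces_id tiling_prefix(1)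
    by (fastforce simp: BijGroup_def full_group_maps_def id_Bij)
  fix f assume f: "f \<in> full_group_maps"
  then have fB: "f \<in> Bij (tilings C)" by (simp add: full_group_maps_def)
  let ?i = "restrict (inv_into (tilings C) f) (tilings C)"
  have "?i \<in> full_group_maps"
    unfolding full_group_maps_def
  proof (intro CollectI conjI ballI)
    show "?i \<in> Bij (tilings C)" by (rule restrict_inv_into_Bij[OF fB])
    fix w assume w: "w \<in> tilings C"
    have s: "f ` tilings C = tilings C" using fB by (simp add: Bij_def bij_betw_def)
    then obtain v where v: "v \<in> tilings C" "w = f v" using w by blast
    obtain x y where "replaces f x y" "f v \<in> cyl y" using full_group_local[OF f v(1)] by metis
    then show "\<exists>x y. replaces ?i x y \<and> w \<in> cyl x"
      using replaces_inverse[OF fB] v(2) by blast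
  qed
  then show "inv\<^bsub>BijGroup (tilings C)\<^esub> f \<in> full_group_maps"
    by (simp add: inv_BijGroup[OF fB])
  fix g assume g: "g \<in> full_group_maps"
  show "f \<otimes>\<^bsub>BijGroup (tilings C)\<^esub> g \<in> full_group_maps"
    using compose_full_group[OF f g] f g by (simp add: BijGroup_def full_group_maps_def)
qed

lemma full_group_mult:
  "f \<in> full_group_maps \<Longrightarrow> g \<in> full_group_maps \<Longrightarrow> f \<otimes>\<^bsub>full_group\<^esub> g = compose (tilings C) f g"
  by (simp add: full_group_def BijGroup_def full_group_maps_def)

lemma full_group_one: "\<one>\<^bsub>full_group\<^esub> = (\<lambda>w\<in>tilings C. w)"
  by (simp add: full_group_def BijGroup_def)

lemma full_group_eqI:
  "f \<in> full_group_maps \<Longrightarrow> g \<in> full_group_maps \<Longrightarrow> (\<And>w. w \<in> tilings C \<Longrightarrow> f w = g w) \<Longrightarrow> f = g"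
  by (auto simp: full_group_maps_def Bij_def intro: extensionalityI)

lemma involutive_full_group:
  assumes "\<And>w. w \<in> tilings C \<Longrightarrow> f w \<in> tilings C" "\<And>w. w \<in> tilings C \<Longrightarrow> f (f w) = w"
    and "\<And>w. w \<in> tilings C \<Longrightarrow> \<exists>x y. replaces f x y \<and> w \<in> cyl x"
  shows "restrict f (tilings C) \<in> full_group_maps"
proof -
  have "bij_betw (restrict f (tilings C)) (tilings C) (tilings C)"
    using assms by (intro bij_betw_byWitness[where f' = f]) auto
  moreover have "replaces (restrict f (tilings C)) x y" if "replaces f x y" for x y
    using that prepend_tiling by (simp add: replaces_def)
  ultimately show ?thesis using assms(3) unfolding full_group_maps_def Bij_def by blast
qed

text \<open>The elements of the full group that are constructed below, and the germs of all kinds, come from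
  exchanging two disjoint cylinders with the same tails.\<close>

lemma swap_exists:
  assumes x: "x \<in> arrows C" and y: "y \<in> arrows C" and xy: "src C x = src C y" and dis: "cyl x \<inter> cyl y = {}"
  shows "\<exists>f\<in>full_group_maps. replaces f x y \<and> replaces f y x \<and>
    (\<forall>w\<in>tilings C. w \<notin> cyl x \<longrightarrow> w \<notin> cyl y \<longrightarrow> f w = w) \<and> (\<forall>w\<in>tilings C. f (f w) = w)"
proof -
  define f where "f w = (if w \<in> cyl x then prepend C y (tshift (deg C x) w)
    else if w \<in> cyl y then prepend C x (tshift (deg C y) w) else w)" for w
  have nx: "w \<notin> cyl x" if "w \<in> cyl y" for w using that dis by blast
  have r: "replaces f x y"
    using x y xy prepend_in_cyl prepend_shift by (simp add: replaces_def f_def)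
  have r': "replaces f y x"
    using x y xy nx[OF prepend_in_cyl] prepend_in_cyl prepend_shift by (simp add: replaces_def f_def)
  have in_t: "f w \<in> tilings C" if w: "w \<in> tilings C" for w
  proof (cases "w \<in> cyl x \<or> w \<in> cyl y")
    case True
    then show ?thesis using replaces_cyl(1)[OF r] replaces_cyl(1)[OF r'] cyl_subset_tilings by blast
  next
    case False
    then show ?thesis using w by (simp add: f_def)
  qed
  have inv: "f (f w) = w" if w: "w \<in> tilings C" for w
  proof -
    consider "w \<in> cyl x" | "w \<in> cyl y" "w \<notin> cyl x" | "w \<notin> cyl x" "w \<notin> cyl y" by blast
    then show ?thesis
    proof cases
      case 1
      have "f (f w) = prepend C x (tshift (deg C y) (f w))"
        using replaces_cyl(1)[OF r 1] nx by (simp add: f_def[of "f w"])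
      then show ?thesis using replaces_cyl(2)[OF r 1] cyl_prepend[OF 1] by simp
    next
      case 2
      have "f (f w) = prepend C y (tshift (deg C x) (f w))"
        using replaces_cyl(1)[OF r' 2(1)] by (simp add: f_def[of "f w"])
      then show ?thesis using replaces_cyl(2)[OF r' 2(1)] cyl_prepend[OF 2(1)] by simp
    next
      case 3
      then show ?thesis by (simp add: f_def)
    qed
  qed
  have fix_out: "f w = w" if "w \<notin> cyl x" "w \<notin> cyl y" for w using that by (simp add: f_def)
  have local: "\<exists>a b. replaces f a b \<and> w \<in> cyl a" if w: "w \<in> tilings C" for w
  proof (cases "w \<in> cyl x \<or> w \<in> cyl y")
    case True
    then show ?thesis using r r' by blast
  next
    case False
    let ?z = "w 0 (deg C x + deg C y)"
    have za: "?z \<in> arrows C" using tiling_prefix(1)[OF w] .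
    have "f v = v" if "v \<in> cyl ?z" for v
      using prefix_cyl_iff[OF w that nat_vec_le_add(1)] prefix_cyl_iff[OF w that nat_vec_le_add(2)]
        False fix_out by blast
    then have "replaces f ?z ?z" using za prepend_in_cyl by (simp add: replaces_def)
    then show ?thesis using prefix_in_cyl[OF w] by blast
  qed
  have res: "replaces (restrict f (tilings C)) a b" if "replaces f a b" for a b
    using that prepend_tiling by (simp add: replaces_def)
  show ?thesis
    using involutive_full_group[OF in_t inv local] res[OF r] res[OF r'] fix_out inv in_t
    by (intro bexI[of _ "restrict f (tilings C)"]) auto
qed

end

context path_graph begin

text \<open>If \<open>y \<noteq> z\<close>, then \<open>y u\<close> and \<open>z u\<close> are independent for some \<open>u\<close>, but the image of any path starting with
  \<open>x u\<close> starts with both. This is where the groupoid is seen to be effective.\<close>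

lemma replaces_unique:
  assumes "replaces f x y" "replaces f x z" shows "y = z"
proof (rule ccontr)
  assume "y \<noteq> z"
  have a: "y \<in> arrows C" "z \<in> arrows C" "src C x = src C y" "src C x = src C z"
    using assms by (auto simp: replaces_def)
  then obtain u where u: "u \<in> arrows C" "src C y = tgt C u" "independent_arrows C (y \<cdot> u) (z \<cdot> u)"
    using aperiodic \<open>y \<noteq> z\<close> unfolding aperiodic_cat_def by metis
  obtain w where w: "w \<in> cyl (x \<cdot> u)"
    using cyl_nonempty[of "x \<cdot> u"] cmp_closed assms u a replaces_arrows by metis
  have "f w \<in> cyl (y \<cdot> u)" "f w \<in> cyl (z \<cdot> u)"
    using replaces_cyl(1)[OF replaces_cmp[OF assms(1) u(1)]]
      replaces_cyl(1)[OF replaces_cmp[OF assms(2) u(1)]] u w a by auto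
  then show False using independent_cyl[OF u(3)] by blast
qed

lemma degree_jump_unique:
  assumes "replaces f x y" "replaces f x' y'" "w \<in> cyl x" "w \<in> cyl x'"
  shows "int_vec (deg C y) - int_vec (deg C x) = int_vec (deg C y') - int_vec (deg C x')"
proof -
  let ?n = "deg C x + deg C x'"
  have w: "w \<in> tilings C" using assms cyl_subset_tilings by blast
  have fw: "f w \<in> tilings C" using replaces_cyl(1)[OF assms(1,3)] cyl_subset_tilings by blast
  have 1: "replaces f (w 0 ?n) (f w 0 (deg C y + deg C x'))"
    using replaces_prefix[OF assms(1,3)] .
  have 2: "replaces f (w 0 ?n) (f w 0 (deg C y' + deg C x))"
    using replaces_prefix[OF assms(2,4), of "deg C x"] by (simp add: add.commute)
  have "deg C y + deg C x' = deg C y' + deg C x"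
    using replaces_unique[OF 1 2] tiling_prefix(2)[OF fw] by metis
  then have "int_vec (deg C y) + int_vec (deg C x') = int_vec (deg C y') + int_vec (deg C x)"
    by (simp flip: int_vec_add)
  then show ?thesis by (simp add: algebra_simps)
qed

text \<open>The canonical cocycle with values in \<open>\<int>\<^sup>k\<close>, which is the middle component of an arrow of the groupoid.\<close>

definition degree_jump :: "(('a, 'k) tiling \<Rightarrow> ('a, 'k) tiling) \<Rightarrow> ('a, 'k) tiling \<Rightarrow> int ^ 'k" where
  "degree_jump f w = (THE n. \<exists>x y. replaces f x y \<and> w \<in> cyl x \<and> n = int_vec (deg C y) - int_vec (deg C x))"

lemma degree_jump_eq:
  "replaces f x y \<Longrightarrow> w \<in> cyl x \<Longrightarrow> degree_jump f w = int_vec (deg C y) - int_vec (deg C x)"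
  unfolding degree_jump_def by (rule the_equality) (use degree_jump_unique in blast)+

lemma degree_jump_compose:
  assumes f: "f \<in> full_group_maps" and g: "g \<in> full_group_maps" and w: "w \<in> tilings C"
  shows "degree_jump (compose (tilings C) f g) w = degree_jump f (g w) + degree_jump g w"
proof -
  obtain a b where ab: "replaces f a b" "g w \<in> cyl a"
    using full_group_local[OF f full_group_in[OF g w]] by metis
  obtain x y where xy: "replaces g x y" "w \<in> cyl x" "g w \<in> cyl y" "deg C a \<le> deg C y"
    using full_group_local[OF g w, of "deg C a"] by metis
  have "g w 0 (deg C y) = y" using xy(3) by (simp add: cyl_def)
  then obtain z where z: "replaces f y z" using replaces_at[OF ab xy(4)] by metis
  show ?thesis
    using degree_jump_eq[OF replaces_compose[OF xy(1) z] xy(2)] degree_jump_eq[OF z xy(3)]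
      degree_jump_eq[OF xy(1,2)] by simp
qed

lemma degree_jump_one: "w \<in> tilings C \<Longrightarrow> degree_jump (\<lambda>w\<in>tilings C. w) w = 0"
  using degree_jump_eq[OF replaces_id prefix_in_cyl] tiling_prefix(1) by (metis diff_self)

lemma replaces_same_jump:
  assumes "replaces f x y" "w \<in> cyl x" "degree_jump f w = 0" "f w = w"
  shows "x = y"
proof -
  have "deg C y = deg C x"
    using degree_jump_eq[OF assms(1,2)] assms(3) by (simp add: int_vec_inj)
  then show ?thesis using replaces_cyl(1)[OF assms(1,2)] assms(2,4) by (simp add: cyl_def)
qed

text \<open>At a fixed point of an involution \<open>p\<close> the cocycle takes a value \<open>n\<close> with \<open>n + n = 0\<close>, because \<open>p p = 1\<close>. So
  \<open>p\<close> replaces a segment by another one of the same degree and with a common path, that is by itself, and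
  \<open>p\<close> is the identity near the fixed point.\<close>

lemma full_group_involution_support_closed:
  assumes p: "p \<in> full_group_maps" and pp: "\<And>w. w \<in> tilings C \<Longrightarrow> p (p w) = w"
  shows "closedin path_topology {w \<in> tilings C. p w \<noteq> w}"
  unfolding closedin_def topspace_path openin_path
proof (intro conjI ballI)
  fix w assume "w \<in> tilings C - {w \<in> tilings C. p w \<noteq> w}"
  then have w: "w \<in> tilings C" "p w = w" by auto
  have "compose (tilings C) p p = (\<lambda>w\<in>tilings C. w)" using pp by (auto simp: compose_def)
  then have "degree_jump p w + degree_jump p w = 0"
    using degree_jump_compose[OF p p w(1)] degree_jump_one[OF w(1)] w(2) by simp
  then have j: "degree_jump p w = 0" by (simp add: vec_eq_iff)
  obtain x y where xy: "replaces p x y" "w \<in> cyl x" using full_group_local[OF p w(1)] by metis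
  have "x = y" using replaces_same_jump[OF xy j w(2)] .
  then have "p v = v" if "v \<in> cyl x" for v
    using xy(1) cyl_prepend[OF that] tail_in[OF that] by (metis replaces_def)
  then have "cyl (w 0 (deg C x)) \<subseteq> tilings C - {w \<in> tilings C. p w \<noteq> w}"
    using xy(2) cyl_subset_tilings by (auto simp: cyl_def)
  then show "\<exists>n. cyl (w 0 n) \<subseteq> tilings C - {w \<in> tilings C. p w \<noteq> w}" ..
qed blast+

lemma full_group_continuous:
  assumes f: "f \<in> full_group_maps" shows "continuous_map path_topology path_topology f"
  unfolding continuous_map_def topspace_path
proof (intro conjI allI impI)
  show "f \<in> tilings C \<rightarrow> tilings C" using full_group_in[OF f] by blast
  fix V assume V: "openin path_topology V"
  show "openin path_topology {w \<in> tilings C. f w \<in> V}"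
    unfolding openin_path
  proof (intro conjI ballI)
    fix w assume w: "w \<in> {w \<in> tilings C. f w \<in> V}"
    then obtain n where n: "cyl (f w 0 n) \<subseteq> V" using V unfolding openin_path by blast
    have wt: "w \<in> tilings C" using w by blast
    obtain x y where xy: "replaces f x y" "w \<in> cyl x" "f w \<in> cyl y" "n \<le> deg C y"
      using full_group_local[OF f wt, of n] by metis
    have "cyl y \<subseteq> cyl (f w 0 n)"
      using cyl_prefix_mono[OF _ xy(4), of "f w"] xy(3) by (simp add: cyl_def)
    then have "cyl x \<subseteq> {w \<in> tilings C. f w \<in> V}"
      using replaces_cyl(1)[OF xy(1)] n cyl_subset_tilings by blast
    then show "\<exists>n. cyl (w 0 n) \<subseteq> {w \<in> tilings C. f w \<in> V}"
      using xy(2) by (intro exI[of _ "deg C x"]) (simp add: cyl_def)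
  qed blast
qed

text \<open>Swap a small cylinder around \<open>w\<close> with one around another point of its orbit that also lies in \<open>V\<close>.\<close>

lemma full_group_local_involution:
  assumes V: "openin path_topology V" and w: "w \<in> V"
  shows "\<exists>p\<in>full_group_maps. (\<forall>v\<in>tilings C. p (p v) = v) \<and> p w \<noteq> w \<and>
    (\<forall>v\<in>tilings C. v \<notin> V \<longrightarrow> p v = v)"
proof -
  have wt: "w \<in> tilings C" using V w unfolding openin_path by blast
  obtain m where m: "cyl (w 0 m) \<subseteq> V" using V w unfolding openin_path by blast
  obtain v where v: "v \<in> cyl (w 0 m)" "v \<noteq> w" "tail_equivalent v w"
    using orbit_other[OF prefix_in_cyl[OF wt]] by metis
  obtain y x u where u: "y \<in> arrows C" "x \<in> arrows C" "src C y = src C x" "u \<in> tilings_at C (src C y)"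
      "v = prepend C y u" "w = prepend C x u" using v(3) unfolding tail_equivalent_def by blast
  have vt: "v \<in> tilings C" using v(1) cyl_subset_tilings by blast
  obtain n where n: "m \<le> n" "cyl (w 0 n) \<inter> cyl (v 0 n) = {}"
    using tilings_separated[OF wt vt v(2)[symmetric]] by metis
  let ?x = "w 0 (deg C x + n)" and ?y = "v 0 (deg C y + n)"
  have sub: "cyl ?x \<subseteq> cyl (w 0 n)" "cyl ?y \<subseteq> cyl (v 0 n)"
    using cyl_prefix_mono[OF wt nat_vec_le_add(2)] cyl_prefix_mono[OF vt nat_vec_le_add(2)] by auto
  have vm: "v 0 m = w 0 m" using v(1) tiling_prefix(2)[OF wt] by (simp add: cyl_def)
  have subV: "cyl ?x \<subseteq> V" "cyl ?y \<subseteq> V"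
    using sub cyl_prefix_mono[OF wt n(1)] cyl_prefix_mono[OF vt n(1)] vm m by auto
  have ut: "u 0 n \<in> arrows C" "src C y = tgt C (u 0 n)" "src C x = tgt C (u 0 n)"
    using tiling_prefix(1) tilings_atD(1)[OF u(4)] tiling_at_src(2)[OF u(4)] u(3) by auto
  have "?x = x \<cdot> u 0 n" "?y = y \<cdot> u 0 n"
    using prepend_prefix[OF u(1,4), of n] prepend_prefix[OF u(2), of u n] u by simp_all
  then have srcs: "src C ?x = src C ?y"
    using src_cmp[OF u(1) ut(1,2)] src_cmp[OF u(2) ut(1,3)] by simp
  have dis: "cyl ?x \<inter> cyl ?y = {}" using sub n(2) by blast
  obtain p where p: "p \<in> full_group_maps" "replaces p ?x ?y"
      "\<forall>w\<in>tilings C. w \<notin> cyl ?x \<longrightarrow> w \<notin> cyl ?y \<longrightarrow> p w = w"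
      "\<forall>w\<in>tilings C. p (p w) = w"
    using swap_exists[OF tiling_prefix(1)[OF wt] tiling_prefix(1)[OF vt] srcs dis] by blast
  have "p w \<in> cyl ?y" using replaces_cyl(1)[OF p(2) prefix_in_cyl[OF wt]] .
  moreover have "w \<notin> cyl ?y"
    using prefix_in_cyl[OF wt, of n] n(2) subsetD[OF sub(2), of w] by (metis disjoint_iff)
  ultimately have "p w \<noteq> w" by metis
  moreover have "\<forall>v\<in>tilings C. v \<notin> V \<longrightarrow> p v = v"
    using p(3) subsetD[OF subV(1)] subsetD[OF subV(2)] by metis
  ultimately show ?thesis using p(1,4) by (intro bexI[of _ p] conjI)
qed

lemma full_group_cut:
  assumes p: "p \<in> full_group_maps" and pp: "\<And>w. w \<in> tilings C \<Longrightarrow> p (p w) = w"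
    and V: "openin path_topology V" "closedin path_topology V" and inv: "\<And>w. w \<in> V \<Longrightarrow> p w \<in> V"
  shows "(\<lambda>w\<in>tilings C. if w \<in> V then p w else w) \<in> full_group_maps"
proof (rule involutive_full_group)
  have inv': "p w \<in> V \<longleftrightarrow> w \<in> V" if "w \<in> tilings C" for w using inv pp[OF that] by metis
  let ?q = "\<lambda>w. if w \<in> V then p w else w"
  show "?q w \<in> tilings C" "?q (?q w) = w" if "w \<in> tilings C" for w
    using that full_group_in[OF p] inv' pp by auto
  show "\<exists>x y. replaces ?q x y \<and> w \<in> cyl x" if w: "w \<in> tilings C" for w
  proof (cases "w \<in> V")
    case True
    then obtain n where n: "cyl (w 0 n) \<subseteq> V" using V unfolding openin_path by blast
    obtain x y where xy: "replaces p x y" "w \<in> cyl x" "n \<le> deg C x"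
      using full_group_local[OF p w] by metis
    have "cyl x \<subseteq> V" using cyl_prefix_mono[OF w xy(3)] xy(2) n by (auto simp: cyl_def)
    then have "replaces ?q x y" using xy(1) prepend_in_cyl by (auto simp: replaces_def subset_iff)
    then show ?thesis using xy(2) by blast
  next
    case False
    have "openin path_topology (tilings C - V)" using V(2) by (simp add: closedin_def topspace_path)
    then obtain n where "cyl (w 0 n) \<subseteq> tilings C - V" using False w unfolding openin_path by blast
    then have "replaces ?q (w 0 n) (w 0 n)"
      using tiling_prefix(1)[OF w] prepend_in_cyl by (auto simp: replaces_def subset_iff)
    then show ?thesis using prefix_in_cyl[OF w] by blast
  qed
qed

lemma full_group_involution_iff:
  "involution full_group p \<longleftrightarrow> p \<in> full_group_maps \<and> (\<forall>w\<in>tilings C. p (p w) = w)"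
  by (auto simp: involution_def full_group_carrier full_group_mult full_group_one compose_def fun_eq_iff
      restrict_def split: if_splits)

sublocale full_action full_group path_topology "\<lambda>f. f"
proof (intro full_action.intro full_action_axioms.intro group_full_group path_compact path_Hausdorff)
  fix g assume "g \<in> carrier full_group"
  then show "continuous_map path_topology path_topology g"
    by (simp add: full_group_continuous full_group_carrier)
next
  fix w assume "w \<in> topspace path_topology"
  then show "\<one>\<^bsub>full_group\<^esub> w = w" by (simp add: full_group_one topspace_path)
next
  fix f g w assume "f \<in> carrier full_group" "g \<in> carrier full_group" "w \<in> topspace path_topology"
  then show "(f \<otimes>\<^bsub>full_group\<^esub> g) w = f (g w)"
    by (simp add: full_group_carrier full_group_mult compose_def topspace_path)
next
  fix g assume "g \<in> carrier full_group" "\<And>w. w \<in> topspace path_topology \<Longrightarrow> g w = w"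
  then show "g = \<one>\<^bsub>full_group\<^esub>"
    using group.is_monoid[OF group_full_group] monoid.one_closed[of full_group]
    by (intro full_group_eqI) (auto simp: full_group_one full_group_carrier topspace_path)
next
  fix p assume "involution full_group p"
  then show "closedin path_topology {w \<in> topspace path_topology. p w \<noteq> w}"
    unfolding full_group_involution_iff topspace_path
    using full_group_involution_support_closed by blast
next
  fix p U assume "involution full_group p" "openin path_topology U" "closedin path_topology U"
    "\<And>w. w \<in> U \<Longrightarrow> p w \<in> U"
  then show "\<exists>q\<in>carrier full_group. \<forall>w\<in>topspace path_topology. q w = (if w \<in> U then p w else w)"
    unfolding full_group_involution_iff topspace_path full_group_carrier
    using full_group_cut[of p U] by (intro bexI[of _ "\<lambda>w\<in>tilings C. if w \<in> U then p w else w"]) auto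
next
  fix U w assume "openin path_topology U" "w \<in> U"
  from full_group_local_involution[OF this] show "\<exists>p. involution full_group p \<and> p w \<noteq> w \<and> (\<forall>v\<in>topspace path_topology - U. p v = v)"
    unfolding full_group_involution_iff topspace_path by blast
qed

end

section \<open>The path groupoid as a groupoid of germs\<close>

context higher_rank_graph begin

lemma path_arrows_iff:
  "(v, n, w) \<in> path_arrows C \<longleftrightarrow> v \<in> tilings C \<and> w \<in> tilings C \<and>
     (\<exists>l m. n = int_vec l - int_vec m \<and> tshift l v = tshift m w)"
  by (simp add: path_arrows_def)

lemma path_arrows_unit: "w \<in> tilings C \<Longrightarrow> (w, 0, w) \<in> path_arrows C"
  unfolding path_arrows_iff by (metis diff_self)

lemma path_arrows_cmp:
  assumes "(u, m, v) \<in> path_arrows C" "(v, n, w) \<in> path_arrows C"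
  shows "(u, m + n, w) \<in> path_arrows C"
proof -
  obtain a b where ab: "m = int_vec a - int_vec b" "tshift a u = tshift b v"
    using assms(1) unfolding path_arrows_iff by blast
  obtain c d where cd: "n = int_vec c - int_vec d" "tshift c v = tshift d w"
    using assms(2) unfolding path_arrows_iff by blast
  have "m + n = int_vec (a + c) - int_vec (d + b)"
    using ab cd by (simp add: int_vec_add)
  moreover have "tshift (a + c) u = tshift (d + b) w"
    using ab(2) cd(2) tshift_tshift by (metis add.commute)
  ultimately show ?thesis using assms unfolding path_arrows_iff by blast
qed

lemma path_groupoid_category: "category (path_groupoid C)"
proof (rule category.intro)
  show "idents (path_groupoid C) \<subseteq> arrows (path_groupoid C)"
    using path_arrows_unit by (auto simp: path_groupoid_def)
  show "a \<cdot>\<^bsub>path_groupoid C\<^esub> b \<in> arrows (path_groupoid C)"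
    if "a \<in> arrows (path_groupoid C)" "b \<in> arrows (path_groupoid C)"
      "src (path_groupoid C) a = tgt (path_groupoid C) b" for a b
    using that path_arrows_cmp by (cases a; cases b) (auto simp: path_groupoid_def)
qed (auto simp: path_groupoid_def path_arrows_def add.assoc)

end

context path_graph begin

definition germ :: "(('a, 'k) tiling \<Rightarrow> ('a, 'k) tiling) \<Rightarrow> ('a, 'k) tiling \<Rightarrow> ('a, 'k) gelem" where
  "germ f w = (f w, degree_jump f w, w)"

lemma germ_in_arrows:
  assumes "f \<in> full_group_maps" "w \<in> tilings C" shows "germ f w \<in> path_arrows C"
proof -
  obtain x y where xy: "replaces f x y" "w \<in> cyl x" using full_group_local[OF assms] by metis
  show ?thesis
    unfolding germ_def path_arrows_iff
    using assms full_group_in degree_jump_eq[OF xy] replaces_cyl(2)[OF xy] by blast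
qed

lemma cylinder_germ: "replaces f x y \<Longrightarrow> cylinder C y x = germ f ` cyl x"
proof -
  assume r: "replaces f x y"
  have x: "x \<in> arrows C" "src C x = src C y" using r by (auto simp: replaces_def)
  have "germ f (prepend C x u) = (prepend C y u, int_vec (deg C y) - int_vec (deg C x), prepend C x u)"
    if "u \<in> tilings_at C (src C x)" for u
    using degree_jump_eq[OF r prepend_in_cyl[OF x(1) that]] r that by (simp add: germ_def replaces_def)
  then show ?thesis
    unfolding cylinder_def cyl_eq[OF x(1)] x(2) Setcompr_eq_image image_image by simp
qed

text \<open>The two paths do not determine the middle component of an arrow between them, so the segments \<open>x\<close>
  and \<open>y\<close> are part of the data.\<close>

lemma germ_of_tails:
  assumes xy: "x \<in> arrows C" "y \<in> arrows C" "src C x = src C y" and u: "u \<in> tilings_at C (src C x)"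
    and ne: "prepend C x u \<noteq> prepend C y u"
  shows "\<exists>f\<in>full_group_maps. germ f (prepend C x u) =
    (prepend C y u, int_vec (deg C y) - int_vec (deg C x), prepend C x u)"
proof -
  let ?w = "prepend C x u" and ?v = "prepend C y u"
  have uy: "u \<in> tilings_at C (src C y)" using u xy by simp
  have wt: "?w \<in> tilings C" and vt: "?v \<in> tilings C"
    using prepend_tiling[OF xy(1) u] prepend_tiling[OF xy(2) uy] by auto
  obtain n where n: "cyl (?w 0 n) \<inter> cyl (?v 0 n) = {}" using tilings_separated[OF wt vt ne, of 0] by metis
  let ?x = "?w 0 (deg C x + n)" and ?y = "?v 0 (deg C y + n)"
  have eq: "?x = x \<cdot> u 0 n" "?y = y \<cdot> u 0 n"
    using prepend_prefix[OF xy(1) u] prepend_prefix[OF xy(2) uy] by auto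
  have sub: "cyl ?x \<subseteq> cyl (?w 0 n)" "cyl ?y \<subseteq> cyl (?v 0 n)"
    using cyl_prefix_mono[OF wt nat_vec_le_add(2)] cyl_prefix_mono[OF vt nat_vec_le_add(2)] by auto
  have ut: "u 0 n \<in> arrows C" "src C x = tgt C (u 0 n)" "src C y = tgt C (u 0 n)"
    using tiling_prefix(1) tilings_atD(1)[OF u] tiling_at_src(2)[OF u] xy(3) by auto
  have srcs: "src C ?x = src C ?y"
    using src_cmp[OF xy(1) ut(1,2)] src_cmp[OF xy(2) ut(1,3)] eq by simp
  have dis: "cyl ?x \<inter> cyl ?y = {}" using sub n by blast
  obtain f where f: "f \<in> full_group_maps" "replaces f ?x ?y"
    using swap_exists[OF tiling_prefix(1)[OF wt] tiling_prefix(1)[OF vt] srcs dis] by blast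
  have w: "?w \<in> cyl ?x" using prefix_in_cyl[OF wt] .
  have t: "tshift n u \<in> tilings_at C (src C ?x)" "?w = prepend C ?x (tshift n u)" "?v = prepend C ?y (tshift n u)"
    using prepend_split[OF xy(1) u, of n] prepend_split[OF xy(2) uy, of n] eq by auto
  have "f ?w = ?v" using f(2) t unfolding replaces_def by metis
  moreover have "degree_jump f ?w = int_vec (deg C y) - int_vec (deg C x)"
    using degree_jump_eq[OF f(2) w] tiling_prefix(2)[OF wt] tiling_prefix(2)[OF vt]
    by (simp add: int_vec_add)
  ultimately have "germ f ?w = (?v, int_vec (deg C y) - int_vec (deg C x), ?w)" by (simp add: germ_def)
  then show ?thesis using f(1) by blast
qed

lemma germ_compose:
  assumes "f \<in> full_group_maps" "g \<in> full_group_maps" "w \<in> tilings C"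
  shows "germ (compose (tilings C) f g) w = (f (g w), degree_jump f (g w) + degree_jump g w, w)"
  using degree_jump_compose[OF assms] assms(3) by (simp add: germ_def compose_def)

text \<open>An arrow between distinct paths is the germ of a swap. An arrow from \<open>w\<close> to itself is a product of two
  such arrows through another path \<open>z\<close> of the orbit.\<close>

lemma germ_surj:
  assumes a: "(v, n, w) \<in> path_arrows C"
  shows "\<exists>f\<in>full_group_maps. germ f w = (v, n, w)"
proof -
  obtain l m where lm: "n = int_vec l - int_vec m" "tshift l v = tshift m w"
      and t: "v \<in> tilings C" "w \<in> tilings C"
    using a unfolding path_arrows_iff by blast
  let ?y = "v 0 l" and ?x = "w 0 m" and ?u = "tshift m w"
  have x: "?x \<in> arrows C" "deg C ?x = m" and y: "?y \<in> arrows C" "deg C ?y = l"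
    using tiling_prefix t by auto
  have wx: "w \<in> cyl ?x" and vy: "v \<in> cyl ?y" using prefix_in_cyl t by auto
  have u: "?u \<in> tilings_at C (src C ?x)" "?u \<in> tilings_at C (src C ?y)"
    using tail_in[OF wx] tail_in[OF vy] x y lm by simp_all
  then have s: "src C ?x = src C ?y" by (simp add: tilings_at_def)
  have wv: "w = prepend C ?x ?u" "v = prepend C ?y ?u"
    using cyl_prepend[OF wx] cyl_prepend[OF vy] x y lm by simp_all
  show ?thesis
  proof (cases "v = w")
    case False
    then show ?thesis using germ_of_tails[OF x(1) y(1) s u(1)] wv x y lm by simp
  next
    case True
    obtain z where z: "z \<noteq> w" "tail_equivalent z w" using orbit_other[OF wx] by metis
    obtain b a t where bat: "b \<in> arrows C" "a \<in> arrows C" "src C b = src C a" "t \<in> tilings_at C (src C b)"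
        "z = prepend C b t" "w = prepend C a t" using z(2) unfolding tail_equivalent_def by blast
    have ta: "t \<in> tilings_at C (src C a)" using bat by simp
    obtain f where f: "f \<in> full_group_maps" "germ f w = (z, int_vec (deg C b) - int_vec (deg C a), w)"
      using germ_of_tails[OF bat(2,1) bat(3)[symmetric] ta] bat z(1) by metis
    \<comment> \<open>Both \<open>z\<close> and \<open>v = w\<close> are rewritten with the common tail \<open>\<sigma>\<^sup>d(w)\<close>, where \<open>d = m + deg a\<close>.\<close>
    let ?b = "b \<cdot> t 0 m" and ?y' = "?y \<cdot> ?u 0 (deg C a)" and ?t = "tshift (m + deg C a) w"
    have st: "tshift m t = ?t" "tshift (deg C a) ?u = ?t"
      using prepend_shift[OF bat(2) ta] bat(6) tshift_tshift add.commute by metis+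
    have b': "?t \<in> tilings_at C (src C ?b)" "z = prepend C ?b ?t"
      using prepend_split[OF bat(1,4), of m] st bat(5) by simp_all
    have y': "?t \<in> tilings_at C (src C ?y')" "w = prepend C ?y' ?t"
      using prepend_split[OF y(1) u(2), of "deg C a"] st wv(2) True by simp_all
    have tm: "t 0 m \<in> arrows C" "tgt C (t 0 m) = src C b" "?u 0 (deg C a) \<in> arrows C"
        "tgt C (?u 0 (deg C a)) = src C ?y" "deg C (t 0 m) = m" "deg C (?u 0 (deg C a)) = deg C a"
      using tiling_prefix(1,2) tilings_atD(1)[OF bat(4)] tilings_atD(1)[OF u(1)]
        tiling_at_src(2)[OF bat(4)] tiling_at_src(2)[OF u(2)] by auto
    have ba: "?b \<in> arrows C" "deg C ?b = deg C b + m" "?y' \<in> arrows C" "deg C ?y' = l + deg C a"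
      using tm bat(1) y by (simp_all add: cmp_closed deg_cmp)
    have sb: "src C ?b = src C ?y'" using b' y' by (simp add: tilings_at_def)
    obtain g where g: "g \<in> full_group_maps" "germ g z = (w, int_vec (deg C ?y') - int_vec (deg C ?b), z)"
      using germ_of_tails[OF ba(1,3) sb b'(1)] b'(2) y'(2) z(1) by metis
    have "germ (compose (tilings C) g f) w = (v, n, w)"
      using germ_compose[OF g(1) f(1) t(2)] f(2) g(2) ba True lm(1)
      by (simp add: germ_def int_vec_add)
    then show ?thesis using compose_full_group[OF g(1) f(1)] by blast
  qed
qed

text \<open>Equal images and equal degree jumps force the two replacing segments to be initial segments of one path
  of the same degree, hence equal.\<close>

lemma germ_eq:
  assumes f: "f \<in> full_group_maps" and g: "g \<in> full_group_maps"
    and w: "w \<in> tilings C" and v: "v \<in> tilings C"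
  shows "germ f w = germ g v \<longleftrightarrow> w = v \<and> (\<exists>U. openin path_topology U \<and> w \<in> U \<and> (\<forall>u\<in>U. f u = g u))"
proof
  assume eq: "germ f w = germ g v"
  then have wv: "w = v" "f w = g w" "degree_jump f w = degree_jump g w" by (auto simp: germ_def)
  obtain x y where xy: "replaces f x y" "w \<in> cyl x" using full_group_local[OF f w] by metis
  obtain x' y' where xy': "replaces g x' y'" "w \<in> cyl x'" using full_group_local[OF g w] by metis
  let ?x = "w 0 (deg C x + deg C x')"
  let ?y = "f w 0 (deg C y + deg C x')" and ?y' = "f w 0 (deg C y' + deg C x)"
  have r: "replaces f ?x ?y" using replaces_prefix[OF xy] .
  have r': "replaces g ?x ?y'" using replaces_prefix[OF xy', of "deg C x"] wv(2) by (simp add: add.commute)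
  have fw: "f w \<in> tilings C" using full_group_in[OF f w] .
  have wx: "w \<in> cyl ?x" using prefix_in_cyl[OF w] .
  have "int_vec (deg C ?y) = int_vec (deg C ?y')"
    using degree_jump_eq[OF r wx] degree_jump_eq[OF r' wx] wv(3) by simp
  then have "?y = ?y'" using tiling_prefix(2)[OF fw] by (metis int_vec_inj)
  then have "f u = g u" if "u \<in> cyl ?x" for u
    using r r' cyl_prepend[OF that] tail_in[OF that] unfolding replaces_def by metis
  then show "w = v \<and> (\<exists>U. openin path_topology U \<and> w \<in> U \<and> (\<forall>u\<in>U. f u = g u))"
    using wv(1) cyl_open wx by blast
next
  assume "w = v \<and> (\<exists>U. openin path_topology U \<and> w \<in> U \<and> (\<forall>u\<in>U. f u = g u))"
  then obtain U where wv: "w = v" and U: "openin path_topology U" "w \<in> U" "\<forall>u\<in>U. f u = g u" by blast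
  obtain n where n: "cyl (w 0 n) \<subseteq> U" using U unfolding openin_path by blast
  obtain x y where xy: "replaces f x y" "w \<in> cyl x" "n \<le> deg C x"
    using full_group_local[OF f w, of n] by metis
  have "cyl x \<subseteq> U" using cyl_prefix_mono[OF w xy(3)] xy(2) n by (auto simp: cyl_def)
  then have "replaces g x y"
    using xy(1) U(3) prepend_in_cyl unfolding replaces_def by (metis subsetD)
  then have "degree_jump g w = degree_jump f w" using degree_jump_eq xy(1,2) by metis
  then show "germ f w = germ g v" using U wv by (simp add: germ_def)
qed

lemma open_path_groupoid:
  "openin (gtop (path_groupoid C)) V \<longleftrightarrow> V \<subseteq> path_arrows C \<and>
     (\<forall>f\<in>full_group_maps. \<forall>w\<in>tilings C. germ f w \<in> V \<longrightarrow>
       (\<exists>U. openin path_topology U \<and> w \<in> U \<and> germ f ` U \<subseteq> V))"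
  (is "?open V \<longleftrightarrow> ?germs V")
proof
  let ?B = "{cylinder C x y | x y. x \<in> arrows C \<and> y \<in> arrows C \<and> src C x = src C y}"
  have open_iff: "?open V \<longleftrightarrow> generate_topology_on ?B V" for V
    by (simp add: path_groupoid_def openin_topology_generated_by_iff)
  show "?germs V" if "?open V"
    using that unfolding open_iff
  proof (induction rule: generate_topology_on.induct)
    case (Int S T)
    show ?case
    proof (intro conjI ballI impI)
      fix f w assume fw: "f \<in> full_group_maps" "w \<in> tilings C" "germ f w \<in> S \<inter> T"
      obtain U1 U2 where U: "openin path_topology U1" "w \<in> U1" "germ f ` U1 \<subseteq> S"
          "openin path_topology U2" "w \<in> U2" "germ f ` U2 \<subseteq> T"
        using Int fw by blast
      show "\<exists>U. openin path_topology U \<and> w \<in> U \<and> germ f ` U \<subseteq> S \<inter> T"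
        using U by (intro exI[of _ "U1 \<inter> U2"]) auto
    qed (use Int in blast)
  next
    case (UN K)
    show ?case
    proof (intro conjI ballI impI)
      show "\<Union>K \<subseteq> path_arrows C" using UN by blast
      fix f w assume fw: "f \<in> full_group_maps" "w \<in> tilings C" "germ f w \<in> \<Union>K"
      then obtain S where S: "S \<in> K" "germ f w \<in> S" by blast
      obtain U where "openin path_topology U" "w \<in> U" "germ f ` U \<subseteq> S"
        using conjunct2[OF UN.IH[OF S(1)], rule_format, OF fw(1,2) S(2)] by blast
      then show "\<exists>U. openin path_topology U \<and> w \<in> U \<and> germ f ` U \<subseteq> \<Union>K" using S(1) by blast
    qed
  next
    case (Basis S)
    then obtain x y where S: "S = cylinder C x y" and xy: "x \<in> arrows C" "y \<in> arrows C" "src C x = src C y"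
      by blast
    show ?case
    proof (intro conjI ballI impI)
      show "S \<subseteq> path_arrows C"
      proof
        fix a assume "a \<in> S"
        then obtain u where u: "u \<in> tilings_at C (src C x)"
            "a = (prepend C x u, int_vec (deg C x) - int_vec (deg C y), prepend C y u)"
          unfolding S cylinder_def by blast
        have "u \<in> tilings_at C (src C y)" using u xy by simp
        then show "a \<in> path_arrows C"
          unfolding u(2) path_arrows_iff
          using prepend_spec[OF xy(1) u(1)] prepend_spec[OF xy(2), of u] by metis
      qed
      fix f w assume f: "f \<in> full_group_maps" and w: "w \<in> tilings C" and fw: "germ f w \<in> S"
      then obtain u where u: "u \<in> tilings_at C (src C x)" "f w = prepend C x u"
          "degree_jump f w = int_vec (deg C x) - int_vec (deg C y)" "w = prepend C y u"
        unfolding S cylinder_def germ_def by blast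
      have uy: "u \<in> tilings_at C (src C y)" using u xy by simp
      obtain a b where ab: "replaces f a b" "w \<in> cyl a" "f w \<in> cyl b" "deg C y \<le> deg C a"
        using full_group_local[OF f w] by metis
      have wy: "w \<in> cyl y" using prepend_in_cyl[OF xy(2) uy] u(4) by simp
      define n where "n = deg C a - deg C y"
      have da: "deg C a = deg C y + n" unfolding n_def using nat_vec_add_diff[OF ab(4)] by simp
      have "a = y \<cdot> u 0 n"
        using prepend_prefix[OF xy(2) uy, of n] u(4) ab(2) da by (simp add: cyl_def)
      moreover have "int_vec (deg C b) = int_vec (deg C x + n)"
        using degree_jump_eq[OF ab(1,2)] u(3) da by (simp add: int_vec_add algebra_simps)
      then have "deg C b = deg C x + n" by (simp only: int_vec_inj)
      then have "b = x \<cdot> u 0 n"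
        using prepend_prefix[OF xy(1) u(1), of n] u(2) ab(3) by (simp add: cyl_def)
      ultimately have r: "replaces f (y \<cdot> u 0 n) (x \<cdot> u 0 n)" using ab(1) by simp
      have ut: "u 0 n \<in> arrows C" "src C x = tgt C (u 0 n)" "src C y = tgt C (u 0 n)"
        using tiling_prefix(1) tilings_atD(1)[OF u(1)] tiling_at_src(2)[OF u(1)] xy(3) by auto
      have "cylinder C (x \<cdot> u 0 n) (y \<cdot> u 0 n) \<subseteq> cylinder C x y"
      proof
        fix e assume "e \<in> cylinder C (x \<cdot> u 0 n) (y \<cdot> u 0 n)"
        then obtain t where t: "t \<in> tilings_at C (src C (x \<cdot> u 0 n))"
          "e = (prepend C (x \<cdot> u 0 n) t, int_vec (deg C (x \<cdot> u 0 n)) - int_vec (deg C (y \<cdot> u 0 n)),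
            prepend C (y \<cdot> u 0 n) t)" unfolding cylinder_def by blast
        have t': "t \<in> tilings_at C (src C (u 0 n))" using t(1) src_cmp[OF xy(1) ut(1,2)] by simp
        have "prepend C (u 0 n) t \<in> tilings_at C (src C x)" using prepend_at[OF ut(1) t'] ut(2) by simp
        moreover have "e = (prepend C x (prepend C (u 0 n) t), int_vec (deg C x) - int_vec (deg C y),
            prepend C y (prepend C (u 0 n) t))"
          using t(2) prepend_cmp[OF xy(1) ut(1,2) t'] prepend_cmp[OF xy(2) ut(1,3) t']
            deg_cmp[OF xy(1) ut(1,2)] deg_cmp[OF xy(2) ut(1,3)] by (simp add: int_vec_add)
        ultimately show "e \<in> cylinder C x y" unfolding cylinder_def by blast
      qed
      then have "germ f ` cyl (y \<cdot> u 0 n) \<subseteq> S" using cylinder_germ[OF r] S by simp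
      moreover have "w \<in> cyl (y \<cdot> u 0 n)" using ab(2) \<open>a = y \<cdot> u 0 n\<close> by simp
      ultimately show "\<exists>U. openin path_topology U \<and> w \<in> U \<and> germ f ` U \<subseteq> S"
        using cyl_open by blast
    qed
  qed blast
  show "?open V" if V: "?germs V"
  proof (subst openin_subopen, intro ballI)
    fix e assume e: "e \<in> V"
    obtain v n w where vnw: "e = (v, n, w)" by (cases e) auto
    then have pa: "(v, n, w) \<in> path_arrows C" using V e by blast
    then obtain f where f: "f \<in> full_group_maps" "germ f w = e" using germ_surj vnw by metis
    have w: "w \<in> tilings C" using pa unfolding path_arrows_iff by blast
    obtain U where U: "openin path_topology U" "w \<in> U" "germ f ` U \<subseteq> V" using V f w e by metis
    obtain m where m: "cyl (w 0 m) \<subseteq> U" using U unfolding openin_path by blast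
    obtain x y where xy: "replaces f x y" "w \<in> cyl x" "m \<le> deg C x"
      using full_group_local[OF f(1) w, of m] by metis
    have "cyl x \<subseteq> U" using cyl_prefix_mono[OF w xy(3)] xy(2) m by (auto simp: cyl_def)
    then have "cylinder C y x \<subseteq> V" using cylinder_germ[OF xy(1)] U(3) by blast
    moreover have "e \<in> cylinder C y x" using cylinder_germ[OF xy(1)] xy(2) f(2) by blast
    moreover have "?open (cylinder C y x)"
      unfolding open_iff using replaces_arrows[OF xy(1)]
      by (intro generate_topology_on.Basis CollectI exI[of _ y] exI[of _ x]) simp
    ultimately show "\<exists>T. ?open T \<and> e \<in> T \<and> T \<subseteq> V" by blast
  qed
qed

sublocale germ_groupoid full_group path_topology "\<lambda>f. f" "path_groupoid C" germ
proof (intro germ_groupoid.intro germ_groupoid_axioms.intro full_action_axioms path_groupoid_category)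
  have "path_arrows C \<subseteq> {germ f w |f w. f \<in> full_group_maps \<and> w \<in> tilings C}"
  proof clarify
    fix v n w assume a: "(v, n, w) \<in> path_arrows C"
    then show "\<exists>f w'. (v, n, w) = germ f w' \<and> f \<in> full_group_maps \<and> w' \<in> tilings C"
      using germ_surj[OF a] unfolding path_arrows_iff by metis
  qed
  then show "arrows (path_groupoid C) = {germ f w |f w. f \<in> carrier full_group \<and> w \<in> topspace path_topology}"
    using germ_in_arrows by (auto simp: path_groupoid_def full_group_carrier topspace_path)
next
  fix f g w v assume "f \<in> carrier full_group" "g \<in> carrier full_group"
    "w \<in> topspace path_topology" "v \<in> topspace path_topology"
  then show "germ f w = germ g v \<longleftrightarrow> w = v \<and> (\<exists>U. openin path_topology U \<and> w \<in> U \<and> (\<forall>u\<in>U. f u = g u))"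
    unfolding full_group_carrier topspace_path by (rule germ_eq)
next
  fix f w assume "f \<in> carrier full_group" "w \<in> topspace path_topology"
  then have fw: "f \<in> full_group_maps" "w \<in> tilings C" "f w \<in> tilings C"
    using full_group_in by (auto simp: full_group_carrier topspace_path)
  show "src (path_groupoid C) (germ f w) = germ \<one>\<^bsub>full_group\<^esub> w"
    using degree_jump_one[OF fw(2)] fw
    by (simp add: germ_def path_groupoid_def full_group_one restrict_apply' del: restrict_apply)
  show "tgt (path_groupoid C) (germ f w) = germ \<one>\<^bsub>full_group\<^esub> (f w)"
    using degree_jump_one[OF fw(3)] fw
    by (simp add: germ_def path_groupoid_def full_group_one restrict_apply' del: restrict_apply)
next
  fix f g w assume "f \<in> carrier full_group" "g \<in> carrier full_group" "w \<in> topspace path_topology"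
  then show "germ f (g w) \<cdot>\<^bsub>path_groupoid C\<^esub> germ g w = germ (f \<otimes>\<^bsub>full_group\<^esub> g) w"
    unfolding full_group_carrier topspace_path
    by (simp add: full_group_mult germ_compose) (simp add: germ_def path_groupoid_def)
next
  show "openin (gtop (path_groupoid C)) V \<longleftrightarrow> V \<subseteq> arrows (path_groupoid C) \<and>
      (\<forall>f\<in>carrier full_group. \<forall>w\<in>topspace path_topology. germ f w \<in> V \<longrightarrow>
        (\<exists>U. openin path_topology U \<and> w \<in> U \<and> germ f ` U \<subseteq> V))" for V
    unfolding open_path_groupoid full_group_carrier topspace_path by (simp add: path_groupoid_def)
qed

end

section \<open>The group of essential bijective morphisms\<close>

definition partial_inverse :: "('a \<rightharpoonup> 'a) \<Rightarrow> 'a \<rightharpoonup> 'a" where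
  "partial_inverse s y = (if y \<in> ran s then Some (SOME x. s x = Some y) else None)"

definition injective_partial :: "('a \<rightharpoonup> 'a) \<Rightarrow> bool" where
  "injective_partial s \<longleftrightarrow> (\<forall>x x' y. s x = Some y \<longrightarrow> s x' = Some y \<longrightarrow> x = x')"

lemma partial_inverse_iff:
  "injective_partial s \<Longrightarrow> partial_inverse s y = Some x \<longleftrightarrow> s x = Some y"
  unfolding partial_inverse_def injective_partial_def ran_def
  by (auto intro: someI2)

lemma partial_inverse_comp:
  assumes "injective_partial s"
  shows "partial_inverse s \<circ>\<^sub>m s = Some |` dom s" "s \<circ>\<^sub>m partial_inverse s = Some |` ran s"
proof -
  have "(partial_inverse s \<circ>\<^sub>m s) x = (Some |` dom s) x" for x
    using partial_inverse_iff[OF assms] by (cases "s x") (auto simp: restrict_map_def map_comp_def)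
  then show "partial_inverse s \<circ>\<^sub>m s = Some |` dom s" by blast
  have "(s \<circ>\<^sub>m partial_inverse s) y = (Some |` ran s) y" for y
  proof (cases "y \<in> ran s")
    case True
    then obtain x where "s x = Some y" by (auto simp: ran_def)
    then have "partial_inverse s y = Some x" using partial_inverse_iff[OF assms] by simp
    then show ?thesis using True \<open>s x = Some y\<close> by (simp add: map_comp_def)
  qed (simp add: partial_inverse_def map_comp_def)
  then show "s \<circ>\<^sub>m partial_inverse s = Some |` ran s" by blast
qed

text \<open>Stated for any set of injective partial functions that contains the inverse of \<open>s\<close>, because it is used
  both for the monoid of bijective morphisms and for its essential part.\<close>

lemma isg_inv_partial:
  assumes S: "mult S = (\<circ>\<^sub>m)" "\<And>s. s \<in> carrier S \<Longrightarrow> injective_partial s"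
    and s: "s \<in> carrier S" "partial_inverse s \<in> carrier S"
  shows "isg_inv S s = partial_inverse s"
  unfolding isg_inv_def S(1)
proof (rule the_equality)
  have inj: "injective_partial s" by (rule S(2)[OF s(1)])
  have "s \<circ>\<^sub>m partial_inverse s \<circ>\<^sub>m s = s"
  proof
    fix x show "(s \<circ>\<^sub>m partial_inverse s \<circ>\<^sub>m s) x = s x"
      unfolding partial_inverse_comp[OF inj]
      by (cases "s x") (auto simp: map_comp_def restrict_map_def ran_def)
  qed
  moreover have "partial_inverse s \<circ>\<^sub>m s \<circ>\<^sub>m partial_inverse s = partial_inverse s"
  proof
    fix y show "(partial_inverse s \<circ>\<^sub>m s \<circ>\<^sub>m partial_inverse s) y = partial_inverse s y"
    proof (cases "partial_inverse s y")
      case (Some x)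
      then have "x \<in> dom s" using partial_inverse_iff[OF inj] by auto
      then show ?thesis
        unfolding partial_inverse_comp[OF inj] using Some by (simp add: map_comp_def restrict_map_def)
    qed (simp add: map_comp_def)
  qed
  ultimately show "partial_inverse s \<in> carrier S \<and> s \<circ>\<^sub>m partial_inverse s \<circ>\<^sub>m s = s \<and>
      partial_inverse s \<circ>\<^sub>m s \<circ>\<^sub>m partial_inverse s = partial_inverse s"
    using s(2) by blast
  fix t assume t: "t \<in> carrier S \<and> s \<circ>\<^sub>m t \<circ>\<^sub>m s = s \<and> t \<circ>\<^sub>m s \<circ>\<^sub>m t = t"
  then have injt: "injective_partial t" using S(2) by blast
  have 1: "t y = Some x" if sx: "s x = Some y" for x y
  proof -
    have "(s \<circ>\<^sub>m t \<circ>\<^sub>m s) x = Some y" using t sx by simp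
    then obtain x' where "t y = Some x'" "s x' = Some y" using sx by (auto simp: map_comp_Some_iff)
    then show ?thesis using inj sx unfolding injective_partial_def by blast
  qed
  have 2: "s x = Some y" if ty: "t y = Some x" for x y
  proof -
    have "(t \<circ>\<^sub>m s \<circ>\<^sub>m t) y = Some x" using t ty by simp
    then obtain y' where "s x = Some y'" "t y' = Some x" using ty by (auto simp: map_comp_Some_iff)
    then show ?thesis using injt ty unfolding injective_partial_def by blast
  qed
  show "t = partial_inverse s"
  proof
    fix y
    show "t y = partial_inverse s y"
      using 1 2 partial_inverse_iff[OF inj] by (metis not_Some_eq)
  qed
qed

context category begin

lemma RC_carrier: "s \<in> carrier (RC C) \<longleftrightarrow>
  (\<exists>R1 R2. fg_right_ideal C R1 \<and> fg_right_ideal C R2 \<and> bij_morphism C s R1 R2)"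
  by (simp add: RC_def)

lemma RC_D:
  assumes "s \<in> carrier (RC C)"
  shows "injective_partial s" "fg_right_ideal C (dom s)" "fg_right_ideal C (ran s)"
    "s x = Some y \<Longrightarrow> src C y = src C x"
    "s x = Some y \<Longrightarrow> c \<in> arrows C \<Longrightarrow> src C x = tgt C c \<Longrightarrow> s (x \<cdot> c) = Some (y \<cdot> c)"
proof -
  obtain R1 R2 where R: "fg_right_ideal C R1" "fg_right_ideal C R2" "bij_morphism C s R1 R2"
    using assms RC_carrier by blast
  have d: "dom s = R1" and b: "bij_betw (the \<circ> s) R1 R2" using R(3) by (auto simp: bij_morphism_def)
  have Some_iff: "s x = Some y \<longleftrightarrow> x \<in> R1 \<and> the (s x) = y" for x y using d by auto
  have r: "ran s = R2"
    using b unfolding bij_betw_def by (force simp: ran_def Some_iff)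
  show "fg_right_ideal C (dom s)" "fg_right_ideal C (ran s)" using R d r by auto
  show "injective_partial s"
    using b unfolding bij_betw_def injective_partial_def inj_on_def by (auto simp: Some_iff)
  show "s x = Some y \<Longrightarrow> src C y = src C x"
    "s x = Some y \<Longrightarrow> c \<in> arrows C \<Longrightarrow> src C x = tgt C c \<Longrightarrow> s (x \<cdot> c) = Some (y \<cdot> c)"
    using R(3) unfolding bij_morphism_def by (auto simp: Some_iff)
qed

lemma RC_I:
  assumes "injective_partial s" "fg_right_ideal C (dom s)" "fg_right_ideal C (ran s)"
    "\<And>x y. s x = Some y \<Longrightarrow> src C y = src C x"
    "\<And>x y c. s x = Some y \<Longrightarrow> c \<in> arrows C \<Longrightarrow> src C x = tgt C c \<Longrightarrow> s (x \<cdot> c) = Some (y \<cdot> c)"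
  shows "s \<in> carrier (RC C)"
proof -
  have "bij_betw (the \<circ> s) (dom s) (ran s)"
    using assms(1) unfolding bij_betw_def inj_on_def injective_partial_def ran_def
    by (auto simp: image_iff) (metis option.sel domI)
  then have "bij_morphism C s (dom s) (ran s)"
    using assms(4,5) by (auto simp: bij_morphism_def dom_def)
  then show ?thesis using assms(2,3) RC_carrier by blast
qed

lemma fg_arrow: "fg_right_ideal C R \<Longrightarrow> x \<in> R \<Longrightarrow> x \<in> arrows C"
  by (auto simp: fg_right_ideal_def right_ideal_def)

lemma fg_ideal: "fg_right_ideal C R \<Longrightarrow> x \<in> R \<Longrightarrow> y \<in> arrow_ideal C x \<Longrightarrow> y \<in> R"
proof -
  assume "fg_right_ideal C R" and xy: "x \<in> R" "y \<in> arrow_ideal C x"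
  then have "set_ideal C R \<subseteq> R" by (simp add: fg_right_ideal_def right_ideal_def)
  then show "y \<in> R" using xy unfolding set_ideal_def by blast
qed

lemma RC_partial_inverse:
  assumes s: "s \<in> carrier (RC C)" shows "partial_inverse s \<in> carrier (RC C)"
proof (rule RC_I)
  note inv = partial_inverse_iff[OF RC_D(1)[OF s]]
  show "injective_partial (partial_inverse s)" by (auto simp: injective_partial_def inv)
  have "dom (partial_inverse s) = ran s" "ran (partial_inverse s) = dom s"
    using inv by (auto simp: dom_def ran_def)
  then show "fg_right_ideal C (dom (partial_inverse s))" "fg_right_ideal C (ran (partial_inverse s))"
    using RC_D(2,3)[OF s] by auto
  show "src C y = src C x" if "partial_inverse s x = Some y" for x y
    using that RC_D(4)[OF s] by (simp add: inv)
  show "partial_inverse s (x \<cdot> c) = Some (y \<cdot> c)"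
    if "partial_inverse s x = Some y" "c \<in> arrows C" "src C x = tgt C c" for x y c
    using that RC_D(4,5)[OF s] by (simp add: inv)
qed

lemma RC_mult: "mult (RC C) = (\<circ>\<^sub>m)" by (simp add: RC_def)

lemma RC_inv: "s \<in> carrier (RC C) \<Longrightarrow> isg_inv (RC C) s = partial_inverse s"
  using RC_D(1) RC_partial_inverse by (intro isg_inv_partial[OF RC_mult])

lemma RC_idempotent: "fg_right_ideal C R \<Longrightarrow> Some |` R \<in> carrier (RC C)"
proof (rule RC_I)
  assume R: "fg_right_ideal C R"
  have [simp]: "dom (Some |` R) = R" "ran (Some |` R) = R"
    by (auto simp: restrict_map_def dom_def ran_def split: if_splits)
  show "fg_right_ideal C (dom (Some |` R))" "fg_right_ideal C (ran (Some |` R))" using R by auto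
  show "(Some |` R) (x \<cdot> c) = Some (y \<cdot> c)"
    if "(Some |` R) x = Some y" "c \<in> arrows C" "src C x = tgt C c" for x y c
    using that fg_ideal[OF R, of x "x \<cdot> c"] ideal_cmp[of x c] fg_arrow[OF R]
    by (auto simp: restrict_map_def split: if_splits)
qed (auto simp: injective_partial_def restrict_map_def split: if_splits)

lemma fg_empty: "fg_right_ideal C {}"
  by (auto simp: fg_right_ideal_def right_ideal_def set_ideal_def)

lemma fg_arrow_ideal: "b \<in> arrows C \<Longrightarrow> fg_right_ideal C (arrow_ideal C b)"
proof -
  assume b: "b \<in> arrows C"
  have "right_ideal C (arrow_ideal C b)"
    using ideal_arrow[OF b] ideal_trans[OF b] by (auto simp: right_ideal_def set_ideal_def)
  then show ?thesis
    using b unfolding fg_right_ideal_def by (auto simp: set_ideal_def intro!: exI[of _ "{b}"])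
qed

lemma RC_zero: "isg_zero (RC C) = Map.empty"
  unfolding isg_zero_def RC_mult
proof (rule the_equality)
  have e: "Map.empty \<in> carrier (RC C)" using RC_idempotent[OF fg_empty] by (simp add: restrict_map_def)
  have z: "Map.empty \<circ>\<^sub>m s = Map.empty" "s \<circ>\<^sub>m Map.empty = Map.empty" for s :: "'a \<rightharpoonup> 'a"
    by (auto simp: map_comp_def split: option.splits)
  then show "Map.empty \<in> carrier (RC C) \<and>
      (\<forall>s\<in>carrier (RC C). Map.empty \<circ>\<^sub>m s = Map.empty \<and> s \<circ>\<^sub>m Map.empty = Map.empty)"
    using e by blast
  show "z = Map.empty" if "z \<in> carrier (RC C) \<and> (\<forall>s\<in>carrier (RC C). z \<circ>\<^sub>m s = z \<and> s \<circ>\<^sub>m z = z)" for z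
    using that e z by metis
qed

lemma nonzero_idempotents_RC:
  "nonzero_idempotents (RC C) = {Some |` R | R. fg_right_ideal C R \<and> R \<noteq> {}}"
proof (intro equalityI subsetI)
  fix e assume "e \<in> nonzero_idempotents (RC C)"
  then have e: "e \<in> carrier (RC C)" "e \<circ>\<^sub>m e = e" "e \<noteq> Map.empty"
    by (auto simp: nonzero_idempotents_def RC_zero RC_mult)
  have "y = x" if xy: "e x = Some y" for x y
  proof -
    have "e y = Some y" using e(2) xy map_comp_Some_iff[of e e x y] by simp
    then show ?thesis using xy RC_D(1)[OF e(1)] unfolding injective_partial_def by blast
  qed
  then have "e = Some |` dom e" by (auto simp: restrict_map_def fun_eq_iff dom_def)
  then show "e \<in> {Some |` R | R. fg_right_ideal C R \<and> R \<noteq> {}}"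
    using RC_D(2)[OF e(1)] e(3) by blast
next
  fix e :: "'a \<rightharpoonup> 'a" assume "e \<in> {Some |` R | R. fg_right_ideal C R \<and> R \<noteq> {}}"
  then obtain R where R: "e = Some |` R" "fg_right_ideal C R" "R \<noteq> {}" by blast
  have "e \<circ>\<^sub>m e = e" unfolding R(1) by (auto simp: map_comp_def restrict_map_def)
  moreover have "e \<noteq> Map.empty" using R(1,3) by (auto simp: restrict_map_def fun_eq_iff split: if_splits)
  ultimately show "e \<in> nonzero_idempotents (RC C)"
    using RC_idempotent[OF R(2)] R(1) by (simp add: nonzero_idempotents_def RC_zero RC_mult)
qed

lemma essential_idempotent_RC:
  assumes R: "fg_right_ideal C R"
  shows "essential_idempotent (RC C) (Some |` R) \<longleftrightarrow> R \<noteq> {} \<and> (\<forall>b\<in>arrows C. arrow_ideal C b \<inter> R \<noteq> {})"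
proof -
  have comp: "Some |` R \<circ>\<^sub>m Some |` R' = Some |` (R \<inter> R')" for R' :: "'a set"
    by (auto simp: map_comp_def restrict_map_def)
  have zero: "Some |` R' = Map.empty \<longleftrightarrow> R' = {}" for R' :: "'a set"
    by (auto simp: restrict_map_def fun_eq_iff split: if_splits)
  have inj: "R' = R''" if "Some |` R' = Some |` R''" for R' R'' :: "'a set"
  proof -
    have "dom (Some |` R') = dom (Some |` R'')" using that by simp
    then show ?thesis by (simp add: dom_def restrict_map_def split: if_splits)
  qed
  have "essential_idempotent (RC C) (Some |` R) \<longleftrightarrow>
      R \<noteq> {} \<and> (\<forall>R'. fg_right_ideal C R' \<and> R' \<noteq> {} \<longrightarrow> R \<inter> R' \<noteq> {})"
    unfolding essential_idempotent_def nonzero_idempotents_RC RC_mult RC_zero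
    using R inj comp zero by auto
  also have "\<dots> \<longleftrightarrow> R \<noteq> {} \<and> (\<forall>b\<in>arrows C. arrow_ideal C b \<inter> R \<noteq> {})"
  proof (intro conj_cong refl iffI allI impI ballI)
    fix b assume "\<forall>R'. fg_right_ideal C R' \<and> R' \<noteq> {} \<longrightarrow> R \<inter> R' \<noteq> {}" "b \<in> arrows C"
    then show "arrow_ideal C b \<inter> R \<noteq> {}" using fg_arrow_ideal ideal_self by blast
  next
    fix R' assume "\<forall>b\<in>arrows C. arrow_ideal C b \<inter> R \<noteq> {}" "fg_right_ideal C R' \<and> R' \<noteq> {}"
    then show "R \<inter> R' \<noteq> {}" using fg_arrow fg_ideal by blast
  qed
  finally show ?thesis .
qed

end

context path_graph begin

text \<open>Every infinite path enters \<open>R\<close>. For finitely generated right ideals this is essentiality, seen on the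
  path space.\<close>

definition bar :: "'a set \<Rightarrow> bool" where
  "bar R \<longleftrightarrow> (\<forall>w\<in>tilings C. \<exists>n. w 0 n \<in> R)"

lemma essential_iff_bar:
  assumes ne: "arrows C \<noteq> {}" and R: "fg_right_ideal C R"
  shows "essential_idempotent (RC C) (Some |` R) \<longleftrightarrow> bar R"
  unfolding essential_idempotent_RC[OF R]
proof (intro iffI conjI ballI)
  assume es: "R \<noteq> {} \<and> (\<forall>b\<in>arrows C. arrow_ideal C b \<inter> R \<noteq> {})"
  obtain X where X: "X \<subseteq> arrows C" "finite X" "R = set_ideal C X" using R unfolding fg_right_ideal_def by blast
  define n where "n = (\<Sum>z\<in>X. deg C z)"
  have n: "deg C z \<le> n" if "z \<in> X" for z
    unfolding n_def using X(2) that by (auto simp: less_eq_vec_def sum_component intro: member_le_sum)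
  show "bar R" unfolding bar_def
  proof
    fix w assume w: "w \<in> tilings C"
    obtain a where a: "a \<in> arrow_ideal C (w 0 n)" "a \<in> R" using es tiling_prefix(1)[OF w] by blast
    then obtain x where x: "x \<in> X" "a \<in> arrow_ideal C x" using X(3) by (auto simp: set_ideal_def)
    have "w 0 n \<in> arrow_ideal C x"
      using ideal_comparable[OF _ tiling_prefix(1)[OF w] x(2) a(1)] x(1) X(1) n tiling_prefix(2)[OF w] by auto
    then show "\<exists>n. w 0 n \<in> R" using x(1) X(3) by (auto simp: set_ideal_def)
  qed
next
  assume b: "bar R"
  obtain x w where "w \<in> cyl x" using cyl_nonempty ne by blast
  then show "R \<noteq> {}" using b cyl_subset_tilings unfolding bar_def by blast
  fix a assume a: "a \<in> arrows C"
  obtain v where v: "v \<in> cyl a" using cyl_nonempty[OF a] by blast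
  have vt: "v \<in> tilings C" using v cyl_subset_tilings by blast
  obtain n where n: "v 0 n \<in> R" using b vt unfolding bar_def by blast
  have "v 0 (deg C a + n) \<in> arrow_ideal C a" using cyl_ideal[OF v nat_vec_le_add(1)] .
  moreover have "v 0 (deg C a + n) \<in> R" using fg_ideal[OF R n tiling_prefix(4)[OF vt nat_vec_le_add(2)]] .
  ultimately show "arrow_ideal C a \<inter> R \<noteq> {}" by blast
qed

abbreviation "ess \<equiv> carrier (essential_part (RC C))"

text \<open>Here \<open>arrows C \<noteq> {}\<close> matters: over the empty graph the only morphism is zero, so nothing is
  essential, although the full group of the empty space is a group.\<close>

lemma ess_iff:
  assumes ne: "arrows C \<noteq> {}"
  shows "s \<in> ess \<longleftrightarrow> s \<in> carrier (RC C) \<and> bar (dom s) \<and> bar (ran s)"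
proof (cases "s \<in> carrier (RC C)")
  case True
  note s = RC_D(1-3)[OF True]
  show ?thesis
    using True essential_iff_bar[OF ne s(2)] essential_iff_bar[OF ne s(3)]
    by (simp add: essential_part_def RC_inv[OF True] RC_mult partial_inverse_comp[OF s(1)])
qed (simp add: essential_part_def)

lemma ess_mult: "mult (essential_part (RC C)) = (\<circ>\<^sub>m)"
  by (simp add: essential_part_def RC_mult)

lemma ess_partial_inverse:
  assumes ne: "arrows C \<noteq> {}" and s: "s \<in> ess" shows "partial_inverse s \<in> ess"
proof -
  have sR: "s \<in> carrier (RC C)" using s by (simp add: essential_part_def)
  have "dom (partial_inverse s) = ran s" "ran (partial_inverse s) = dom s"
    using partial_inverse_iff[OF RC_D(1)[OF sR]] by (auto simp: dom_def ran_def)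
  then show ?thesis using s RC_partial_inverse[OF sR] unfolding ess_iff[OF ne] by simp
qed

lemma ess_le_iff:
  assumes ne: "arrows C \<noteq> {}" and a: "a \<in> ess"
  shows "isg_le (essential_part (RC C)) a b \<longleftrightarrow> (\<forall>x y. a x = Some y \<longrightarrow> b x = Some y)"
proof -
  have inj: "injective_partial s" if "s \<in> ess" for s using that RC_D(1) ess_iff[OF ne] by blast
  have "isg_inv (essential_part (RC C)) a = partial_inverse a"
    using inj a ess_partial_inverse[OF ne a] by (rule isg_inv_partial[OF ess_mult])
  then have "isg_le (essential_part (RC C)) a b \<longleftrightarrow> a = b \<circ>\<^sub>m (Some |` dom a)"
    by (simp add: isg_le_def ess_mult partial_inverse_comp[OF inj[OF a]])
  also have "\<dots> \<longleftrightarrow> (\<forall>x. a x = (if x \<in> dom a then b x else None))"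
    by (simp add: fun_eq_iff map_comp_def restrict_map_def)
  also have "\<dots> \<longleftrightarrow> (\<forall>x y. a x = Some y \<longrightarrow> b x = Some y)"
    by (metis domIff domI not_Some_eq)
  finally show ?thesis .
qed

text \<open>The map \<open>f\<close> is the action of the morphism \<open>s\<close> on infinite paths.\<close>

definition induces :: "('a \<rightharpoonup> 'a) \<Rightarrow> (('a, 'k) tiling \<Rightarrow> ('a, 'k) tiling) \<Rightarrow> bool" where
  "induces s f \<longleftrightarrow> s \<in> ess \<and> (\<forall>x y. s x = Some y \<longrightarrow> replaces f x y)"

lemma ess_domain:
  assumes ne: "arrows C \<noteq> {}" and s: "s \<in> ess"
  shows "\<exists>N. \<forall>x\<in>arrows C. vec N \<le> deg C x \<longrightarrow> x \<in> dom s"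
proof -
  have sR: "s \<in> carrier (RC C)" "bar (dom s)" using s ess_iff[OF ne] by auto
  note fg = RC_D(2)[OF sR(1)]
  have sub: "dom s \<subseteq> arrows C" using fg_arrow[OF fg] by blast
  have "\<exists>N. \<forall>x\<in>arrows C. vec N \<le> deg C x \<longrightarrow> (\<exists>u\<in>dom s. x \<in> arrow_ideal C u)"
  proof (rule bar_uniform[OF sub])
    fix w assume w: "w \<in> tilings C"
    then obtain n where "w 0 n \<in> dom s" using sR(2) unfolding bar_def by blast
    then show "\<exists>n. \<exists>u\<in>dom s. w 0 n \<in> arrow_ideal C u" using ideal_self[OF tiling_prefix(1)[OF w]] by blast
  qed
  then show ?thesis using fg_ideal[OF fg] by blast
qed

text \<open>The path is cut at the fixed degree \<open>N\<close>, beyond which \<open>s\<close> is defined. That cutting at another segment in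
  the domain gives the same result is the compatibility of \<open>s\<close> with right multiplication.\<close>

lemma ess_action:
  assumes ne: "arrows C \<noteq> {}" and s: "s \<in> ess"
  shows "\<exists>f. \<forall>x y. s x = Some y \<longrightarrow> replaces f x y"
proof -
  have sR: "s \<in> carrier (RC C)" using s by (simp add: essential_part_def)
  obtain N where N: "\<And>x. x \<in> arrows C \<Longrightarrow> vec N \<le> deg C x \<Longrightarrow> x \<in> dom s"
    using ess_domain[OF ne s] by blast
  let ?N = "vec N :: nat ^ 'k"
  define f where "f w = prepend C (the (s (w 0 ?N))) (tshift ?N w)" for w
  have arr: "x \<in> arrows C" "y \<in> arrows C" "src C y = src C x" if "s x = Some y" for x y
    using that fg_arrow[OF RC_D(2)[OF sR]] fg_arrow[OF RC_D(3)[OF sR]] RC_D(4)[OF sR]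
    by (auto simp: dom_def ran_def)
  have key: "f (prepend C x u) = prepend C y u" if xy: "s x = Some y" and u: "u \<in> tilings_at C (src C x)" for x y u
  proof -
    note a = arr[OF xy]
    let ?w = "prepend C x u"
    have w: "?w \<in> tilings C" using prepend_tiling[OF a(1) u] .
    let ?x = "?w 0 ?N"
    have x': "?x \<in> arrows C" "deg C ?x = ?N" by (rule tiling_prefix(1)[OF w], rule tiling_prefix(2)[OF w])
    obtain y' where xy': "s ?x = Some y'" using N[OF x'(1)] x'(2) by auto
    note a' = arr[OF xy']
    have u': "tshift ?N ?w \<in> tilings_at C (src C ?x)" using tail_in[OF prefix_in_cyl[OF w]] x'(2) by metis
    let ?c = "u 0 ?N" and ?c' = "tshift ?N ?w 0 (deg C x)"
    have c: "?c \<in> arrows C" "tgt C ?c = src C x" "?c' \<in> arrows C" "tgt C ?c' = src C ?x"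
      using tiling_prefix(1) tilings_atD(1)[OF u] tilings_atD(1)[OF u'] tiling_at_src(2)[OF u]
        tiling_at_src(2)[OF u'] by auto
    have "x \<cdot> ?c = ?x \<cdot> ?c'"
      using prepend_prefix[OF a(1) u, of ?N] tshift_prefix[OF w, of ?N "deg C x"] by (simp add: add.commute)
    then have yc: "y \<cdot> ?c = y' \<cdot> ?c'"
      using RC_D(5)[OF sR xy c(1)] RC_D(5)[OF sR xy' c(3)] c by simp
    have uy: "u \<in> tilings_at C (src C y)" "tshift ?N ?w \<in> tilings_at C (src C y')" using u u' a a' by auto
    have "f ?w = prepend C y' (tshift ?N ?w)" by (simp add: f_def xy')
    also have "\<dots> = prepend C (y' \<cdot> ?c') (tshift (deg C x) (tshift ?N ?w))"
      using prepend_split[OF a'(2) uy(2)] by blast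
    also have "tshift (deg C x) (tshift ?N ?w) = tshift ?N u"
      using prepend_shift[OF a(1) u] tshift_tshift add.commute by metis
    also have "prepend C (y' \<cdot> ?c') (tshift ?N u) = prepend C y u"
      using prepend_split(2)[OF a(2) uy(1), of ?N] yc by simp
    finally show ?thesis .
  qed
  have "replaces f x y" if "s x = Some y" for x y
    using arr[OF that] key[OF that] unfolding replaces_def by simp
  then show ?thesis by blast
qed

lemma ess_induces:
  assumes ne: "arrows C \<noteq> {}" and s: "s \<in> ess"
  shows "\<exists>f\<in>full_group_maps. induces s f"
proof -
  let ?t = "partial_inverse s"
  have sR: "s \<in> carrier (RC C)" "bar (dom s)" "bar (ran s)" using s ess_iff[OF ne] by auto
  note inv = partial_inverse_iff[OF RC_D(1)[OF sR(1)]]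
  obtain f where f: "\<And>x y. s x = Some y \<Longrightarrow> replaces f x y" using ess_action[OF ne s] by blast
  obtain g where g: "\<And>x y. ?t x = Some y \<Longrightarrow> replaces g x y"
    using ess_action[OF ne ess_partial_inverse[OF ne s]] by blast
  have f_local: "\<exists>x y. s x = Some y \<and> w \<in> cyl x" if w: "w \<in> tilings C" for w
    using sR(2) w prefix_in_cyl[OF w] unfolding bar_def by (metis domD)
  have g_local: "\<exists>x y. s x = Some y \<and> w \<in> cyl y" if w: "w \<in> tilings C" for w
  proof -
    obtain n where "w 0 n \<in> ran s" using sR(3) w unfolding bar_def by blast
    then show ?thesis using prefix_in_cyl[OF w] unfolding ran_def by blast
  qed
  have fg: "f w \<in> tilings C" "g (f w) = w" if w: "w \<in> tilings C" for w
  proof -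
    obtain x y where xy: "s x = Some y" "w \<in> cyl x" using f_local[OF w] by blast
    have fw: "f w \<in> cyl y" "tshift (deg C y) (f w) = tshift (deg C x) w"
      using replaces_cyl[OF f[OF xy(1)] xy(2)] by auto
    show "f w \<in> tilings C" using fw cyl_subset_tilings by blast
    have r: "replaces g y x" using g inv xy(1) by blast
    show "g (f w) = w"
      using cyl_prepend[OF replaces_cyl(1)[OF r fw(1)]] replaces_cyl(2)[OF r fw(1)] fw(2) cyl_prepend[OF xy(2)]
      by simp
  qed
  have gf: "g w \<in> tilings C" "f (g w) = w" if w: "w \<in> tilings C" for w
  proof -
    obtain x y where xy: "s x = Some y" "w \<in> cyl y" using g_local[OF w] by blast
    have r: "replaces g y x" using g inv xy(1) by blast
    have gw: "g w \<in> cyl x" "tshift (deg C x) (g w) = tshift (deg C y) w"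
      using replaces_cyl[OF r xy(2)] by auto
    show "g w \<in> tilings C" using gw cyl_subset_tilings by blast
    show "f (g w) = w"
      using cyl_prepend[OF replaces_cyl(1)[OF f[OF xy(1)] gw(1)]] replaces_cyl(2)[OF f[OF xy(1)] gw(1)]
        gw(2) cyl_prepend[OF xy(2)] by simp
  qed
  let ?f = "restrict f (tilings C)"
  have res: "replaces ?f x y" if "s x = Some y" for x y
    using f[OF that] prepend_tiling by (simp add: replaces_def)
  have "bij_betw ?f (tilings C) (tilings C)"
    using fg gf by (intro bij_betw_byWitness[where f' = g]) auto
  then have "?f \<in> full_group_maps"
    unfolding full_group_maps_def Bij_def using res f_local by blast
  then show ?thesis using s res unfolding induces_def by blast
qed

text \<open>The morphism induced by \<open>f\<close> on all arrows of degree at least \<open>(N, \<dots>, N)\<close>. If \<open>N\<close> is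
  large enough, it lies below two given morphisms that act as \<open>f\<close>, so it witnesses that they are
  \<open>\<sigma>\<close>-related.\<close>

definition canonical :: "(('a, 'k) tiling \<Rightarrow> ('a, 'k) tiling) \<Rightarrow> nat \<Rightarrow> 'a \<rightharpoonup> 'a" where
  "canonical f N x = (if x \<in> arrows C \<and> vec N \<le> deg C x then Some (THE y. replaces f x y) else None)"

text \<open>The bound \<open>N\<close> works for all arrows at once by compactness.\<close>

lemma full_group_uniform:
  assumes f: "f \<in> full_group_maps"
  obtains N where "\<forall>x\<in>arrows C. vec N \<le> deg C x \<longrightarrow> (\<exists>y. replaces f x y \<and> vec M \<le> deg C y)"
proof -
  let ?U = "{x. \<exists>y. replaces f x y \<and> vec M \<le> deg C y}"
  have "\<exists>N. \<forall>x\<in>arrows C. vec N \<le> deg C x \<longrightarrow> (\<exists>u\<in>?U. x \<in> arrow_ideal C u)"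
  proof (rule bar_uniform)
    show "?U \<subseteq> arrows C" using replaces_arrows(1) by blast
    fix w assume w: "w \<in> tilings C"
    obtain x y where xy: "replaces f x y" "w \<in> cyl x" "vec M \<le> deg C y"
      using full_group_local[OF f w, of "vec M"] by metis
    have "w 0 (deg C x) \<in> arrow_ideal C x" using cyl_ideal[OF xy(2)] by simp
    then show "\<exists>n. \<exists>u\<in>?U. w 0 n \<in> arrow_ideal C u" using xy by blast
  qed
  then obtain N where N: "\<And>x. x \<in> arrows C \<Longrightarrow> vec N \<le> deg C x \<Longrightarrow> \<exists>u\<in>?U. x \<in> arrow_ideal C u" by blast
  have "\<exists>y. replaces f x y \<and> vec M \<le> deg C y" if x: "x \<in> arrows C" "vec N \<le> deg C x" for x
  proof -
    obtain u v where u: "replaces f u v" "vec M \<le> deg C v" "x \<in> arrow_ideal C u" using N[OF x] by blast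
    then obtain c where c: "c \<in> arrows C" "src C u = tgt C c" "x = u \<cdot> c" unfolding ideal_iff by blast
    have "deg C (v \<cdot> c) = deg C v + deg C c"
      using replaces_arrows[OF u(1)] c by (simp add: deg_cmp)
    then have "vec M \<le> deg C (v \<cdot> c)" using u(2) nat_vec_le_add(1) order_trans by metis
    then show ?thesis using replaces_cmp[OF u(1) c(1,2)] c(3) by blast
  qed
  then show thesis using that by blast
qed

lemma canonical_replaces:
  assumes "\<forall>x\<in>arrows C. vec N \<le> deg C x \<longrightarrow> (\<exists>y. replaces f x y)"
  shows "canonical f N x = Some y \<longleftrightarrow> replaces f x y \<and> vec N \<le> deg C x"
proof -
  have the: "(THE y. replaces f x y) = y" if "replaces f x y" for x y
    using that replaces_unique by (intro the_equality)
  show ?thesis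
    using assms the replaces_arrows(1) unfolding canonical_def by auto
qed

lemma canonical_induces:
  assumes ne: "arrows C \<noteq> {}" and f: "f \<in> full_group_maps"
    and N: "\<forall>x\<in>arrows C. vec N \<le> deg C x \<longrightarrow> (\<exists>y. replaces f x y)"
  shows "induces (canonical f N) f"
proof -
  let ?s = "canonical f N"
  note s = canonical_replaces[OF N]
  have fB: "f \<in> Bij (tilings C)" using f by (simp add: full_group_maps_def)
  have dom: "dom ?s = {x \<in> arrows C. vec N \<le> deg C x}"
    by (auto simp: canonical_def dom_def)
  let ?D = "{x \<in> arrows C. deg C x = vec N}"
  have split: "\<exists>x0\<in>?D. \<exists>c\<in>arrows C. src C x0 = tgt C c \<and> x = x0 \<cdot> c" if "x \<in> arrows C" "vec N \<le> deg C x" for x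
    using factorization[OF that] by blast
  have up: "vec N \<le> deg C y" if "x \<in> arrows C" "vec N \<le> deg C x" "y \<in> arrow_ideal C x" for x y
    using ideal_deg[OF that(1,3)] that(2) by simp
  have dom_ideal: "y \<in> dom ?s" if "x \<in> dom ?s" "y \<in> arrow_ideal C x" for x y
  proof -
    have x: "x \<in> arrows C" "vec N \<le> deg C x" using that(1) unfolding dom by auto
    show ?thesis unfolding dom using ideal_arrow[OF x(1) that(2)] up[OF x that(2)] by simp
  qed
  have "x \<in> set_ideal C ?D" if x: "x \<in> dom ?s" for x
  proof -
    have xa: "x \<in> arrows C" "vec N \<le> deg C x" using x unfolding dom by auto
    obtain x0 c where c: "x0 \<in> ?D" "c \<in> arrows C" "src C x0 = tgt C c" "x = x0 \<cdot> c"
      using split[OF xa] by blast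
    then have "x \<in> arrow_ideal C x0" using ideal_cmp by simp
    then show ?thesis unfolding set_ideal_def by (rule UN_I[OF c(1)])
  qed
  moreover have "x \<in> dom ?s" if x: "x \<in> set_ideal C ?D" for x
  proof -
    obtain x0 where x0: "x0 \<in> ?D" "x \<in> arrow_ideal C x0" using x unfolding set_ideal_def by blast
    then have "x0 \<in> dom ?s" unfolding dom by simp
    then show ?thesis using dom_ideal x0(2) by blast
  qed
  ultimately have "dom ?s = set_ideal C ?D" by blast
  moreover have "right_ideal C (dom ?s)"
    unfolding right_ideal_def set_ideal_def
  proof (intro conjI UN_least subsetI)
    show "x \<in> arrows C" if "x \<in> dom ?s" for x using that unfolding dom by blast
  qed (rule dom_ideal)
  ultimately have fgd: "fg_right_ideal C (dom ?s)"
    unfolding fg_right_ideal_def using finite_degree[of "vec N"] by (intro conjI exI[of _ ?D]) auto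
  have ran: "ran ?s = {y. \<exists>x. replaces f x y \<and> vec N \<le> deg C x}"
    unfolding ran_def s by blast
  have ran_cmp: "y \<cdot> c \<in> ran ?s" if y: "y \<in> ran ?s" and that: "c \<in> arrows C" "src C y = tgt C c" for y c
  proof -
    obtain x where x: "replaces f x y" "vec N \<le> deg C x" using y unfolding ran by blast
    have xa: "x \<in> arrows C" "src C x = tgt C c" using replaces_arrows[OF x(1)] that(2) by auto
    have "vec N \<le> deg C (x \<cdot> c)" using up[OF xa(1) x(2) ideal_cmp[OF xa(1) that(1) xa(2)]] .
    then show ?thesis using replaces_cmp[OF x(1) that(1) xa(2)] unfolding ran by blast
  qed
  have ran_ideal: "z \<in> ran ?s" if "y \<in> ran ?s" "z \<in> arrow_ideal C y" for y z
    using ran_cmp[OF that(1)] that(2) unfolding ideal_iff by blast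
  have rana: "ran ?s \<subseteq> arrows C" using replaces_arrows(2) unfolding ran by blast
  let ?Y = "(\<lambda>x. the (?s x)) ` ?D"
  have Y: "?Y \<subseteq> ran ?s" 
  proof (rule image_subsetI)
    fix x assume "x \<in> ?D"
    then have "x \<in> dom ?s" unfolding dom by simp
    then obtain y where "?s x = Some y" by blast
    then show "the (?s x) \<in> ran ?s" unfolding ran_def by auto
  qed
  have "ran ?s = set_ideal C ?Y"
  proof
    show "set_ideal C ?Y \<subseteq> ran ?s"
      unfolding set_ideal_def using Y ran_ideal by blast
    show "ran ?s \<subseteq> set_ideal C ?Y"
    proof
      fix y assume "y \<in> ran ?s"
      then obtain x where x: "replaces f x y" "vec N \<le> deg C x" unfolding ran by blast
      obtain x0 c where c: "x0 \<in> ?D" "c \<in> arrows C" "src C x0 = tgt C c" "x = x0 \<cdot> c"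
        using split[OF replaces_arrows(1)[OF x(1)] x(2)] by blast
      obtain y0 where y0: "replaces f x0 y0" using N c(1) by auto
      have sy0: "?s x0 = Some y0" using s y0 c(1) by simp
      have "y = y0 \<cdot> c"
        using replaces_unique[OF x(1)] replaces_cmp[OF y0 c(2,3)] c(4) by simp
      moreover have "src C y0 = tgt C c" using replaces_arrows(3)[OF y0] c(3) by simp
      ultimately have "y \<in> arrow_ideal C y0" using c(2) unfolding ideal_iff by blast
      moreover have "y0 \<in> ?Y" using c(1) sy0 by force
      ultimately show "y \<in> set_ideal C ?Y" unfolding set_ideal_def by blast
    qed
  qed
  moreover have "right_ideal C (ran ?s)"
    unfolding right_ideal_def set_ideal_def using rana ran_ideal by blast
  moreover have "finite ?Y" "?Y \<subseteq> arrows C" using finite_degree Y rana by auto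
  ultimately have fgr: "fg_right_ideal C (ran ?s)" unfolding fg_right_ideal_def by blast
  have sR: "?s \<in> carrier (RC C)"
  proof (rule RC_I[OF _ fgd fgr])
    show "injective_partial ?s"
      unfolding injective_partial_def s
      using replaces_inverse[OF fB] replaces_unique by blast
    show "src C y = src C x" if "?s x = Some y" for x y using that s replaces_arrows(3) by metis
    show "?s (x \<cdot> c) = Some (y \<cdot> c)" if "?s x = Some y" "c \<in> arrows C" "src C x = tgt C c" for x y c
    proof -
      have xy: "replaces f x y" "vec N \<le> deg C x" using that(1) s by auto
      have xa: "x \<in> arrows C" using replaces_arrows[OF xy(1)] by blast
      show ?thesis
        using s replaces_cmp[OF xy(1) that(2,3)] up[OF xa xy(2) ideal_cmp[OF xa that(2,3)]] by blast
    qed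
  qed
  have "bar (dom ?s)" unfolding bar_def dom
  proof
    fix w assume w: "w \<in> tilings C"
    show "\<exists>n. w 0 n \<in> {x \<in> arrows C. vec N \<le> deg C x}"
      using tiling_prefix(1,2)[OF w] by (intro exI[of _ "vec N"]) simp
  qed
  moreover have "bar (ran ?s)" unfolding bar_def
  proof
    fix w assume w: "w \<in> tilings C"
    have "f ` tilings C = tilings C" using fB by (simp add: Bij_def bij_betw_def)
    then obtain v where v: "v \<in> tilings C" "w = f v" using w by blast
    have x: "v 0 (vec N) \<in> arrows C" "deg C (v 0 (vec N)) = vec N"
      by (rule tiling_prefix(1)[OF v(1)], rule tiling_prefix(2)[OF v(1)])
    then obtain y where y: "replaces f (v 0 (vec N)) y" using N by auto
    have "w 0 (deg C y) = y" using replaces_cyl(1)[OF y prefix_in_cyl[OF v(1)]] v(2) by (simp add: cyl_def)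
    moreover have "y \<in> ran ?s" unfolding ran using y x(2) by (metis (mono_tags, lifting) mem_Collect_eq order_refl)
    ultimately show "\<exists>n. w 0 n \<in> ran ?s" by metis
  qed
  ultimately have "?s \<in> ess" using ess_iff[OF ne] sR by blast
  then show ?thesis unfolding induces_def s by blast
qed

lemma induces_unique:
  assumes ne: "arrows C \<noteq> {}" and "induces s f" "induces s g" "f \<in> full_group_maps" "g \<in> full_group_maps"
  shows "f = g"
proof (rule full_group_eqI[OF assms(4,5)])
  fix w assume w: "w \<in> tilings C"
  have "bar (dom s)" using assms(2) ess_iff[OF ne] unfolding induces_def by blast
  then obtain n y where y: "s (w 0 n) = Some y" using w unfolding bar_def by blast
  then have "replaces f (w 0 n) y" "replaces g (w 0 n) y" using assms(2,3) unfolding induces_def by blast+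
  then show "f w = g w"
    using cyl_prepend[OF prefix_in_cyl[OF w]] tail_in[OF prefix_in_cyl[OF w]] unfolding replaces_def by metis
qed

lemma induces_sigma:
  assumes ne: "arrows C \<noteq> {}" and f: "f \<in> full_group_maps" and s: "induces s f"
  shows "(s, t) \<in> sigma_congruence (essential_part (RC C)) \<longleftrightarrow> induces t f"
proof
  assume t: "induces t f"
  have se: "s \<in> ess" "t \<in> ess" using s t by (auto simp: induces_def)
  obtain N1 where N1: "\<forall>x\<in>arrows C. vec N1 \<le> deg C x \<longrightarrow> x \<in> dom s" using ess_domain[OF ne se(1)] by blast
  obtain N2 where N2: "\<forall>x\<in>arrows C. vec N2 \<le> deg C x \<longrightarrow> x \<in> dom t" using ess_domain[OF ne se(2)] by blast
  let ?N = "max N1 N2"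
  have le: "vec N1 \<le> d" "vec N2 \<le> d" if "vec ?N \<le> d" for d :: "nat ^ 'k"
    using order_trans[OF vec_nat_mono that] by auto
  have d: "x \<in> dom s" "x \<in> dom t" if "x \<in> arrows C" "vec ?N \<le> deg C x" for x using that le N1 N2 by blast+
  have N: "\<forall>x\<in>arrows C. vec ?N \<le> deg C x \<longrightarrow> (\<exists>y. replaces f x y)"
    using d(1) s unfolding induces_def by blast
  have z: "canonical f ?N \<in> ess" using canonical_induces[OF ne f N] by (simp add: induces_def)
  have below: "r x = Some y" if r: "induces r f" "\<And>x. x \<in> arrows C \<Longrightarrow> vec ?N \<le> deg C x \<Longrightarrow> x \<in> dom r"
      and xy: "canonical f ?N x = Some y" for r x y
  proof -
    have c: "replaces f x y" "vec ?N \<le> deg C x" using xy canonical_replaces[OF N] by auto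
    obtain y' where y': "r x = Some y'" using r(2)[OF replaces_arrows(1)[OF c(1)] c(2)] by blast
    then have "replaces f x y'" using r(1) unfolding induces_def by blast
    then show ?thesis using replaces_unique[OF c(1)] y' by simp
  qed
  have "isg_le (essential_part (RC C)) (canonical f ?N) s" "isg_le (essential_part (RC C)) (canonical f ?N) t"
    unfolding ess_le_iff[OF ne z] using below[OF s d(1)] below[OF t d(2)] by blast+
  then show "(s, t) \<in> sigma_congruence (essential_part (RC C))"
    unfolding sigma_congruence_def using se z by blast
next
  assume "(s, t) \<in> sigma_congruence (essential_part (RC C))"
  then obtain z where z: "z \<in> ess" "isg_le (essential_part (RC C)) z s" "isg_le (essential_part (RC C)) z t"
      and t: "t \<in> ess" unfolding sigma_congruence_def by blast
  obtain g where g: "g \<in> full_group_maps" "induces t g" using ess_induces[OF ne t] by blast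
  have "induces z f" using z(1,2) s unfolding ess_le_iff[OF ne z(1)] induces_def by blast
  moreover have "induces z g" using z(1,3) g(2) unfolding ess_le_iff[OF ne z(1)] induces_def by blast
  ultimately have "f = g" using induces_unique[OF ne _ _ f g(1)] by blast
  then show "induces t f" using g(2) by simp
qed

lemma induces_exists:
  assumes ne: "arrows C \<noteq> {}" and f: "f \<in> full_group_maps" shows "\<exists>s. induces s f"
proof -
  obtain N where "\<forall>x\<in>arrows C. vec N \<le> deg C x \<longrightarrow> (\<exists>y. replaces f x y \<and> vec 0 \<le> deg C y)"
    by (rule full_group_uniform[OF f])
  then have "\<forall>x\<in>arrows C. vec N \<le> deg C x \<longrightarrow> (\<exists>y. replaces f x y)" by blast
  then show ?thesis using canonical_induces[OF ne f] by blast
qed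

lemma induces_comp:
  assumes "induces s f" "induces t g" "s \<circ>\<^sub>m t \<in> ess"
  shows "induces (s \<circ>\<^sub>m t) (compose (tilings C) f g)"
  unfolding induces_def
proof (intro conjI allI impI assms(3))
  fix x z assume "(s \<circ>\<^sub>m t) x = Some z"
  then obtain y where "t x = Some y" "s y = Some z" unfolding map_comp_Some_iff by blast
  then have "replaces g x y" "replaces f y z" using assms(1,2) unfolding induces_def by blast+
  then show "replaces (compose (tilings C) f g) x z" by (rule replaces_compose)
qed

text \<open>One product inside the essential part is enough, since the product of two classes in \<^const>\<open>GC\<close> is a
  union over all representatives in which products outside the essential part contribute nothing.\<close>

lemma canonical_comp:
  assumes ne: "arrows C \<noteq> {}" and f: "f \<in> full_group_maps" and g: "g \<in> full_group_maps"
  shows "\<exists>s t. induces s f \<and> induces t g \<and> s \<circ>\<^sub>m t \<in> ess"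
proof -
  obtain M where "\<forall>x\<in>arrows C. vec M \<le> deg C x \<longrightarrow> (\<exists>y. replaces f x y \<and> vec 0 \<le> deg C y)"
    by (rule full_group_uniform[OF f])
  then have M: "\<forall>x\<in>arrows C. vec M \<le> deg C x \<longrightarrow> (\<exists>y. replaces f x y)" by blast
  obtain N where N: "\<forall>x\<in>arrows C. vec N \<le> deg C x \<longrightarrow> (\<exists>y. replaces g x y \<and> vec M \<le> deg C y)"
    by (rule full_group_uniform[OF g])
  have N': "\<forall>x\<in>arrows C. vec N \<le> deg C x \<longrightarrow> (\<exists>y. replaces g x y)" using N by blast
  let ?h = "compose (tilings C) f g"
  have h: "\<forall>x\<in>arrows C. vec N \<le> deg C x \<longrightarrow> (\<exists>y. replaces ?h x y)"
    using N M replaces_compose replaces_arrows(2) by meson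
  have "canonical f M \<circ>\<^sub>m canonical g N = canonical ?h N"
  proof
    fix x
    show "(canonical f M \<circ>\<^sub>m canonical g N) x = canonical ?h N x"
    proof (cases "x \<in> arrows C \<and> vec N \<le> deg C x")
      case True
      obtain y where y: "replaces g x y" "vec M \<le> deg C y" using N True by blast
      obtain z where z: "replaces f y z" using M y replaces_arrows(2) by blast
      have "canonical g N x = Some y" using canonical_replaces[OF N'] y True by blast
      moreover have "canonical f M y = Some z" using canonical_replaces[OF M] y z by blast
      moreover have "canonical ?h N x = Some z"
        using canonical_replaces[OF h] replaces_compose[OF y(1) z] True by blast
      ultimately show ?thesis by (simp add: map_comp_def)
    next
      case False
      then have "canonical g N x = None" "canonical ?h N x = None" by (auto simp: canonical_def)
      then show ?thesis by (simp add: map_comp_def)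
    qed
  qed
  then show ?thesis
    using canonical_induces[OF ne f M] canonical_induces[OF ne g N']
      canonical_induces[OF ne compose_full_group[OF f g] h] unfolding induces_def by metis
qed

text \<open>The class of morphisms corresponding to \<open>f\<close> consists of those that act as \<open>f\<close>.\<close>

theorem full_group_iso_GC:
  assumes ne: "arrows C \<noteq> {}"
  shows "full_group \<cong> GC C"
proof (rule is_isoI[OF isoI])
  let ?cls = "\<lambda>f. {s. induces s f}"
  let ?\<sigma> = "sigma_congruence (essential_part (RC C))"
  have cls: "?\<sigma> `` {s} = ?cls f" if "f \<in> full_group_maps" "induces s f" for s f
    using induces_sigma[OF ne that] by blast
  have carrier: "carrier (GC C) = ?cls ` full_group_maps"
  proof -
    have "carrier (GC C) = {?\<sigma> `` {s} | s. s \<in> ess}"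
      by (auto simp: GC_def quotient_monoid_def quotient_def)
    also have "\<dots> = ?cls ` full_group_maps"
    proof
      show "{?\<sigma> `` {s} | s. s \<in> ess} \<subseteq> ?cls ` full_group_maps"
      proof clarify
        fix s assume "s \<in> ess"
        then obtain f where "f \<in> full_group_maps" "induces s f" using ess_induces[OF ne] by blast
        then show "?\<sigma> `` {s} \<in> ?cls ` full_group_maps" using cls by (intro image_eqI[of _ _ f])
      qed
      show "?cls ` full_group_maps \<subseteq> {?\<sigma> `` {s} | s. s \<in> ess}"
      proof (rule image_subsetI)
        fix f assume f: "f \<in> full_group_maps"
        then obtain s where s: "induces s f" using induces_exists[OF ne] by blast
        then have "s \<in> ess" by (simp add: induces_def)
        then show "?cls f \<in> {?\<sigma> `` {s} | s. s \<in> ess}" using cls[OF f s] by blast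
      qed
    qed
    finally show ?thesis .
  qed
  have inj: "inj_on ?cls full_group_maps"
  proof (rule inj_onI)
    fix f g assume fg: "f \<in> full_group_maps" "g \<in> full_group_maps" "?cls f = ?cls g"
    obtain s where "induces s f" using induces_exists[OF ne fg(1)] by blast
    then show "f = g" using fg induces_unique[OF ne, of s f g] by blast
  qed
  show "bij_betw ?cls (carrier full_group) (carrier (GC C))"
    using inj by (simp add: bij_betw_def full_group_carrier carrier)
  show "?cls \<in> hom full_group (GC C)"
  proof (rule homI)
    fix f assume "f \<in> carrier full_group"
    then show "?cls f \<in> carrier (GC C)" by (auto simp: carrier full_group_carrier)
  next
    fix f g assume "f \<in> carrier full_group" "g \<in> carrier full_group"
    then have fg: "f \<in> full_group_maps" "g \<in> full_group_maps" by (auto simp: full_group_carrier)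
    let ?h = "compose (tilings C) f g"
    have h: "?h \<in> full_group_maps" by (rule compose_full_group[OF fg])
    have product: "?\<sigma> `` {s \<circ>\<^sub>m t} = (if s \<circ>\<^sub>m t \<in> ess then ?cls ?h else {})"
      if "induces s f" "induces t g" for s t
    proof (cases "s \<circ>\<^sub>m t \<in> ess")
      case True
      then show ?thesis using cls[OF h induces_comp[OF that]] by simp
    qed (auto simp: sigma_congruence_def)
    have "?cls f \<otimes>\<^bsub>GC C\<^esub> ?cls g = (\<Union>s\<in>?cls f. \<Union>t\<in>?cls g. ?\<sigma> `` {s \<circ>\<^sub>m t})"
      by (simp add: GC_def quotient_monoid_def ess_mult)
    also have "\<dots> = ?cls ?h"
    proof (intro equalityI UN_least)
      fix s t assume st: "s \<in> ?cls f" "t \<in> ?cls g"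
      show "?\<sigma> `` {s \<circ>\<^sub>m t} \<subseteq> ?cls ?h" using product[of s t] st by simp
    next
      obtain s t where st: "induces s f" "induces t g" "s \<circ>\<^sub>m t \<in> ess" using canonical_comp[OF ne fg] by blast
      then have "?\<sigma> `` {s \<circ>\<^sub>m t} = ?cls ?h" using product[OF st(1,2)] by simp
      then show "?cls ?h \<subseteq> (\<Union>s\<in>?cls f. \<Union>t\<in>?cls g. ?\<sigma> `` {s \<circ>\<^sub>m t})" using st(1,2) by blast
    qed
    finally show "?cls (f \<otimes>\<^bsub>full_group\<^esub> g) = ?cls f \<otimes>\<^bsub>GC C\<^esub> ?cls g"
      by (simp add: full_group_mult[OF fg])
  qed
qed

end

lemma infinite_BC_nonempty:
  assumes "infinite (carrier (BC C))" shows "arrows C \<noteq> {}"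
proof
  assume empty: "arrows C = {}"
  have "carrier (RC C) \<subseteq> {Map.empty}"
    using empty by (auto simp: RC_def fg_right_ideal_def right_ideal_def bij_morphism_def)
  then have "finite (carrier (BC C))"
    by (auto simp: BC_def quotient_monoid_def quotient_def dest: finite_subset)
  then show False using assms by contradiction
qed

section \<open>Homology of path groupoids\<close>

theorem corollary9p2:
  fixes C :: "('a, 'k::finite) hrg" and C' :: "('b, 'l::finite) hrg"
  assumes "higher_rank_graph C" and "higher_rank_graph C'"
    and "row_finite C" and "row_finite C'"
    and "aperiodic_cat C" and "aperiodic_cat C'"
    and "cofinal_cat C" and "cofinal_cat C'"
    and "finite (idents C)" and "finite (idents C')"
    and "no_sources C" and "no_sources C'"
    and "countable (carrier (BC C))" and "infinite (carrier (BC C))"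
    and "countable (carrier (BC C'))" and "infinite (carrier (BC C'))"
    and "GC C \<cong> GC C'"
  shows "\<forall>n. groupoid_homology (path_groupoid C) n \<cong> groupoid_homology (path_groupoid C') n"
proof
  fix n
  interpret C: path_graph C using assms by (intro path_graph.intro path_graph_axioms.intro)
  interpret C': path_graph C' using assms by (intro path_graph.intro path_graph_axioms.intro)
  have "C.full_group \<cong> GC C"
    by (rule C.full_group_iso_GC[OF infinite_BC_nonempty[OF assms(14)]])
  also note \<open>GC C \<cong> GC C'\<close>
  also have "GC C' \<cong> C'.full_group"
    by (rule group.iso_sym[OF C'.group_full_group
          C'.full_group_iso_GC[OF infinite_BC_nonempty[OF assms(16)]]])
  finally have "C.full_group \<cong> C'.full_group" .
  then obtain h where h: "h \<in> iso C.full_group C'.full_group" unfolding is_iso_def by blast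
  define h' where "h' = inv_into (carrier C.full_group) h"
  have h': "h' \<in> iso C'.full_group C.full_group"
    unfolding h'_def by (rule group.iso_set_sym[OF C.group_full_group h])
  interpret isomorphic_germ_groupoids
    C.full_group C.path_topology "\<lambda>f. f" "path_groupoid C" C.germ
    C'.full_group C'.path_topology "\<lambda>f. f" "path_groupoid C'" C'.germ h h'
  proof (intro isomorphic_germ_groupoids.intro isomorphic_full_actions.intro
      isomorphic_full_actions_axioms.intro C.germ_groupoid_axioms C'.germ_groupoid_axioms
      C.full_action_axioms C'.full_action_axioms h h')
    show "h' (h g) = g" if "g \<in> carrier C.full_group" for g
      using that h unfolding h'_def by (simp add: iso_iff inv_into_f_f)
    show "h (h' g) = g" if "g \<in> carrier C'.full_group" for g
      using that h unfolding h'_def by (simp add: iso_iff f_inv_into_f)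
  qed
  interpret top_groupoid_iso "path_groupoid C" "path_groupoid C'" germ_map inv.germ_map
    by (rule germ_map_iso)
  show "groupoid_homology (path_groupoid C) n \<cong> groupoid_homology (path_groupoid C') n"
    by (rule homology_iso)
qed

end
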